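(* Let $\chi:\mathfrak{Z}(H)\to k$ be a character (closed point of $\operatorname{Spec}\mathfrak{Z}(H)$) with $\chi(e^p)=0$. (1) If $\chi(x^p)\neq 0$, then $M_\chi=H_\chi\otimes_{N_\chi}k_\chi$ is the irreducible $H_\chi$-module of dimension $p^2$. (2) If $\chi(x^p)=0$ and $\chi(y^p)\ne 0$, then $M_\chi=H_\chi\otimes_{B_\chi}k_\chi'$ is the irreducible $H_\chi$-module of dimension $p^2$. (3) If $\chi(x^p)=\chi(y^p)=0$, then any irreducible $H_\chi$-module is an irreducible $\mathfrak{sl}_2$-module on which $x,y$ act as $0$.
   Context: $k$ is an algebraically closed field of characteristic $p>2$. $\mathfrak{g}=\mathfrak{sl}_2$ over $k$ with standard basis $e,f,h$; $V$ is its natural 2-dimensional representation with basis $x,y$ such that $ex=0$, $fx=y$, $ey=x$, $fy=0$, $hx=x$, $hy=-y$. $H=\mathfrak{U}(\mathfrak{g}\ltimes V)$ is the enveloping algebra of the semidirect product (with $[x,y]=0$), and $\mathfrak{Z}(H)$ is its center; it contains $e^p,f^p,h^p-h,x^p,y^p$. For a character $\chi:\mathfrak{Z}(H)\to k$, $H_\chi=H/(\ker\chi)H$ is the fiber of $H$ at $\chi$. $N_\chi\subset H_\chi$ is the subalgebra generated by $f,y$, and $k_\chi=kv$ is its one-dimensional representation with $f^pv=\chi(f^p)v$, $y^pv=\chi(y^p)v$ (i.e. $f$ and $y$ act on $v$ by the $p$-th roots of $\chi(f^p)$ and $\chi(y^p)$). $B_\chi\subset H_\chi$ is the subalgebra generated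 by $e,x,h$, and $k_\chi'=kv$ is a one-dimensional representation of it with $ev=xv=0$, $hv=\lambda v$, where $\lambda\in k$ satisfies $\lambda^p-\lambda=\chi(h^p-h)$.
   Formalization: In (1), M_χ is claimed to be the irreducible module only if χ(f^p)≠0 or χ(y^p)≠0; if χ(f^p)=χ(y^p)=0 the claim as printed is false (M_χ is reducible), and only the existence and uniqueness of an irreducible H_χ-module of dimension p^2 is stated. *)

theory Defs
  imports
    "HOL-Algebra.QuotRing"
    "HOL-Algebra.Ideal_Product"
    "HOL-Algebra.Generated_Rings"
    "HOL-Algebra.Module"
    "HOL-Algebra.Free_Abelian_Groups"
    "HOL-Algebra.Algebraic_Closure_Type"
    "HOL-Analysis.Determinants"
begin

section \<open>Associative algebras over a field\<close>

text \<open>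
  A (not necessarily commutative) algebra over the field \<open>'k\<close> is carried by the record
  \<^typ>\<open>('k, 'a) module\<close>: its ring fields are the ring structure and
  \<^const>\<open>smult\<close> is the action of \<open>'k\<close>.
\<close>

definition quot_alg :: "('k, 'a) module \<Rightarrow> 'a set \<Rightarrow> ('k, 'a set) module" where
  "quot_alg A I =
     \<lparr>carrier = carrier (A Quot I), monoid.mult = monoid.mult (A Quot I),
      monoid.one = monoid.one (A Quot I), ring.zero = ring.zero (A Quot I),
      ring.add = ring.add (A Quot I),
      module.smult = (\<lambda>c C. \<Union>a\<in>C. I +>\<^bsub>A\<^esub> (c \<odot>\<^bsub>A\<^esub> a))\<rparr>"

definition alg_center :: "('k, 'a) module \<Rightarrow> 'a set" where
  "alg_center A = {z \<in> carrier A. \<forall>a\<in>carrier A. z \<otimes>\<^bsub>A\<^esub> a = a \<otimes>\<^bsub>A\<^esub> z}"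

definition subalg_gen :: "('k, 'a) module \<Rightarrow> 'a set \<Rightarrow> 'a set" where
  "subalg_gen A S = generate_ring A (S \<union> range (\<lambda>c. c \<odot>\<^bsub>A\<^esub> \<one>\<^bsub>A\<^esub>))"

text \<open>Unital algebra homomorphisms to the ground field.\<close>

definition alg_character :: "('k::field, 'a) module \<Rightarrow> ('a \<Rightarrow> 'k) \<Rightarrow> bool" where
  "alg_character A \<rho> \<longleftrightarrow>
     \<rho> \<in> ring_hom A ring_of_type_algebra \<and>
     (\<forall>c. \<forall>a\<in>carrier A. \<rho> (c \<odot>\<^bsub>A\<^esub> a) = c * \<rho> a)"

section \<open>Left modules over noncommutative rings\<close>

text \<open>
  The library's locale \<^locale>\<open>module\<close> requires a commutative ring of scalars. As there, the
  fields \<open>mult\<close> and \<open>one\<close> of the record carrying a module are irrelevant.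
\<close>

locale left_module = A?: ring A + M?: abelian_group M
  for A :: "('a, 'x) ring_scheme" (structure) and M :: "('a, 'm) module" (structure) +
  assumes smult_closed: "a \<in> carrier A \<Longrightarrow> m \<in> carrier M \<Longrightarrow> a \<odot>\<^bsub>M\<^esub> m \<in> carrier M"
    and smult_l_distr: "a \<in> carrier A \<Longrightarrow> b \<in> carrier A \<Longrightarrow> m \<in> carrier M \<Longrightarrow>
          (a \<oplus>\<^bsub>A\<^esub> b) \<odot>\<^bsub>M\<^esub> m = a \<odot>\<^bsub>M\<^esub> m \<oplus>\<^bsub>M\<^esub> b \<odot>\<^bsub>M\<^esub> m"
    and smult_r_distr: "a \<in> carrier A \<Longrightarrow> m \<in> carrier M \<Longrightarrow> n \<in> carrier M \<Longrightarrow>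
          a \<odot>\<^bsub>M\<^esub> (m \<oplus>\<^bsub>M\<^esub> n) = a \<odot>\<^bsub>M\<^esub> m \<oplus>\<^bsub>M\<^esub> a \<odot>\<^bsub>M\<^esub> n"
    and smult_assoc: "a \<in> carrier A \<Longrightarrow> b \<in> carrier A \<Longrightarrow> m \<in> carrier M \<Longrightarrow>
          (a \<otimes>\<^bsub>A\<^esub> b) \<odot>\<^bsub>M\<^esub> m = a \<odot>\<^bsub>M\<^esub> (b \<odot>\<^bsub>M\<^esub> m)"
    and smult_one: "m \<in> carrier M \<Longrightarrow> \<one>\<^bsub>A\<^esub> \<odot>\<^bsub>M\<^esub> m = m"

definition irreducible_module ::
    "('a, 'x) ring_scheme \<Rightarrow> ('a, 'm) module \<Rightarrow> bool" where
  "irreducible_module A M \<longleftrightarrow>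
     left_module A M \<and> carrier M \<noteq> {\<zero>\<^bsub>M\<^esub>} \<and>
     (\<forall>N. submodule N A M \<longrightarrow> N = {\<zero>\<^bsub>M\<^esub>} \<or> N = carrier M)"

definition iso_modules ::
    "('a, 'x) ring_scheme \<Rightarrow> ('a, 'm) module \<Rightarrow> ('a, 'n) module \<Rightarrow> bool" where
  "iso_modules A M N \<longleftrightarrow>
     (\<exists>\<phi>. bij_betw \<phi> (carrier M) (carrier N) \<and>
        (\<forall>m\<in>carrier M. \<forall>m'\<in>carrier M. \<phi> (m \<oplus>\<^bsub>M\<^esub> m') = \<phi> m \<oplus>\<^bsub>N\<^esub> \<phi> m') \<and>
        (\<forall>a\<in>carrier A. \<forall>m\<in>carrier M. \<phi> (a \<odot>\<^bsub>M\<^esub> m) = a \<odot>\<^bsub>N\<^esub> \<phi> m))"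

text \<open>The vector space underlying a module over an algebra.\<close>

definition underlying_space :: "('k, 'a) module \<Rightarrow> ('a, 'm) module \<Rightarrow> ('k, 'm) module" where
  "underlying_space A M =
     \<lparr>carrier = carrier M, monoid.mult = monoid.mult M, monoid.one = monoid.one M,
      ring.zero = ring.zero M, ring.add = ring.add M,
      module.smult = (\<lambda>c m. (c \<odot>\<^bsub>A\<^esub> \<one>\<^bsub>A\<^esub>) \<odot>\<^bsub>M\<^esub> m)\<rparr>"

text \<open>The vector space \<open>V\<close> has a basis of \<open>n\<close> vectors.\<close>

definition has_dimension :: "('k::field, 'v) module \<Rightarrow> nat \<Rightarrow> bool" where
  "has_dimension V n \<longleftrightarrow>
     (\<exists>b. (\<forall>i<n. b i \<in> carrier V) \<and>
        (\<forall>v\<in>carrier V. \<exists>!c. (\<forall>i\<ge>n. c i = 0) \<and>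
            v = (\<Oplus>\<^bsub>V\<^esub>i\<in>{..<n}. c i \<odot>\<^bsub>V\<^esub> b i)))"

text \<open>
  \<open>M\<close> is an irreducible \<open>A\<close>-module of dimension \<open>n\<close>, and every irreducible \<open>A\<close>-module (with
  carrier in the type \<open>'w\<close>) is isomorphic to it.
\<close>

definition the_irreducible_module ::
    "'w itself \<Rightarrow> ('k::field, 'a) module \<Rightarrow> nat \<Rightarrow> ('a, 'm) module \<Rightarrow> bool" where
  "the_irreducible_module _ A n M \<longleftrightarrow>
     irreducible_module A M \<and> has_dimension (underlying_space A M) n \<and>
     (\<forall>W :: ('a, 'w) module. irreducible_module A W \<longrightarrow> iso_modules A W M)"

text \<open>The one-dimensional module on which an algebra acts through a character.\<close>

definition character_module :: "('a \<Rightarrow> 'k::field) \<Rightarrow> ('a, 'k) module" where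
  "character_module \<rho> =
     \<lparr>carrier = UNIV, monoid.mult = (*), monoid.one = 1, ring.zero = 0, ring.add = (+),
      module.smult = (\<lambda>a t. \<rho> a * t)\<rparr>"

text \<open>
  The left \<open>A\<close>-module \<open>A \<otimes>\<^sub>B W\<close> for a subring \<open>B\<close> of \<open>A\<close> and a left \<open>B\<close>-module \<open>W\<close>: the quotient
  of the free abelian group on \<open>A \<times> W\<close> by the relations of biadditivity and \<open>B\<close>-balancedness.
\<close>

definition tensor_rels ::
    "('a, 'x) ring_scheme \<Rightarrow> 'a set \<Rightarrow> ('a, 'w) module \<Rightarrow> ('a \<times> 'w \<Rightarrow>\<^sub>0 int) set" where
  "tensor_rels A B W =
     {frag_of (a \<oplus>\<^bsub>A\<^esub> a', w) - frag_of (a, w) - frag_of (a', w) | a a' w.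
        a \<in> carrier A \<and> a' \<in> carrier A \<and> w \<in> carrier W} \<union>
     {frag_of (a, w \<oplus>\<^bsub>W\<^esub> w') - frag_of (a, w) - frag_of (a, w') | a w w'.
        a \<in> carrier A \<and> w \<in> carrier W \<and> w' \<in> carrier W} \<union>
     {frag_of (a \<otimes>\<^bsub>A\<^esub> b, w) - frag_of (a, b \<odot>\<^bsub>W\<^esub> w) | a b w.
        a \<in> carrier A \<and> b \<in> B \<and> w \<in> carrier W}"

definition tensor_module ::
    "('a, 'x) ring_scheme \<Rightarrow> 'a set \<Rightarrow> ('a, 'w) module \<Rightarrow> ('a, ('a \<times> 'w \<Rightarrow>\<^sub>0 int) set) module"
  where
  "tensor_module A B W =
     (let F = free_Abelian_group (carrier A \<times> carrier W);
          R = generate F (tensor_rels A B W)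
      in \<lparr>carrier = carrier (F Mod R), monoid.mult = undefined, monoid.one = undefined,
          ring.zero = monoid.one (F Mod R), ring.add = monoid.mult (F Mod R),
          module.smult = (\<lambda>a C. \<Union>t\<in>C. R #>\<^bsub>F\<^esub> frag_extend (\<lambda>(a', w). frag_of (a \<otimes>\<^bsub>A\<^esub> a', w)) t)\<rparr>)"

section \<open>Universal enveloping algebras\<close>

text \<open>
  A Lie algebra is given by its carrier \<open>L\<close> (a subspace of the additive group of a type), its
  scalar multiplication \<open>s\<close> and its bracket \<open>br\<close>. The elements of the free algebra on the set
  \<open>L\<close> are the finitely supported functions on the words over \<open>L\<close>.
\<close>

definition free_alg :: "'l set \<Rightarrow> ('k::field, 'l list \<Rightarrow> 'k) module" where
  "free_alg L =
     \<lparr>carrier = {\<phi>. finite {w. \<phi> w \<noteq> 0} \<and> {w. \<phi> w \<noteq> 0} \<subseteq> lists L},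
      monoid.mult = (\<lambda>\<phi> \<psi> w. \<Sum>i\<le>length w. \<phi> (take i w) * \<psi> (drop i w)),
      monoid.one = (\<lambda>w. if w = [] then 1 else 0),
      ring.zero = (\<lambda>w. 0),
      ring.add = (\<lambda>\<phi> \<psi> w. \<phi> w + \<psi> w),
      module.smult = (\<lambda>c \<phi> w. c * \<phi> w)\<rparr>"

definition letter :: "'l \<Rightarrow> 'l list \<Rightarrow> 'k::field" where
  "letter a = (\<lambda>w. if w = [a] then 1 else 0)"

text \<open>
  Imposing the first two families of relations turns the free algebra on the set \<open>L\<close> into the
  tensor algebra of the vector space \<open>L\<close>.
\<close>

definition env_rels ::
    "'l::ab_group_add set \<Rightarrow> ('k::field \<Rightarrow> 'l \<Rightarrow> 'l) \<Rightarrow> ('l \<Rightarrow> 'l \<Rightarrow> 'l) \<Rightarrow> ('l list \<Rightarrow> 'k) set" where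
  "env_rels L s br =
     {(\<lambda>w. letter (a + b) w - letter a w - letter b w) | a b. a \<in> L \<and> b \<in> L} \<union>
     {(\<lambda>w. letter (s c a) w - c * letter a w) | c a. a \<in> L} \<union>
     {(\<lambda>w. (letter a \<otimes>\<^bsub>free_alg L\<^esub> letter b) w - (letter b \<otimes>\<^bsub>free_alg L\<^esub> letter a) w
           - letter (br a b) w) | a b. a \<in> L \<and> b \<in> L}"

definition env_ideal ::
    "'l::ab_group_add set \<Rightarrow> ('k::field \<Rightarrow> 'l \<Rightarrow> 'l) \<Rightarrow> ('l \<Rightarrow> 'l \<Rightarrow> 'l) \<Rightarrow> ('l list \<Rightarrow> 'k) set" where
  "env_ideal L s br = Idl\<^bsub>free_alg L\<^esub> (env_rels L s br)"

definition env_alg ::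
    "'l::ab_group_add set \<Rightarrow> ('k::field \<Rightarrow> 'l \<Rightarrow> 'l) \<Rightarrow> ('l \<Rightarrow> 'l \<Rightarrow> 'l)
      \<Rightarrow> ('k, ('l list \<Rightarrow> 'k) set) module" where
  "env_alg L s br = quot_alg (free_alg L) (env_ideal L s br)"

definition env_incl ::
    "'l::ab_group_add set \<Rightarrow> ('k::field \<Rightarrow> 'l \<Rightarrow> 'l) \<Rightarrow> ('l \<Rightarrow> 'l \<Rightarrow> 'l)
      \<Rightarrow> 'l \<Rightarrow> ('l list \<Rightarrow> 'k) set" where
  "env_incl L s br a = env_ideal L s br +>\<^bsub>free_alg L\<^esub> letter a"

section \<open>Irreducible Lie algebra modules\<close>

definition lie_module ::
    "'l::ab_group_add set \<Rightarrow> ('k::field \<Rightarrow> 'l \<Rightarrow> 'l) \<Rightarrow> ('l \<Rightarrow> 'l \<Rightarrow> 'l)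
      \<Rightarrow> ('k, 'v) module \<Rightarrow> ('l \<Rightarrow> 'v \<Rightarrow> 'v) \<Rightarrow> bool" where
  "lie_module L s br V act \<longleftrightarrow>
     module ring_of_type_algebra V \<and>
     (\<forall>a\<in>L. \<forall>v\<in>carrier V. act a v \<in> carrier V) \<and>
     (\<forall>a\<in>L. \<forall>v\<in>carrier V. \<forall>w\<in>carrier V. act a (v \<oplus>\<^bsub>V\<^esub> w) = act a v \<oplus>\<^bsub>V\<^esub> act a w) \<and>
     (\<forall>c. \<forall>a\<in>L. \<forall>v\<in>carrier V. act a (c \<odot>\<^bsub>V\<^esub> v) = c \<odot>\<^bsub>V\<^esub> act a v) \<and>
     (\<forall>a\<in>L. \<forall>b\<in>L. \<forall>v\<in>carrier V. act (a + b) v = act a v \<oplus>\<^bsub>V\<^esub> act b v) \<and>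
     (\<forall>c. \<forall>a\<in>L. \<forall>v\<in>carrier V. act (s c a) v = c \<odot>\<^bsub>V\<^esub> act a v) \<and>
     (\<forall>a\<in>L. \<forall>b\<in>L. \<forall>v\<in>carrier V. act (br a b) v = act a (act b v) \<ominus>\<^bsub>V\<^esub> act b (act a v))"

definition irreducible_lie_module ::
    "'l::ab_group_add set \<Rightarrow> ('k::field \<Rightarrow> 'l \<Rightarrow> 'l) \<Rightarrow> ('l \<Rightarrow> 'l \<Rightarrow> 'l)
      \<Rightarrow> ('k, 'v) module \<Rightarrow> ('l \<Rightarrow> 'v \<Rightarrow> 'v) \<Rightarrow> bool" where
  "irreducible_lie_module L s br V act \<longleftrightarrow>
     lie_module L s br V act \<and> carrier V \<noteq> {\<zero>\<^bsub>V\<^esub>} \<and>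
     (\<forall>N. submodule N ring_of_type_algebra V \<and> (\<forall>a\<in>L. \<forall>v\<in>N. act a v \<in> N) \<longrightarrow>
          N = {\<zero>\<^bsub>V\<^esub>} \<or> N = carrier V)"

section \<open>The Lie algebra of 2 by 2 traceless matrices and its natural representation\<close>

definition sl2 :: "('k::field ^ 2 ^ 2) set" where
  "sl2 = {A. trace A = 0}"

definition mat_scale :: "'k::field \<Rightarrow> 'k ^ 2 ^ 2 \<Rightarrow> 'k ^ 2 ^ 2" where
  "mat_scale c A = (\<chi> i j. c * A $ i $ j)"

definition mat_bracket :: "'k::field ^ 2 ^ 2 \<Rightarrow> 'k ^ 2 ^ 2 \<Rightarrow> 'k ^ 2 ^ 2" where
  "mat_bracket A B = A ** B - B ** A"

definition mat_e :: "'k::field ^ 2 ^ 2" where "mat_e = vector [vector [0, 1], vector [0, 0]]"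
definition mat_f :: "'k::field ^ 2 ^ 2" where "mat_f = vector [vector [0, 0], vector [1, 0]]"
definition mat_h :: "'k::field ^ 2 ^ 2" where "mat_h = vector [vector [1, 0], vector [0, - 1]]"
definition vec_x :: "'k::field ^ 2" where "vec_x = vector [1, 0]"
definition vec_y :: "'k::field ^ 2" where "vec_y = vector [0, 1]"

text \<open>The semidirect product of \<^const>\<open>sl2\<close> with its natural representation, an abelian ideal.\<close>

type_synonym 'k sl2V = "('k ^ 2 ^ 2) \<times> ('k ^ 2)"

definition sl2V :: "'k::field sl2V set" where
  "sl2V = sl2 \<times> UNIV"

definition sl2V_scale :: "'k::field \<Rightarrow> 'k sl2V \<Rightarrow> 'k sl2V" where
  "sl2V_scale c = (\<lambda>(A, v). (mat_scale c A, c *s v))"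

definition sl2V_bracket :: "'k::field sl2V \<Rightarrow> 'k sl2V \<Rightarrow> 'k sl2V" where
  "sl2V_bracket = (\<lambda>(A, v) (B, w). (mat_bracket A B, A *v w - B *v v))"

section \<open>The enveloping algebra of the semidirect product and its fibers\<close>

type_synonym 'k Helem = "('k sl2V list \<Rightarrow> 'k) set"

definition Halg :: "('k::field, 'k Helem) module" where
  "Halg = env_alg sl2V sl2V_scale sl2V_bracket"

definition Hincl :: "'k::field sl2V \<Rightarrow> 'k Helem" where
  "Hincl = env_incl sl2V sl2V_scale sl2V_bracket"

definition He :: "'k::field Helem" where "He = Hincl (mat_e, 0)"
definition Hf :: "'k::field Helem" where "Hf = Hincl (mat_f, 0)"
definition Hh :: "'k::field Helem" where "Hh = Hincl (mat_h, 0)"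
definition Hx :: "'k::field Helem" where "Hx = Hincl (0, vec_x)"
definition Hy :: "'k::field Helem" where "Hy = Hincl (0, vec_y)"

definition Zalg :: "('k::field, 'k Helem) module" where
  "Zalg = Halg\<lparr>carrier := alg_center Halg\<rparr>"

definition fiber_ideal :: "('k::field Helem \<Rightarrow> 'k) \<Rightarrow> 'k Helem set" where
  "fiber_ideal chi = {z \<in> carrier Zalg. chi z = 0} \<cdot>\<^bsub>Halg\<^esub> carrier Halg"

definition fiber :: "('k::field Helem \<Rightarrow> 'k) \<Rightarrow> ('k, 'k Helem set) module" where
  "fiber chi = quot_alg Halg (fiber_ideal chi)"

definition to_fiber :: "('k::field Helem \<Rightarrow> 'k) \<Rightarrow> 'k Helem \<Rightarrow> 'k Helem set" where
  "to_fiber chi u = fiber_ideal chi +>\<^bsub>Halg\<^esub> u"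

definition Nsub :: "('k::field Helem \<Rightarrow> 'k) \<Rightarrow> 'k Helem set set" where
  "Nsub chi = subalg_gen (fiber chi) {to_fiber chi Hf, to_fiber chi Hy}"

definition Bsub :: "('k::field Helem \<Rightarrow> 'k) \<Rightarrow> 'k Helem set set" where
  "Bsub chi = subalg_gen (fiber chi) {to_fiber chi He, to_fiber chi Hx, to_fiber chi Hh}"

text \<open>
  The characters of \<^term>\<open>Nsub chi\<close> and \<^term>\<open>Bsub chi\<close> through which these subalgebras act on the
  one-dimensional modules that are induced to the fiber.

  If \<open>chi\<close> vanishes on \<open>e\<^sup>p\<close>, \<open>f\<^sup>p\<close> and \<open>y\<^sup>p\<close> but not on \<open>x\<^sup>p\<close>, the module induced from
  \<^term>\<open>Nsub chi\<close> is not irreducible: it is the sum of \<open>p\<close> copies of the irreducible module of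
  dimension \<open>p\<^sup>2\<close>. In that module, which is induced from the subalgebra generated by \<open>f\<close>, \<open>y\<close>, \<open>h\<close>,
  the vectors \<open>v\<close>, \<open>x v\<close>, \<open>\<dots>\<close>, \<open>x\<^bsup>p-1\<^esup> v\<close> with \<open>f v = y v = 0\<close> are all annihilated by \<open>f\<close> and \<open>y\<close>.
\<close>

definition Nchar :: "nat \<Rightarrow> ('k::field Helem \<Rightarrow> 'k) \<Rightarrow> ('k Helem set \<Rightarrow> 'k) \<Rightarrow> bool" where
  "Nchar p chi \<rho> \<longleftrightarrow>
     alg_character ((fiber chi)\<lparr>carrier := Nsub chi\<rparr>) \<rho> \<and>
     \<rho> (to_fiber chi Hf) ^ p = chi (Hf [^]\<^bsub>Halg\<^esub> p) \<and>
     \<rho> (to_fiber chi Hy) ^ p = chi (Hy [^]\<^bsub>Halg\<^esub> p)"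

definition Bchar :: "('k::field Helem \<Rightarrow> 'k) \<Rightarrow> 'k \<Rightarrow> ('k Helem set \<Rightarrow> 'k) \<Rightarrow> bool" where
  "Bchar chi c \<rho> \<longleftrightarrow>
     alg_character ((fiber chi)\<lparr>carrier := Bsub chi\<rparr>) \<rho> \<and>
     \<rho> (to_fiber chi He) = 0 \<and> \<rho> (to_fiber chi Hx) = 0 \<and> \<rho> (to_fiber chi Hh) = c"

definition Ninduced ::
    "('k::field Helem \<Rightarrow> 'k) \<Rightarrow> ('k Helem set \<Rightarrow> 'k)
      \<Rightarrow> ('k Helem set, ('k Helem set \<times> 'k \<Rightarrow>\<^sub>0 int) set) module" where
  "Ninduced chi \<rho> = tensor_module (fiber chi) (Nsub chi) (character_module \<rho>)"

definition Binduced ::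
    "('k::field Helem \<Rightarrow> 'k) \<Rightarrow> ('k Helem set \<Rightarrow> 'k)
      \<Rightarrow> ('k Helem set, ('k Helem set \<times> 'k \<Rightarrow>\<^sub>0 int) set) module" where
  "Binduced chi \<rho> = tensor_module (fiber chi) (Bsub chi) (character_module \<rho>)"

end

theory Submission
  imports Defs
begin

text \<open>
  Let \<open>H\<close> be the enveloping algebra of \<open>sl\<^sub>2 \<ltimes> V\<close>. A module over the fiber at \<open>chi\<close> with a generator is
  \<open>H / J\<close> for a left ideal \<open>J\<close> containing the kernel of \<open>chi\<close>, namely the annihilator of the generator.
  Passing from a vector \<open>w\<close> to \<open>a w\<close> replaces \<open>J\<close> by \<open>{u. u a \<in> J}\<close>. The proof studies these left
  ideals inside the ring \<open>H\<close> and returns to modules only at the end.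

  For parts (1) and (2) one fixes eigenvalue equations for a vector \<open>v\<close> and shows two things. First, each
  proper \<open>J\<close> over \<open>chi\<close> can be replaced by one satisfying the equations, since commuting (or normalizing)
  elements annihilated by a polynomial have a common eigenvector (\<open>common_eigenvector\<close>,
  \<open>highest_weight_vector\<close>). Second, if a proper \<open>J\<close> over \<open>chi\<close> satisfies them, then \<open>p\<^sup>2\<close> monomials in two
  generators form a basis of \<open>H / J\<close> and each nonzero class generates \<open>H / J\<close>; this is called a frame.
  Frames are maximal, and the intersection of two solutions \<open>J\<close> is again a solution, so \<open>J\<close> is unique:
  there is exactly one irreducible module, of dimension \<open>p\<^sup>2\<close> (\<open>the_irreducible_moduleI\<close>).

  The equations and the bases are the following.

    \<^item> \<open>e v = 0\<close>, \<open>x v = a v\<close> with \<open>a \<noteq> 0\<close>: basis \<open>h\<^sup>i y\<^sup>j v\<close> (\<open>frame_x_invertible\<close>).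
    \<^item> \<open>f v = b v\<close>, \<open>y v = a v\<close> with \<open>a \<noteq> 0\<close>: basis \<open>h\<^sup>i x\<^sup>j v\<close> (\<open>frame_y_invertible\<close>).
    \<^item> \<open>f v = b v\<close>, \<open>y v = 0\<close> with \<open>b \<noteq> 0\<close> and \<open>x\<^sup>p\<close> nonzero: basis \<open>e\<^sup>i h\<^sup>j v\<close> (\<open>frame_f_invertible\<close>).
    \<^item> \<open>e v = x v = 0\<close>, \<open>h v = c v\<close> with \<open>y\<^sup>p\<close> nonzero: basis \<open>f\<^sup>i y\<^sup>j v\<close> (\<open>frame_highest_weight\<close>).

  The monomials span by straightening (\<open>layer_closed\<close>). In the first two cases the missing generator
  comes from the central element \<open>e y\<^sup>2 + h x y - f x\<^sup>2\<close>, which expresses \<open>f\<close> where \<open>x\<close> is invertible and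
  \<open>e\<close> where \<open>y\<close> is; in the third it forces \<open>x\<close> to act on \<open>v\<close> by a scalar. Independence and generation
  come from operators that lower the degree in one generator like a derivation or a difference operator
  (\<open>lowering\<close>); exponents below \<open>p\<close> keep the factorials invertible.

  An induced module is generated by \<open>1 \<otimes> 1\<close>, which satisfies the equations and is nonzero because
  the fiber itself contains such a \<open>v\<close>. This in turn needs a nonzero fiber: \<open>H\<close> is finite over its
  center, so the kernel of \<open>chi\<close> generates a proper ideal by Nakayama's lemma (\<open>one_notin_ker_ideal\<close>).

  In part (3) the vectors killed by \<open>x\<close> and \<open>y\<close> form a nonzero submodule, hence everything.
\<close>

section \<open>The free algebra\<close>

lemma free_alg_simps:
  "carrier (free_alg L) = {\<phi>. finite {w. \<phi> w \<noteq> 0} \<and> {w. \<phi> w \<noteq> 0} \<subseteq> lists L}"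
  "\<phi> \<otimes>\<^bsub>free_alg L\<^esub> \<psi> = (\<lambda>w. \<Sum>i\<le>length w. \<phi> (take i w) * \<psi> (drop i w))"
  "\<one>\<^bsub>free_alg L\<^esub> = (\<lambda>w. if w = [] then 1 else 0)"
  "\<zero>\<^bsub>free_alg L\<^esub> = (\<lambda>w. 0)"
  "\<phi> \<oplus>\<^bsub>free_alg L\<^esub> \<psi> = (\<lambda>w. \<phi> w + \<psi> w)"
  "c \<odot>\<^bsub>free_alg L\<^esub> \<phi> = (\<lambda>w. c * \<phi> w)"
  by (simp_all add: free_alg_def)

text \<open>
  The product splits off the first letter: the cut is either in front of it or behind it. This
  recursion reduces associativity to an induction on the word.
\<close>

definition shift :: "'l \<Rightarrow> ('l list \<Rightarrow> 'k) \<Rightarrow> 'l list \<Rightarrow> 'k" where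
  "shift a \<phi> w = \<phi> (a # w)"

lemma free_mult_Nil: "(\<phi> \<otimes>\<^bsub>free_alg L\<^esub> \<psi>) [] = \<phi> [] * \<psi> []"
  by (simp add: free_alg_simps)

lemma free_mult_Cons:
  "(\<phi> \<otimes>\<^bsub>free_alg L\<^esub> \<psi>) (a # w) = \<phi> [] * \<psi> (a # w) + (shift a \<phi> \<otimes>\<^bsub>free_alg L\<^esub> \<psi>) w"
  by (simp add: free_alg_simps shift_def sum.atMost_Suc_shift del: sum.atMost_Suc)

lemma free_mult_linear:
  "((\<lambda>w. c * \<phi> w + \<phi>' w) \<otimes>\<^bsub>free_alg L\<^esub> \<psi>) w
     = c * (\<phi> \<otimes>\<^bsub>free_alg L\<^esub> \<psi>) w + (\<phi>' \<otimes>\<^bsub>free_alg L\<^esub> \<psi>) w"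
  by (simp add: free_alg_simps distrib_right sum.distrib sum_distrib_left mult.assoc)

lemma free_mult_assoc:
  "((\<phi> \<otimes>\<^bsub>free_alg L\<^esub> \<psi>) \<otimes>\<^bsub>free_alg L\<^esub> \<theta>) w = (\<phi> \<otimes>\<^bsub>free_alg L\<^esub> (\<psi> \<otimes>\<^bsub>free_alg L\<^esub> \<theta>)) w"
proof (induction w arbitrary: \<phi> \<psi>)
  case Nil
  then show ?case by (simp add: free_mult_Nil mult.assoc)
next
  case (Cons a w)
  have "shift a (\<phi> \<otimes>\<^bsub>free_alg L\<^esub> \<psi>)
      = (\<lambda>v. \<phi> [] * shift a \<psi> v + (shift a \<phi> \<otimes>\<^bsub>free_alg L\<^esub> \<psi>) v)"
    by (rule ext) (simp add: shift_def[of _ "\<phi> \<otimes>\<^bsub>free_alg L\<^esub> \<psi>"] shift_def[of _ \<psi>] free_mult_Cons)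
  then show ?case
    by (simp add: free_mult_Cons free_mult_Nil free_mult_linear Cons algebra_simps)
qed

lemma free_one_mult: "\<one>\<^bsub>free_alg L\<^esub> \<otimes>\<^bsub>free_alg L\<^esub> \<phi> = \<phi>"
proof
  fix w show "(\<one>\<^bsub>free_alg L\<^esub> \<otimes>\<^bsub>free_alg L\<^esub> \<phi>) w = \<phi> w"
    by (cases w) (simp_all add: free_mult_Nil free_mult_Cons, simp_all add: free_alg_simps shift_def)
qed

lemma free_mult_closed:
  assumes "\<phi> \<in> carrier (free_alg L)" "\<psi> \<in> carrier (free_alg L)"
  shows "\<phi> \<otimes>\<^bsub>free_alg L\<^esub> \<psi> \<in> carrier (free_alg L)"
proof -
  let ?S = "(\<lambda>(u, v). u @ v) ` ({w. \<phi> w \<noteq> 0} \<times> {w. \<psi> w \<noteq> 0})"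
  have "{w. (\<phi> \<otimes>\<^bsub>free_alg L\<^esub> \<psi>) w \<noteq> 0} \<subseteq> ?S"
  proof
    fix w assume "w \<in> {w. (\<phi> \<otimes>\<^bsub>free_alg L\<^esub> \<psi>) w \<noteq> 0}"
    then obtain i where "\<phi> (take i w) * \<psi> (drop i w) \<noteq> 0"
      by (auto simp: free_alg_simps elim!: sum.not_neutral_contains_not_neutral)
    then have "(take i w, drop i w) \<in> {w. \<phi> w \<noteq> 0} \<times> {w. \<psi> w \<noteq> 0}" by auto
    then show "w \<in> ?S" by (metis (mono_tags, lifting) append_take_drop_id case_prod_conv image_eqI)
  qed
  moreover have "finite ?S"
    using assms by (auto simp: free_alg_simps)
  moreover have "?S \<subseteq> lists L"
    using assms by (force simp: free_alg_simps simp del: in_lists_conv_set)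
  ultimately show ?thesis by (auto simp: free_alg_simps(1) intro: finite_subset)
qed

lemma free_alg_ring: "ring (free_alg L :: ('k::field, 'l list \<Rightarrow> 'k) module)"
proof (rule ringI)
  show "abelian_group (free_alg L :: ('k, 'l list \<Rightarrow> 'k) module)"
  proof (rule abelian_groupI, goal_cases)
    case (1 \<phi> \<psi>)
    have "{w. \<phi> w + \<psi> w \<noteq> 0} \<subseteq> {w. \<phi> w \<noteq> 0} \<union> {w. \<psi> w \<noteq> 0}" by auto
    with 1 show ?case
      by (auto simp: free_alg_simps intro: finite_subset)
  next
    case (6 \<phi>)
    then show ?case
      by (intro bexI[of _ "\<lambda>w. - \<phi> w"]) (auto simp: free_alg_simps)
  qed (auto simp: free_alg_simps add.assoc add.commute)
next
  show "monoid (free_alg L :: ('k, 'l list \<Rightarrow> 'k) module)"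
  proof (rule monoidI, goal_cases)
    case (1 \<phi> \<psi>) then show ?case by (rule free_mult_closed)
  next
    case 2 show ?case by (auto simp: free_alg_simps)
  next
    case (3 \<phi> \<psi> \<theta>) show ?case by (rule ext) (rule free_mult_assoc)
  next
    case (4 \<phi>)
    show ?case by (rule free_one_mult)
  next
    case (5 \<phi>)
    have "(\<phi> \<otimes>\<^bsub>free_alg L\<^esub> \<one>\<^bsub>free_alg L\<^esub>) w = \<phi> w" for w
    proof (induction w arbitrary: \<phi>)
      case Nil show ?case by (simp add: free_mult_Nil) (simp add: free_alg_simps)
    next
      case (Cons a w)
      show ?case
        unfolding free_mult_Cons Cons by (simp add: free_alg_simps shift_def)
    qed
    then show ?case by (rule ext)
  qed
next
  fix \<phi> \<psi> \<theta> :: "'l list \<Rightarrow> 'k"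
  show "(\<phi> \<oplus>\<^bsub>free_alg L\<^esub> \<psi>) \<otimes>\<^bsub>free_alg L\<^esub> \<theta>
      = \<phi> \<otimes>\<^bsub>free_alg L\<^esub> \<theta> \<oplus>\<^bsub>free_alg L\<^esub> \<psi> \<otimes>\<^bsub>free_alg L\<^esub> \<theta>"
    by (simp add: free_alg_simps distrib_right sum.distrib)
  show "\<theta> \<otimes>\<^bsub>free_alg L\<^esub> (\<phi> \<oplus>\<^bsub>free_alg L\<^esub> \<psi>)
      = \<theta> \<otimes>\<^bsub>free_alg L\<^esub> \<phi> \<oplus>\<^bsub>free_alg L\<^esub> \<theta> \<otimes>\<^bsub>free_alg L\<^esub> \<psi>"
    by (simp add: free_alg_simps distrib_left sum.distrib)
qed

lemma free_smult_closed: "\<phi> \<in> carrier (free_alg L) \<Longrightarrow> c \<odot>\<^bsub>free_alg L\<^esub> \<phi> \<in> carrier (free_alg L)"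
proof -
  assume a: "\<phi> \<in> carrier (free_alg L)"
  have "{w. c * \<phi> w \<noteq> 0} \<subseteq> {w. \<phi> w \<noteq> 0}" by auto
  with a show ?thesis by (auto simp: free_alg_simps intro: finite_subset)
qed

lemma free_smult_mult:
  "c \<odot>\<^bsub>free_alg L\<^esub> (\<phi> \<otimes>\<^bsub>free_alg L\<^esub> \<psi>) = (c \<odot>\<^bsub>free_alg L\<^esub> \<phi>) \<otimes>\<^bsub>free_alg L\<^esub> \<psi>"
  "c \<odot>\<^bsub>free_alg L\<^esub> (\<phi> \<otimes>\<^bsub>free_alg L\<^esub> \<psi>) = \<phi> \<otimes>\<^bsub>free_alg L\<^esub> (c \<odot>\<^bsub>free_alg L\<^esub> \<psi>)"
  by (simp_all add: free_alg_simps sum_distrib_left ac_simps)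

lemma letter_closed: "a \<in> L \<Longrightarrow> letter a \<in> carrier (free_alg L)"
  by (auto simp: free_alg_simps letter_def)

lemma free_alg_minus:
  assumes "\<phi> \<in> carrier (free_alg L)" "\<psi> \<in> carrier (free_alg L)"
  shows "\<phi> \<ominus>\<^bsub>free_alg L\<^esub> \<psi> = (\<lambda>w. \<phi> w - \<psi> w)"
proof -
  interpret ring "free_alg L" by (rule free_alg_ring)
  have "(\<lambda>w. - \<psi> w) \<in> carrier (free_alg L)" using assms by (simp add: free_alg_simps)
  then have "\<ominus>\<^bsub>free_alg L\<^esub> \<psi> = (\<lambda>w. - \<psi> w)"
    using assms by (intro minus_equality) (auto simp: free_alg_simps)
  then show ?thesis by (simp add: a_minus_def) (simp add: free_alg_simps)
qed

text \<open>
  A word is the product of its letters, so a set with these closure properties contains all words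
  and their linear combinations.
\<close>

lemma free_alg_induct [consumes 1, case_names one add smult letter]:
  assumes \<phi>: "\<phi> \<in> carrier (free_alg L)"
    and one: "P \<one>\<^bsub>free_alg L\<^esub>"
    and add: "\<And>\<phi> \<psi>. \<phi> \<in> carrier (free_alg L) \<Longrightarrow> \<psi> \<in> carrier (free_alg L) \<Longrightarrow> P \<phi> \<Longrightarrow> P \<psi>
        \<Longrightarrow> P (\<phi> \<oplus>\<^bsub>free_alg L\<^esub> \<psi>)"
    and smult: "\<And>c \<phi>. \<phi> \<in> carrier (free_alg L) \<Longrightarrow> P \<phi> \<Longrightarrow> P (c \<odot>\<^bsub>free_alg L\<^esub> \<phi>)"
    and letter: "\<And>a \<phi>. a \<in> L \<Longrightarrow> \<phi> \<in> carrier (free_alg L) \<Longrightarrow> P \<phi>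
        \<Longrightarrow> P (letter a \<otimes>\<^bsub>free_alg L\<^esub> \<phi>)"
  shows "P \<phi>"
proof -
  define word :: "'a list \<Rightarrow> 'a list \<Rightarrow> 'b" where "word w = (\<lambda>v. if v = w then 1 else 0)" for w
  have word_closed: "word w \<in> carrier (free_alg L)" if "w \<in> lists L" for w
    using that by (auto simp: word_def free_alg_simps)
  have word_Cons: "word (a # w) = letter a \<otimes>\<^bsub>free_alg L\<^esub> word w" for a w
  proof
    fix v
    have "shift b (letter a :: 'a list \<Rightarrow> 'b) = (if a = b then \<one>\<^bsub>free_alg L\<^esub> else \<zero>\<^bsub>free_alg L\<^esub>)" for b
      by (auto simp: shift_def letter_def free_alg_simps)
    moreover have "(\<zero>\<^bsub>free_alg L\<^esub> \<otimes>\<^bsub>free_alg L\<^esub> word w) v = 0" for v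
      by (simp add: free_alg_simps)
    ultimately show "word (a # w) v = (letter a \<otimes>\<^bsub>free_alg L\<^esub> word w) v"
      by (cases v) (simp_all add: free_mult_Nil free_mult_Cons free_one_mult, simp_all add: word_def letter_def)
  qed
  have word: "P (word w)" if "w \<in> lists L" for w
    using that
  proof (induction w)
    case Nil
    have "word [] = \<one>\<^bsub>free_alg L\<^esub>" by (simp add: word_def free_alg_simps)
    then show ?case using one by simp
  next
    case (Cons a w)
    then show ?case by (simp add: word_Cons letter word_closed)
  qed
  have zero: "P \<zero>\<^bsub>free_alg L\<^esub>"
    using smult[of "\<one>\<^bsub>free_alg L\<^esub>" 0] word_closed[of "[]"] one
    by (simp add: free_alg_simps word_def if_distrib cong: if_cong)
  have "P (\<lambda>w. if w \<in> A then \<phi> w else 0) \<and> (\<lambda>w. if w \<in> A then \<phi> w else 0) \<in> carrier (free_alg L)"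
    if "finite A" "A \<subseteq> lists L" for A
    using that
  proof (induction A rule: finite_induct)
    case empty
    show ?case using zero by (simp add: free_alg_simps)
  next
    case (insert w A)
    have eq: "(\<lambda>v. if v \<in> insert w A then \<phi> v else 0)
        = (\<phi> w \<odot>\<^bsub>free_alg L\<^esub> word w) \<oplus>\<^bsub>free_alg L\<^esub> (\<lambda>v. if v \<in> A then \<phi> v else 0)"
      using insert.hyps by (auto simp: free_alg_simps word_def)
    have w: "w \<in> lists L" using insert.prems by auto
    interpret ring "free_alg L :: ('b, 'a list \<Rightarrow> 'b) module" by (rule free_alg_ring)
    show ?case
      unfolding eq using insert w word[OF w] word_closed[OF w]
      by (auto intro!: add smult free_smult_closed)
  qed
  from this[of "{w. \<phi> w \<noteq> 0}"] \<phi>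
  have "P (\<lambda>w. if \<phi> w \<noteq> 0 then \<phi> w else 0)" by (simp add: free_alg_simps)
  moreover have "(\<lambda>w. if \<phi> w \<noteq> 0 then \<phi> w else 0) = \<phi>" by auto
  ultimately show ?thesis by (simp only:)
qed

section \<open>Algebras and their quotients\<close>

locale assoc_alg = ring A for A :: "('k::field, 'a) module" (structure) +
  assumes sm_closed [simp]: "a \<in> carrier A \<Longrightarrow> c \<odot> a \<in> carrier A"
    and sm_add_right: "a \<in> carrier A \<Longrightarrow> b \<in> carrier A \<Longrightarrow> c \<odot> (a \<oplus> b) = c \<odot> a \<oplus> c \<odot> b"
    and sm_add_left: "a \<in> carrier A \<Longrightarrow> (c + d) \<odot> a = c \<odot> a \<oplus> d \<odot> a"
    and sm_sm: "a \<in> carrier A \<Longrightarrow> c \<odot> (d \<odot> a) = (c * d) \<odot> a"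
    and sm_one: "a \<in> carrier A \<Longrightarrow> 1 \<odot> a = a"
    and sm_mult_left: "a \<in> carrier A \<Longrightarrow> b \<in> carrier A \<Longrightarrow> c \<odot> (a \<otimes> b) = (c \<odot> a) \<otimes> b"
    and sm_mult_right: "a \<in> carrier A \<Longrightarrow> b \<in> carrier A \<Longrightarrow> c \<odot> (a \<otimes> b) = a \<otimes> (c \<odot> b)"

lemma free_alg_assoc_alg: "assoc_alg (free_alg L :: ('k::field, 'l list \<Rightarrow> 'k) module)"
proof -
  interpret ring "free_alg L :: ('k, 'l list \<Rightarrow> 'k) module" by (rule free_alg_ring)
  show ?thesis
  proof (unfold_locales, goal_cases)
    case 1 then show ?case by (rule free_smult_closed)
  next
    case 6 show ?case by (rule free_smult_mult)
  next
    case 7 show ?case by (rule free_smult_mult)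
  qed (simp_all add: free_alg_simps(5,6) algebra_simps)
qed

text \<open>
  Being a ring depends on the ring fields of a record alone. The quotient algebra shares them with the
  quotient ring, in a longer record.
\<close>

lemma ring_fields_cong:
  fixes R :: "('a, 'x) ring_scheme" and S :: "('a, 'y) ring_scheme"
  assumes R: "ring R"
    and eq: "carrier S = carrier R" "monoid.mult S = monoid.mult R" "monoid.one S = monoid.one R"
      "ring.zero S = ring.zero R" "ring.add S = ring.add R"
  shows "ring S"
proof -
  interpret ring R by (rule R)
  show ?thesis
  proof (rule ringI)
    show "abelian_group S"
      by (rule abelian_groupI) (auto simp: eq a_ac intro: add.l_inv_ex)
    show "monoid S"
      by (rule monoidI) (auto simp: eq m_assoc)
  qed (auto simp: eq l_distr r_distr)
qed

locale alg_ideal = assoc_alg A + ideal I A for A :: "('k::field, 'a) module" (structure) and I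
begin

abbreviation cls :: "'a \<Rightarrow> 'a set" where "cls a \<equiv> I +>\<^bsub>A\<^esub> a"

lemma quot_fields:
  "carrier (quot_alg A I) = carrier (A Quot I)"
  "monoid.mult (quot_alg A I) = monoid.mult (A Quot I)"
  "monoid.one (quot_alg A I) = monoid.one (A Quot I)"
  "ring.zero (quot_alg A I) = ring.zero (A Quot I)"
  "ring.add (quot_alg A I) = ring.add (A Quot I)"
  by (simp_all add: quot_alg_def)

lemma quot_ring: "ring (quot_alg A I)"
  by (rule ring_fields_cong[OF quotient_is_ring quot_fields])

lemma cls_closed: "a \<in> carrier A \<Longrightarrow> cls a \<in> carrier (quot_alg A I)"
  by (auto simp: quot_fields FactRing_def A_RCOSETS_def')

lemma cls_surj: "C \<in> carrier (quot_alg A I) \<Longrightarrow> \<exists>a\<in>carrier A. C = cls a"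
  by (auto simp: quot_fields FactRing_def A_RCOSETS_def')

lemma cls_eq_iff: "a \<in> carrier A \<Longrightarrow> b \<in> carrier A \<Longrightarrow> cls a = cls b \<longleftrightarrow> a \<ominus> b \<in> I"
  using quotient_eq_iff_same_a_r_cos[OF is_ideal] by blast

lemma cls_add: "a \<in> carrier A \<Longrightarrow> b \<in> carrier A \<Longrightarrow>
    cls a \<oplus>\<^bsub>quot_alg A I\<^esub> cls b = cls (a \<oplus> b)"
  by (simp add: quot_fields FactRing_def a_rcos_sum)

lemma cls_mult: "a \<in> carrier A \<Longrightarrow> b \<in> carrier A \<Longrightarrow>
    cls a \<otimes>\<^bsub>quot_alg A I\<^esub> cls b = cls (a \<otimes> b)"
  by (simp add: quot_fields FactRing_def rcoset_mult_add)

lemma cls_one: "\<one>\<^bsub>quot_alg A I\<^esub> = cls \<one>"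
  by (simp add: quot_fields FactRing_def)

lemma cls_zero: "\<zero>\<^bsub>quot_alg A I\<^esub> = cls \<zero>"
  using a_rcos_zero[OF is_ideal additive_subgroup.zero_closed[OF is_additive_subgroup]]
  by (simp add: quot_fields FactRing_def)

lemma sm_ideal: "a \<in> I \<Longrightarrow> c \<odot> a \<in> I"
  using I_l_closed[of a "c \<odot> \<one>"] sm_mult_left[of \<one> a c] by simp

lemma sm_zero: "c \<odot> \<zero> = \<zero>"
  using sm_mult_left[of \<zero> \<zero> c] by simp

lemma sm_minus: "a \<in> carrier A \<Longrightarrow> b \<in> carrier A \<Longrightarrow> c \<odot> (a \<ominus> b) = c \<odot> a \<ominus> c \<odot> b"
proof -
  assume ab: "a \<in> carrier A" "b \<in> carrier A"
  have "c \<odot> (\<ominus> b) \<oplus> c \<odot> b = \<zero>"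
    using ab by (simp flip: sm_add_right add: l_neg sm_zero)
  then have "c \<odot> (\<ominus> b) = \<ominus> (c \<odot> b)"
    using ab by (simp add: minus_equality)
  then show ?thesis using ab by (simp add: a_minus_def sm_add_right)
qed

text \<open>
  The union over the coset in \<^const>\<open>quot_alg\<close> collapses to one class, because representatives differ by
  an element of the ideal and the ideal is closed under scalars.
\<close>

lemma cls_sm:
  assumes a: "a \<in> carrier A"
  shows "c \<odot>\<^bsub>quot_alg A I\<^esub> cls a = cls (c \<odot> a)"
proof -
  have "cls (c \<odot> b) = cls (c \<odot> a)" if b: "b \<in> cls a" for b
  proof -
    have "b \<in> carrier A" using b a a_r_coset_subset_G[OF a_subset] by blast
    moreover have "cls b = cls a" using a_repr_independence'[OF b a] by simp
    ultimately show ?thesis using a by (simp add: cls_eq_iff sm_ideal flip: sm_minus)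
  qed
  moreover have "a \<in> cls a" using a by (rule a_rcos_self)
  ultimately have "(\<Union>b\<in>cls a. cls (c \<odot> b)) = cls (c \<odot> a)" by blast
  then show ?thesis by (simp add: quot_alg_def)
qed

lemma quot_assoc_alg: "assoc_alg (quot_alg A I)"
proof -
  interpret Q: ring "quot_alg A I" by (rule quot_ring)
  show ?thesis
  proof unfold_locales
    fix P S c d assume "P \<in> carrier (quot_alg A I)" "S \<in> carrier (quot_alg A I)"
    then obtain a b where P: "a \<in> carrier A" "P = cls a" and S: "b \<in> carrier A" "S = cls b"
      by (meson cls_surj)
    show "c \<odot>\<^bsub>quot_alg A I\<^esub> (P \<oplus>\<^bsub>quot_alg A I\<^esub> S)
        = c \<odot>\<^bsub>quot_alg A I\<^esub> P \<oplus>\<^bsub>quot_alg A I\<^esub> c \<odot>\<^bsub>quot_alg A I\<^esub> S"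
      using P S by (simp add: cls_add cls_sm sm_add_right)
    show "c \<odot>\<^bsub>quot_alg A I\<^esub> (P \<otimes>\<^bsub>quot_alg A I\<^esub> S) = c \<odot>\<^bsub>quot_alg A I\<^esub> P \<otimes>\<^bsub>quot_alg A I\<^esub> S"
      using P S by (simp add: cls_mult cls_sm sm_mult_left)
    show "c \<odot>\<^bsub>quot_alg A I\<^esub> (P \<otimes>\<^bsub>quot_alg A I\<^esub> S) = P \<otimes>\<^bsub>quot_alg A I\<^esub> (c \<odot>\<^bsub>quot_alg A I\<^esub> S)"
      using P S by (simp add: cls_mult cls_sm sm_mult_right)
  next
    fix P c d assume "P \<in> carrier (quot_alg A I)"
    then obtain a where P: "a \<in> carrier A" "P = cls a" by (meson cls_surj)
    show "c \<odot>\<^bsub>quot_alg A I\<^esub> P \<in> carrier (quot_alg A I)"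
      using P by (simp add: cls_sm cls_closed)
    show "(c + d) \<odot>\<^bsub>quot_alg A I\<^esub> P = c \<odot>\<^bsub>quot_alg A I\<^esub> P \<oplus>\<^bsub>quot_alg A I\<^esub> d \<odot>\<^bsub>quot_alg A I\<^esub> P"
      using P by (simp add: cls_sm cls_add sm_add_left)
    show "c \<odot>\<^bsub>quot_alg A I\<^esub> (d \<odot>\<^bsub>quot_alg A I\<^esub> P) = (c * d) \<odot>\<^bsub>quot_alg A I\<^esub> P"
      using P by (simp add: cls_sm sm_sm)
    show "1 \<odot>\<^bsub>quot_alg A I\<^esub> P = P"
      using P by (simp add: cls_sm sm_one)
  qed
qed

end

section \<open>The enveloping algebra as a type\<close>

lemma sl2V_add: "a \<in> sl2V \<Longrightarrow> b \<in> sl2V \<Longrightarrow> a + b \<in> sl2V"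
  by (auto simp: sl2V_def sl2_def trace_add)

lemma sl2V_scale_closed: "a \<in> sl2V \<Longrightarrow> sl2V_scale c a \<in> sl2V"
proof -
  have "trace (mat_scale c A) = c * trace A" for A
    by (simp add: trace_def mat_scale_def sum_distrib_left)
  then show "a \<in> sl2V \<Longrightarrow> sl2V_scale c a \<in> sl2V"
    by (auto simp: sl2V_def sl2_def sl2V_scale_def)
qed

lemma sl2V_bracket_closed: "a \<in> sl2V \<Longrightarrow> b \<in> sl2V \<Longrightarrow> sl2V_bracket a b \<in> sl2V"
  using trace_mul_sym[of "fst a" "fst b"]
  by (auto simp: sl2V_def sl2_def sl2V_bracket_def mat_bracket_def trace_sub)

lemma env_rels_carrier:
  "env_rels sl2V sl2V_scale sl2V_bracket \<subseteq> carrier (free_alg sl2V :: ('k::field, 'k sl2V list \<Rightarrow> 'k) module)"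
proof -
  let ?F = "free_alg sl2V :: ('k, 'k sl2V list \<Rightarrow> 'k) module"
  interpret ring ?F by (rule free_alg_ring)
  have m: "(\<lambda>w. \<phi> w - \<psi> w) \<in> carrier ?F" if "\<phi> \<in> carrier ?F" "\<psi> \<in> carrier ?F" for \<phi> \<psi>
    using minus_closed[OF that] by (simp add: free_alg_minus that)
  have s: "(\<lambda>w. c * \<phi> w) \<in> carrier ?F" if "\<phi> \<in> carrier ?F" for \<phi> c
    using free_smult_closed[OF that] by (simp add: free_alg_simps)
  show ?thesis
    unfolding env_rels_def
    by (intro Un_least subsetI; elim CollectE exE conjE; hypsubst;
        intro m s letter_closed sl2V_add sl2V_scale_closed sl2V_bracket_closed free_mult_closed; assumption)
qed

lemma env_alg_ideal:
  "alg_ideal (free_alg sl2V :: ('k::field, 'k sl2V list \<Rightarrow> 'k) module) (env_ideal sl2V sl2V_scale sl2V_bracket)"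
proof -
  interpret assoc_alg "free_alg sl2V :: ('k, 'k sl2V list \<Rightarrow> 'k) module" by (rule free_alg_assoc_alg)
  show ?thesis
    unfolding env_ideal_def
    by (intro alg_ideal.intro genideal_ideal env_rels_carrier free_alg_assoc_alg)
qed

lemma env_rels_in_ideal:
  "env_rels sl2V sl2V_scale sl2V_bracket \<subseteq> (env_ideal sl2V sl2V_scale sl2V_bracket :: ('k::field sl2V list \<Rightarrow> 'k) set)"
proof -
  interpret assoc_alg "free_alg sl2V :: ('k, 'k sl2V list \<Rightarrow> 'k) module" by (rule free_alg_assoc_alg)
  show ?thesis
    unfolding env_ideal_def by (intro genideal_self env_rels_carrier)
qed

text \<open>
  The constant term of a linear combination of words is multiplicative and kills the relations, so
  the unit element does not vanish in the enveloping algebra.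
\<close>

lemma env_ideal_augmentation:
  "\<phi> \<in> (env_ideal sl2V sl2V_scale sl2V_bracket :: ('k::field sl2V list \<Rightarrow> 'k) set) \<Longrightarrow> \<phi> [] = 0"
proof -
  let ?F = "free_alg sl2V :: ('k, 'k sl2V list \<Rightarrow> 'k) module"
  interpret ring ?F by (rule free_alg_ring)
  let ?J = "{\<phi> \<in> carrier ?F. \<phi> [] = 0}"
  have neg: "\<ominus>\<^bsub>?F\<^esub> \<phi> = (\<lambda>w. - \<phi> w)" if "\<phi> \<in> carrier ?F" for \<phi>
    using free_alg_minus[OF zero_closed that] that by (simp add: a_minus_def) (simp add: free_alg_simps)
  have "ideal ?J ?F"
  proof (rule idealI)
    show "subgroup ?J (add_monoid ?F)"
    proof (rule add.subgroupI, goal_cases)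
      case 2
      have "\<zero>\<^bsub>?F\<^esub> \<in> ?J" by (simp add: free_alg_simps)
      then show ?case by blast
    next
      case (3 \<phi>)
      then show ?case using a_inv_closed[of \<phi>] by (simp add: neg)
    next
      case (4 \<phi> \<psi>)
      then show ?case using a_closed[of \<phi> \<psi>] by simp (simp add: free_alg_simps(5))
    qed auto
  qed (auto simp: free_mult_Nil ring_axioms)
  moreover have "env_rels sl2V sl2V_scale sl2V_bracket \<subseteq> ?J"
  proof
    fix \<phi> :: "'k sl2V list \<Rightarrow> 'k" assume \<phi>: "\<phi> \<in> env_rels sl2V sl2V_scale sl2V_bracket"
    then have "\<phi> [] = 0" by (auto simp: env_rels_def free_mult_Nil letter_def)
    then show "\<phi> \<in> ?J" using \<phi> env_rels_carrier by blast
  qed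
  ultimately have "env_ideal sl2V sl2V_scale sl2V_bracket \<subseteq> ?J"
    unfolding env_ideal_def by (rule genideal_minimal)
  then show "\<phi> \<in> env_ideal sl2V sl2V_scale sl2V_bracket \<Longrightarrow> \<phi> [] = 0" by blast
qed

lemma Halg_assoc_alg: "assoc_alg (Halg :: ('k::field, 'k Helem) module)"
  unfolding Halg_def env_alg_def by (rule alg_ideal.quot_assoc_alg[OF env_alg_ideal])

interpretation Halg: assoc_alg "Halg :: ('k::field, 'k Helem) module"
  by (rule Halg_assoc_alg)

lemma Halg_one_neq_zero: "\<one>\<^bsub>Halg\<^esub> \<noteq> (\<zero>\<^bsub>Halg\<^esub> :: 'k::field Helem)"
proof
  let ?F = "free_alg sl2V :: ('k, 'k sl2V list \<Rightarrow> 'k) module"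
  interpret alg_ideal ?F "env_ideal sl2V sl2V_scale sl2V_bracket" by (rule env_alg_ideal)
  assume "\<one>\<^bsub>Halg\<^esub> = (\<zero>\<^bsub>Halg\<^esub> :: 'k Helem)"
  then have "\<one>\<^bsub>?F\<^esub> \<ominus>\<^bsub>?F\<^esub> \<zero>\<^bsub>?F\<^esub> \<in> env_ideal sl2V sl2V_scale sl2V_bracket"
    unfolding Halg_def env_alg_def
    using cls_eq_iff[of "\<one>\<^bsub>?F\<^esub>" "\<zero>\<^bsub>?F\<^esub>"] by (simp add: cls_one cls_zero)
  then have "(\<one>\<^bsub>?F\<^esub> \<ominus>\<^bsub>?F\<^esub> \<zero>\<^bsub>?F\<^esub>) [] = 0" by (rule env_ideal_augmentation)
  moreover have "\<one>\<^bsub>?F\<^esub> \<ominus>\<^bsub>?F\<^esub> \<zero>\<^bsub>?F\<^esub> = \<one>\<^bsub>?F\<^esub>" by (simp add: a_minus_def)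
  ultimately show False by (simp add: free_alg_simps)
qed

text \<open>
  The elements of the enveloping algebra form a type, so that identities in it can be computed by
  the simplifier for the class of noncommutative rings.
\<close>

typedef (overloaded) 'k env = "carrier (Halg :: ('k::field, 'k Helem) module)"
  morphisms rep_env abs_env
  by (rule exI[of _ "\<one>\<^bsub>Halg\<^esub>"]) simp

instantiation env :: (field) ring_1
begin

definition "0 = abs_env \<zero>\<^bsub>Halg\<^esub>"
definition "1 = abs_env \<one>\<^bsub>Halg\<^esub>"
definition "u + v = abs_env (rep_env u \<oplus>\<^bsub>Halg\<^esub> rep_env v)"
definition "- u = abs_env (\<ominus>\<^bsub>Halg\<^esub> rep_env u)"
definition "u - v = abs_env (rep_env u \<ominus>\<^bsub>Halg\<^esub> rep_env v)"
definition "u * v = abs_env (rep_env u \<otimes>\<^bsub>Halg\<^esub> rep_env v)"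

lemma rep_env_simps:
  "rep_env (0 :: 'a env) = \<zero>\<^bsub>Halg\<^esub>"
  "rep_env (1 :: 'a env) = \<one>\<^bsub>Halg\<^esub>"
  "rep_env (u + v) = rep_env u \<oplus>\<^bsub>Halg\<^esub> rep_env v"
  "rep_env (- u) = \<ominus>\<^bsub>Halg\<^esub> rep_env u"
  "rep_env (u - v) = rep_env u \<ominus>\<^bsub>Halg\<^esub> rep_env v"
  "rep_env (u * v) = rep_env u \<otimes>\<^bsub>Halg\<^esub> rep_env v"
  for u v :: "'a env"
  using rep_env[of u] rep_env[of v]
  by (simp_all add: zero_env_def one_env_def plus_env_def uminus_env_def minus_env_def times_env_def
      abs_env_inverse)

instance
proof
  fix u v w :: "'a env"
  note [simp] = rep_env rep_env_inject[symmetric] rep_env_simps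
  show "u + v + w = u + (v + w)" by (simp add: Halg.a_assoc)
  show "u + v = v + u" by (simp add: Halg.a_comm)
  show "0 + u = u" by simp
  show "- u + u = 0" by (simp add: Halg.l_neg)
  show "u - v = u + - v" by (simp add: a_minus_def)
  show "u * v * w = u * (v * w)" by (simp add: Halg.m_assoc)
  show "1 * u = u" "u * 1 = u" by simp_all
  show "(u + v) * w = u * w + v * w" by (simp add: Halg.l_distr)
  show "u * (v + w) = u * v + u * w" by (simp add: Halg.r_distr)
  show "(0 :: 'a env) \<noteq> 1" using Halg_one_neq_zero[where 'k = 'a, symmetric] by simp
qed

end

lemma rep_env_power: "rep_env (u ^ n) = rep_env u [^]\<^bsub>Halg\<^esub> n"
  by (induction n) (simp_all add: rep_env_simps power_Suc2 del: power_Suc)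

lemma rep_env_minus_power: "rep_env (u ^ n - u) = rep_env u [^]\<^bsub>Halg\<^esub> n \<ominus>\<^bsub>Halg\<^esub> rep_env u"
  by (simp add: rep_env_simps rep_env_power)

definition sc :: "'k::field \<Rightarrow> 'k env" where "sc c = abs_env (c \<odot>\<^bsub>Halg\<^esub> \<one>\<^bsub>Halg\<^esub>)"

lemma rep_env_sc: "rep_env (sc c) = c \<odot>\<^bsub>Halg\<^esub> \<one>\<^bsub>Halg\<^esub>"
  by (simp add: sc_def abs_env_inverse)

lemma rep_env_sc_mult: "rep_env (sc c * u) = c \<odot>\<^bsub>Halg\<^esub> rep_env u"
  using rep_env[of u] by (simp add: rep_env_simps rep_env_sc flip: Halg.sm_mult_left)

lemma sc_add: "sc (c + d) = sc c + sc d"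
  by (simp add: rep_env_inject[symmetric] rep_env_simps rep_env_sc Halg.sm_add_left)

lemma sc_mult: "sc (c * d) = sc c * sc d"
  by (simp add: rep_env_inject[symmetric] rep_env_sc_mult rep_env_sc Halg.sm_sm)

lemma sc_one: "sc 1 = 1"
  by (simp add: rep_env_inject[symmetric] rep_env_simps rep_env_sc Halg.sm_one)

lemma sc_central: "sc c * u = u * sc c"
  using rep_env[of u]
  by (simp add: rep_env_inject[symmetric] rep_env_sc_mult)
     (simp add: rep_env_simps rep_env_sc flip: Halg.sm_mult_right)

definition lin :: "'k::field sl2V \<Rightarrow> 'k env" where "lin a = abs_env (Hincl a)"

lemma Hincl_closed: "a \<in> sl2V \<Longrightarrow> Hincl a \<in> carrier (Halg :: ('k::field, 'k Helem) module)"
  unfolding Hincl_def env_incl_def Halg_def env_alg_def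
  by (rule alg_ideal.cls_closed[OF env_alg_ideal letter_closed])

lemma rep_env_lin: "a \<in> sl2V \<Longrightarrow> rep_env (lin a) = Hincl a"
  by (simp add: lin_def abs_env_inverse Hincl_closed)

context
  fixes a :: "'k::field sl2V"
  assumes a: "a \<in> sl2V"
begin

interpretation alg_ideal "free_alg sl2V :: ('k, 'k sl2V list \<Rightarrow> 'k) module"
  "env_ideal sl2V sl2V_scale sl2V_bracket"
  by (rule env_alg_ideal)

lemmas env_unfold = rep_env_inject[symmetric] rep_env_simps rep_env_lin rep_env_sc_mult
  Hincl_def env_incl_def Halg_def env_alg_def

lemma lin_add:
  assumes b: "b \<in> sl2V"
  shows "lin (a + b) = lin a + lin b"
proof -
  have "(\<lambda>w. letter (a + b) w - letter a w - letter b w) \<in> (env_ideal sl2V sl2V_scale sl2V_bracket :: ('k sl2V list \<Rightarrow> 'k) set)"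
    using a b by (rule_tac subsetD[OF env_rels_in_ideal], unfold env_rels_def) blast
  also have "(\<lambda>w. letter (a + b) w - letter a w - letter b w)
      = letter (a + b) \<ominus>\<^bsub>free_alg sl2V\<^esub> (letter a \<oplus>\<^bsub>free_alg sl2V\<^esub> letter b :: 'k sl2V list \<Rightarrow> 'k)"
    using a b by (subst free_alg_minus, (simp add: letter_closed sl2V_add; fail)+) (simp add: free_alg_simps(5) diff_diff_eq)
  finally show ?thesis
    using a b by (simp add: env_unfold sl2V_add cls_add letter_closed cls_eq_iff)
qed

lemma lin_scale: "lin (sl2V_scale c a) = sc c * lin a"
proof -
  have "(\<lambda>w. letter (sl2V_scale c a) w - c * letter a w) \<in> (env_ideal sl2V sl2V_scale sl2V_bracket :: ('k sl2V list \<Rightarrow> 'k) set)"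
    using a by (rule_tac subsetD[OF env_rels_in_ideal], unfold env_rels_def) blast
  also have "(\<lambda>w. letter (sl2V_scale c a) w - c * letter a w)
      = letter (sl2V_scale c a) \<ominus>\<^bsub>free_alg sl2V\<^esub> (c \<odot>\<^bsub>free_alg sl2V\<^esub> letter a :: 'k sl2V list \<Rightarrow> 'k)"
    using a by (subst free_alg_minus, (simp add: letter_closed sl2V_scale_closed free_smult_closed; fail)+) (simp add: free_alg_simps(6))
  finally show ?thesis
    using a by (simp add: rep_env_inject[symmetric] rep_env_sc_mult rep_env_lin sl2V_scale_closed)
      (simp add: env_unfold sl2V_scale_closed cls_sm letter_closed cls_eq_iff)
qed

lemma lin_bracket:
  assumes b: "b \<in> sl2V"
  shows "lin a * lin b - lin b * lin a = lin (sl2V_bracket a b)"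
proof -
  let ?F = "free_alg sl2V :: ('k, 'k sl2V list \<Rightarrow> 'k) module"
  let ?la = "letter a :: 'k sl2V list \<Rightarrow> 'k" and ?lb = "letter b :: 'k sl2V list \<Rightarrow> 'k"
  have cl: "?la \<in> carrier ?F" "?lb \<in> carrier ?F" "letter (sl2V_bracket a b) \<in> carrier ?F"
    using a b by (auto simp: letter_closed sl2V_bracket_closed)
  have "(\<lambda>w. (?la \<otimes>\<^bsub>?F\<^esub> ?lb) w - (?lb \<otimes>\<^bsub>?F\<^esub> ?la) w - letter (sl2V_bracket a b) w)
      \<in> env_ideal sl2V sl2V_scale sl2V_bracket"
    using a b by (rule_tac subsetD[OF env_rels_in_ideal], unfold env_rels_def) blast
  also have "(\<lambda>w. (?la \<otimes>\<^bsub>?F\<^esub> ?lb) w - (?lb \<otimes>\<^bsub>?F\<^esub> ?la) w - letter (sl2V_bracket a b) w)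
      = ?la \<otimes>\<^bsub>?F\<^esub> ?lb \<ominus>\<^bsub>?F\<^esub> (?lb \<otimes>\<^bsub>?F\<^esub> ?la \<oplus>\<^bsub>?F\<^esub> letter (sl2V_bracket a b))"
    using cl by (subst free_alg_minus, (simp; fail)+) (simp add: free_alg_simps(5) diff_diff_eq)
  finally have "lin a * lin b = lin b * lin a + lin (sl2V_bracket a b)"
    using a b cl by (simp add: env_unfold sl2V_bracket_closed cls_mult cls_add cls_eq_iff)
  then show ?thesis by simp
qed

end

definition env_e :: "'k::field env" where "env_e = lin (mat_e, 0)"
definition env_f :: "'k::field env" where "env_f = lin (mat_f, 0)"
definition env_h :: "'k::field env" where "env_h = lin (mat_h, 0)"
definition env_x :: "'k::field env" where "env_x = lin (0, vec_x)"
definition env_y :: "'k::field env" where "env_y = lin (0, vec_y)"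

lemmas env_gens = env_e_def env_f_def env_h_def env_x_def env_y_def

lemma sl2V_gens [simp]:
  "(mat_e, 0) \<in> sl2V" "(mat_f, 0) \<in> sl2V" "(mat_h, 0) \<in> sl2V" "(0, vec_x) \<in> sl2V" "(0, vec_y) \<in> sl2V"
  by (simp_all add: sl2V_def sl2_def mat_e_def mat_f_def mat_h_def trace_def sum_2)

lemma rep_env_gens:
  "rep_env env_e = He" "rep_env env_f = Hf" "rep_env env_h = Hh" "rep_env env_x = Hx" "rep_env env_y = Hy"
  by (simp_all add: env_gens rep_env_lin He_def Hf_def Hh_def Hx_def Hy_def)

text \<open>
  As the five basis vectors span the Lie algebra, the defining relations reduce to the ten brackets
  between them, and the letters in \<open>free_alg_induct\<close> to five.
\<close>

lemma lin_decomp: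
  fixes A :: "'k::field ^ 2 ^ 2"
  assumes "(A, v) \<in> sl2V"
  shows "lin (A, v) = sc (A$1$2) * env_e + sc (A$2$1) * env_f + sc (A$1$1) * env_h
      + sc (v$1) * env_x + sc (v$2) * env_y"
proof -
  have "A$2$2 = - A$1$1"
    using assms by (simp add: sl2V_def sl2_def trace_def sum_2 eq_neg_iff_add_eq_0 add.commute)
  then have "(A, v) = sl2V_scale (A$1$2) (mat_e, 0) + sl2V_scale (A$2$1) (mat_f, 0)
      + sl2V_scale (A$1$1) (mat_h, 0) + sl2V_scale (v$1) (0, vec_x) + sl2V_scale (v$2) (0, vec_y)"
    by (simp add: sl2V_scale_def mat_scale_def vec_eq_iff forall_2 mat_e_def mat_f_def mat_h_def
        vec_x_def vec_y_def)
  then show ?thesis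
    by (simp only: lin_add lin_scale sl2V_add sl2V_scale_closed sl2V_gens env_gens)
qed

lemma lin_commute:
  fixes A B C :: "'k::field ^ 2 ^ 2" and u v w :: "'k ^ 2"
  assumes "(A, v) \<in> sl2V" "(B, w) \<in> sl2V" "mat_bracket A B = C" "A *v w - B *v v = u"
  shows "lin (A, v) * lin (B, w) = lin (B, w) * lin (A, v)
      + (sc (C$1$2) * env_e + sc (C$2$1) * env_f + sc (C$1$1) * env_h + sc (u$1) * env_x + sc (u$2) * env_y)"
proof -
  have "sl2V_bracket (A, v) (B, w) = (C, u)"
    using assms by (simp add: sl2V_bracket_def)
  moreover from this have "(C, u) \<in> sl2V"
    using sl2V_bracket_closed[OF assms(1,2)] by simp
  ultimately show ?thesis
    using lin_bracket[OF assms(1,2)] lin_decomp[of C u] by (simp add: algebra_simps)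
qed

lemma sc_zero: "sc 0 = 0"
  using sc_add[of 0 0] by simp

lemma sc_minus: "sc (- c) = - sc c"
  using sc_add[of c "- c"] by (simp add: sc_zero eq_neg_iff_add_eq_0 add.commute)

lemma sc_two: "sc 2 = 2"
  using sc_add[of 1 1] by (simp add: sc_one)

lemma env_relations:
  "(env_h :: 'k::field env) * env_e = env_e * env_h + 2 * env_e"
  "(env_h :: 'k::field env) * env_f = env_f * env_h - 2 * env_f"
  "(env_e :: 'k::field env) * env_f = env_f * env_e + env_h"
  "(env_h :: 'k::field env) * env_x = env_x * env_h + env_x"
  "(env_h :: 'k::field env) * env_y = env_y * env_h - env_y"
  "(env_e :: 'k::field env) * env_x = env_x * env_e"
  "(env_e :: 'k::field env) * env_y = env_y * env_e + env_x"
  "(env_f :: 'k::field env) * env_x = env_x * env_f + env_y"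
  "(env_f :: 'k::field env) * env_y = env_y * env_f"
  "(env_x :: 'k::field env) * env_y = env_y * env_x"
  unfolding env_gens
  by (subst lin_commute, (simp; fail), (simp; fail), rule refl, rule refl,
      simp add: mat_bracket_def matrix_matrix_mult_def matrix_vector_mult_def mat_e_def mat_f_def
        mat_h_def vec_x_def vec_y_def sum_2 sc_zero sc_one sc_minus sc_two;
      simp add: env_gens mat_e_def mat_f_def mat_h_def vec_x_def vec_y_def; fail)+

lemma env_induct:
  fixes S :: "'k::field env set"
  assumes one: "1 \<in> S"
    and add: "\<And>u v. u \<in> S \<Longrightarrow> v \<in> S \<Longrightarrow> u + v \<in> S"
    and sc: "\<And>c u. u \<in> S \<Longrightarrow> sc c * u \<in> S"
    and gens: "\<And>u. u \<in> S \<Longrightarrow> env_e * u \<in> S" "\<And>u. u \<in> S \<Longrightarrow> env_f * u \<in> S"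
      "\<And>u. u \<in> S \<Longrightarrow> env_h * u \<in> S" "\<And>u. u \<in> S \<Longrightarrow> env_x * u \<in> S" "\<And>u. u \<in> S \<Longrightarrow> env_y * u \<in> S"
  shows "S = UNIV"
proof -
  let ?F = "free_alg sl2V :: ('k, 'k sl2V list \<Rightarrow> 'k) module"
  interpret alg_ideal ?F "env_ideal sl2V sl2V_scale sl2V_bracket" by (rule env_alg_ideal)
  have rep: "rep_env (abs_env (cls \<phi>)) = cls \<phi>" if "\<phi> \<in> carrier ?F" for \<phi>
    using cls_closed[OF that] by (intro abs_env_inverse) (simp add: Halg_def env_alg_def)
  have lin: "lin a * u \<in> S" if "a \<in> sl2V" "u \<in> S" for a u
  proof (cases a)
    case (Pair A v)
    then show ?thesis
      using that by (simp add: lin_decomp distrib_right mult.assoc add sc gens)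
  qed
  have "abs_env (cls \<phi>) \<in> S" if "\<phi> \<in> carrier ?F" for \<phi>
    using that
  proof (induction \<phi> rule: free_alg_induct)
    case one
    have "abs_env (cls \<one>\<^bsub>?F\<^esub>) = 1" by (simp add: one_env_def Halg_def env_alg_def cls_one)
    then show ?case using assms(1) by simp
  next
    case (add \<phi> \<psi>)
    have "abs_env (cls (\<phi> \<oplus>\<^bsub>?F\<^esub> \<psi>)) = abs_env (cls \<phi>) + abs_env (cls \<psi>)"
      using add by (simp add: plus_env_def rep) (simp add: Halg_def env_alg_def cls_add)
    then show ?case using add assms(2) by simp
  next
    case (smult c \<phi>)
    have "abs_env (cls (c \<odot>\<^bsub>?F\<^esub> \<phi>)) = sc c * abs_env (cls \<phi>)"
      using smult by (simp add: rep_env_inject[symmetric] rep_env_sc_mult rep) (simp add: Halg_def env_alg_def cls_sm)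
    then show ?case using smult assms(3) by simp
  next
    case (letter a \<phi>)
    have "abs_env (cls (letter a \<otimes>\<^bsub>?F\<^esub> \<phi>)) = lin a * abs_env (cls \<phi>)"
      using letter by (simp add: rep_env_inject[symmetric] rep_env_simps rep_env_lin rep letter_closed)
        (simp add: Halg_def env_alg_def Hincl_def env_incl_def cls_mult letter_closed)
    then show ?case using letter lin by simp
  qed
  moreover have "\<exists>\<phi>\<in>carrier ?F. u = abs_env (cls \<phi>)" for u :: "'k env"
    using cls_surj[of "rep_env u"] rep_env[of u]
    by (metis Halg_def env_alg_def rep_env_inverse)
  ultimately show ?thesis by (metis UNIV_eq_I)
qed

section \<open>The center\<close>

text \<open>
  A presentation of the enveloping algebra: the scalars act through a central homomorphism \<open>sc\<close>, the
  generators satisfy the brackets of the Lie algebra, and their products span.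
\<close>

locale sl2V_algebra =
  fixes sc :: "'k::alg_closed_field \<Rightarrow> 'h::ring_1" and e f h x y :: 'h
  assumes sc_add: "sc (c + d) = sc c + sc d"
    and sc_mult: "sc (c * d) = sc c * sc d"
    and sc_one: "sc 1 = 1"
    and sc_central: "sc c * u = u * sc c"
    and he: "h * e = e * h + 2 * e"
    and hf: "h * f = f * h - 2 * f"
    and ef: "e * f = f * e + h"
    and hx: "h * x = x * h + x"
    and hy: "h * y = y * h - y"
    and ex: "e * x = x * e"
    and ey: "e * y = y * e + x"
    and fx: "f * x = x * f + y"
    and fy: "f * y = y * f"
    and xy: "x * y = y * x"
    and gen_induct: "\<And>S. \<lbrakk>1 \<in> S; \<And>u v. u \<in> S \<Longrightarrow> v \<in> S \<Longrightarrow> u + v \<in> S;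
        \<And>c u. u \<in> S \<Longrightarrow> sc c * u \<in> S; \<And>u. u \<in> S \<Longrightarrow> e * u \<in> S; \<And>u. u \<in> S \<Longrightarrow> f * u \<in> S;
        \<And>u. u \<in> S \<Longrightarrow> h * u \<in> S; \<And>u. u \<in> S \<Longrightarrow> x * u \<in> S; \<And>u. u \<in> S \<Longrightarrow> y * u \<in> S\<rbrakk>
        \<Longrightarrow> S = UNIV"
begin

lemma sc_0: "sc 0 = 0"
  using sc_add[of 0 0] by simp

lemma sc_minus: "sc (- c) = - sc c"
  using sc_add[of c "- c"] by (simp add: sc_0 eq_neg_iff_add_eq_0 add.commute)

lemma sc_diff: "sc (c - d) = sc c - sc d"
  using sc_add[of c "- d"] by (simp add: sc_minus)

lemma sc_of_nat: "sc (of_nat n) = of_nat n"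
  by (induction n) (simp_all add: sc_0 sc_one sc_add)

lemma sc_left_commute: "u * (sc c * v) = sc c * (u * v)"
  by (metis mult.assoc sc_central)

definition central :: "'h \<Rightarrow> bool" where "central z \<longleftrightarrow> (\<forall>u. z * u = u * z)"

lemma centralD: "central z \<Longrightarrow> z * u = u * z"
  by (simp add: central_def)

lemma central_left_commute: "central z \<Longrightarrow> u * (z * v) = z * (u * v)"
  by (metis mult.assoc centralD)

lemma central_sc: "central (sc c)"
  by (simp add: central_def sc_central)

lemma central_0: "central 0" and central_1: "central 1"
  by (simp_all add: central_def)

lemma central_add: "central u \<Longrightarrow> central v \<Longrightarrow> central (u + v)"
  and central_diff: "central u \<Longrightarrow> central v \<Longrightarrow> central (u - v)"
  by (simp_all add: central_def algebra_simps)

lemma central_mult: "central u \<Longrightarrow> central v \<Longrightarrow> central (u * v)"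
  unfolding central_def by (metis mult.assoc)

text \<open>
  The elements commuting with \<open>z\<close> are closed under products, so it suffices to test the generators.
\<close>

lemma centralI_gens:
  assumes "z * e = e * z" "z * f = f * z" "z * h = h * z" "z * x = x * z" "z * y = y * z"
  shows "central z"
proof -
  have "{u. z * u = u * z} = UNIV"
  proof (rule gen_induct)
    fix c u assume "u \<in> {u. z * u = u * z}"
    then show "sc c * u \<in> {u. z * u = u * z}"
      by simp (metis mult.assoc sc_central)
  qed (use assms in \<open>auto simp: algebra_simps, (metis mult.assoc)+\<close>)
  then show ?thesis by (auto simp: central_def)
qed

text \<open>
  The analogue of the Casimir element. It becomes the relation that expresses \<open>f\<close> by the other
  generators where \<open>x\<close> is invertible, and \<open>e\<close> where \<open>y\<close> is.
\<close>

definition casimir :: 'h where "casimir = e * y * y + h * x * y - f * x * x"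

lemma casimir_central: "central casimir"
proof -
  have r: "h * (e * u) = e * (h * u) + 2 * e * u" "h * (f * u) = f * (h * u) - 2 * f * u"
    "e * (f * u) = f * (e * u) + h * u" "x * (h * u) = h * (x * u) - x * u"
    "y * (h * u) = h * (y * u) + y * u" "x * (e * u) = e * (x * u)"
    "y * (e * u) = e * (y * u) - x * u" "x * (f * u) = f * (x * u) - y * u"
    "y * (f * u) = f * (y * u)" "y * (x * u) = x * (y * u)" for u
    unfolding mult.assoc[symmetric] by (simp_all add: he hf ef hx hy ex ey fx fy xy algebra_simps)
  have r': "h * e = e * h + 2 * e" "h * f = f * h - 2 * f" "e * f = f * e + h" "x * h = h * x - x"
    "y * h = h * y + y" "x * e = e * x" "y * e = e * y - x" "x * f = f * x - y" "y * f = f * y" "y * x = x * y"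
    by (simp_all add: he hf ef hx hy ex ey fx fy xy algebra_simps)
  show ?thesis
    unfolding casimir_def
    by (rule centralI_gens) (simp_all add: r r' algebra_simps mult_2 mult_2_right)
qed

text \<open>
  If the iterated commutators \<open>w\<close>, \<open>w\<^sub>1 = [u, w]\<close>, \<open>w\<^sub>2 = [u, w\<^sub>1]\<close> end with one commuting with
  \<open>u\<close>, moving \<open>u\<^sup>n\<close> past \<open>w\<close> costs only two terms with binomial coefficients. For \<open>n\<close> the
  characteristic both coefficients vanish.
\<close>

lemma power_past:
  fixes u w w1 w2 :: 'h
  assumes "u * w = w * u + w1" "u * w1 = w1 * u + w2" "u * w2 = w2 * u"
  shows "u ^ (n + 2) * w
    = w * u ^ (n + 2) + of_nat (n + 2) * w1 * u ^ (n + 1) + of_nat ((n + 2) choose 2) * w2 * u ^ n"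
proof (induction n)
  case 0
  have "u * (u * w) = (u * w) * u + u * w1"
    by (metis assms(1) distrib_left mult.assoc)
  then have "u * (u * w) = w * u * u + 2 * (w1 * u) + w2"
    unfolding assms by (simp add: mult_2 algebra_simps)
  then show ?case by (simp add: numeral_2_eq_2 mult.assoc)
next
  case (Suc n)
  have c: "(Suc n + 2) choose 2 = (n + 2) + ((n + 2) choose 2)"
    by (simp add: numeral_2_eq_2)
  have n: "u * (of_nat k * v) = of_nat k * (u * v)" for k v
    by (metis mult.assoc mult_of_nat_commute)
  have a: "u * (v * z) = (u * v) * z" for v z :: 'h by (simp add: mult.assoc)
  have "u ^ (Suc n + 2) * w = u * (u ^ (n + 2) * w)" by (simp add: mult.assoc)
  also have "\<dots> = (u * w) * u ^ (n + 2) + of_nat (n + 2) * ((u * w1) * u ^ (n + 1))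
      + of_nat ((n + 2) choose 2) * ((u * w2) * u ^ n)"
    unfolding Suc by (simp only: distrib_left mult.assoc n)
  also have "\<dots> = w * u ^ (Suc n + 2) + of_nat (Suc n + 2) * w1 * u ^ (Suc n + 1)
      + of_nat ((Suc n + 2) choose 2) * w2 * u ^ Suc n"
    unfolding assms c by (simp add: algebra_simps power_commutes power_Suc2 del: power_Suc binomial_Suc_Suc)
  finally show ?case .
qed

end

locale sl2V_algebra_char = sl2V_algebra sc e f h x y
  for sc :: "'k::alg_closed_field \<Rightarrow> 'h::ring_1" and e f h x y :: 'h +
  fixes p :: nat
  assumes CHAR: "CHAR('k) = p" and p_gt_2: "p > 2"
begin

lemma prime_p: "prime p"
  using prime_CHAR_semidom[where 'a = 'k] CHAR p_gt_2 by simp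

lemma of_nat_eq_0: "p dvd n \<Longrightarrow> (of_nat n :: 'h) = 0"
  by (metis CHAR of_nat_eq_0_iff_char_dvd sc_0 sc_of_nat)

lemma power_p_commutes:
  fixes u w w1 w2 :: 'h
  assumes "u * w = w * u + w1" "u * w1 = w1 * u + w2" "u * w2 = w2 * u"
  shows "u ^ p * w = w * u ^ p"
proof -
  have p: "p - 2 + 2 = p" using p_gt_2 by simp
  have "p dvd (p choose 2)" using prime_p p_gt_2 by (intro dvd_choose_prime) auto
  then show ?thesis
    using power_past[OF assms, of "p - 2"] unfolding p by (simp add: of_nat_eq_0)
qed

lemma commutes_p_power: "u ^ p * u = u * u ^ p" for u :: 'h
  by (simp add: power_commutes)

lemma central_e_p: "central (e ^ p)"
  using power_p_commutes[of e f h "- 2 * e"] power_p_commutes[of e h "- 2 * e" 0]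
    power_p_commutes[of e x 0 0] power_p_commutes[of e y x 0]
  by (intro centralI_gens) (simp_all add: commutes_p_power he ef ex ey mult_2 mult_2_right algebra_simps)

lemma central_f_p: "central (f ^ p)"
  using power_p_commutes[of f e "- h" "- 2 * f"] power_p_commutes[of f h "2 * f" 0]
    power_p_commutes[of f x y 0] power_p_commutes[of f y 0 0]
  by (intro centralI_gens) (simp_all add: commutes_p_power hf ef fx fy mult_2 mult_2_right algebra_simps)

lemma central_x_p: "central (x ^ p)"
  using power_p_commutes[of x e 0 0] power_p_commutes[of x f "- y" 0]
    power_p_commutes[of x h "- x" 0] power_p_commutes[of x y 0 0]
  by (intro centralI_gens) (simp_all add: commutes_p_power hx ex fx xy)

lemma central_y_p: "central (y ^ p)"
  using power_p_commutes[of y e "- x" 0] power_p_commutes[of y f 0 0]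
    power_p_commutes[of y h y 0] power_p_commutes[of y x 0 0]
  by (intro centralI_gens) (simp_all add: commutes_p_power hy ey fy xy)

text \<open>
  Horner's scheme. As the scalars are central, it is multiplicative in the polynomial although the
  ring is not commutative.
\<close>

definition peval :: "'k poly \<Rightarrow> 'h \<Rightarrow> 'h" where
  "peval P u = fold_coeffs (\<lambda>a b. sc a + u * b) P 0"

lemma peval_0 [simp]: "peval 0 u = 0"
  by (simp add: peval_def)

lemma peval_pCons [simp]: "peval (pCons a P) u = sc a + u * peval P u"
  by (cases "P = 0 \<and> a = 0") (auto simp: peval_def sc_0)

lemma peval_add: "peval (P + Q) u = peval P u + peval Q u"
  by (induction P Q rule: poly_induct2) (simp_all add: sc_add algebra_simps)

lemma peval_smult: "peval (smult c P) u = sc c * peval P u"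
  by (induction P) (simp_all add: sc_mult distrib_left sc_left_commute)

lemma peval_mult: "peval (P * Q) u = peval P u * peval Q u"
  by (induction P) (simp_all add: peval_add peval_smult distrib_right mult.assoc sc_0)

lemma peval_1 [simp]: "peval 1 u = 1"
  by (simp add: one_pCons sc_one)

lemma peval_power: "peval (P ^ n) u = peval P u ^ n"
  by (induction n) (simp_all add: peval_mult)

lemma peval_monom: "peval (monom c n) u = sc c * u ^ n"
  by (induction n) (simp_all add: monom_0 monom_Suc sc_0 sc_left_commute)

text \<open>
  The powers of a single element commute, so the Frobenius identity of the commutative ring of
  polynomials carries over.
\<close>

lemma add_sc_power_p: "(u + sc c) ^ p = u ^ p + sc (c ^ p)"
proof -
  have u: "peval [:c, 1:] u = u + sc c" by (simp add: sc_one add.commute)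
  have "[:c, 1:] = monom 1 1 + [:c:]" by (simp add: monom_altdef)
  then have "[:c, 1:] ^ p = monom 1 1 ^ p + [:c:] ^ p"
    using freshmans_dream[where 'a = "'k poly"] prime_p CHAR by simp
  also have "\<dots> = monom 1 p + [:c ^ p:]"
    by (simp add: poly_const_pow monom_power)
  finally have "peval ([:c, 1:] ^ p) u = u ^ p + sc (c ^ p)"
    by (simp only: peval_add peval_monom peval_pCons peval_0 sc_one) simp
  then show ?thesis by (simp only: peval_power u)
qed

lemma of_nat_power_p: "(of_nat n :: 'k) ^ p = of_nat n"
proof (induction n)
  case 0
  show ?case using p_gt_2 by simp
next
  case (Suc n)
  then show ?case using freshmans_dream[where 'a = 'k] prime_p CHAR by simp
qed

lemma minus_power_p: "(- c :: 'k) ^ p = - (c ^ p)"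
  using prime_odd_nat[OF prime_p p_gt_2] by simp

text \<open>
  The other generators are weight vectors: \<open>h w = w (h + c)\<close> with \<open>c\<close> in the prime field, so that
  \<open>c\<^sup>p = c\<close> and \<open>h\<^sup>p\<close> is shifted by the same \<open>c\<close> as \<open>h\<close>.
\<close>

lemma central_h_p: "central (h ^ p - h)"
proof -
  have shift: "(h ^ p - h) * w = w * (h ^ p - h)" if w: "h * w = w * (h + sc c)" and c: "c ^ p = c"
    for w c
  proof -
    have "h ^ n * w = w * (h + sc c) ^ n" for n
    proof (induction n)
      case (Suc n)
      have "h ^ Suc n * w = h * (h ^ n * w)" by (simp add: mult.assoc)
      also have "\<dots> = w * ((h + sc c) * (h + sc c) ^ n)" by (metis Suc mult.assoc w)
      finally show ?case by simp
    qed simp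
    then show ?thesis
      by (simp add: add_sc_power_p w c algebra_simps)
  qed
  have two: "sc 2 = 2" using sc_of_nat[of 2] by simp
  have two_p: "(2 :: 'k) ^ p = 2" using of_nat_power_p[of 2] by simp
  show ?thesis
    using shift[of e 2] shift[of f "-2"] shift[of x 1] shift[of y "-1"]
    by (intro centralI_gens)
      (simp_all add: commutes_p_power he hf hx hy sc_minus sc_one two two_p minus_power_p mult_2 mult_2_right algebra_simps)
qed

end

section \<open>Layers\<close>

context sl2V_algebra_char
begin

lemma brackets:
  "h * e - e * h = e + e" "f * e - e * f = - h" "x * e - e * x = 0" "y * e - e * y = - x"
  "e * f - f * e = h" "h * f - f * h = - f - f" "x * f - f * x = - y" "y * f - f * y = 0"
  "e * h - h * e = - e - e" "f * h - h * f = f + f" "x * h - h * x = - x" "y * h - h * y = y"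
  "e * x - x * e = 0" "f * x - x * f = y" "h * x - x * h = x" "y * x - x * y = 0"
  "e * y - y * e = x" "f * y - y * f = 0" "h * y - y * h = - y" "x * y - y * x = 0"
  by (simp_all add: he hf ef hx hy ex ey fx fy xy mult_2)

definition subspace :: "'h set \<Rightarrow> bool" where
  "subspace T \<longleftrightarrow> 0 \<in> T \<and> (\<forall>u\<in>T. \<forall>v\<in>T. u + v \<in> T) \<and> (\<forall>c. \<forall>u\<in>T. sc c * u \<in> T)"

lemma subspace_0: "subspace T \<Longrightarrow> 0 \<in> T"
  and subspace_add: "subspace T \<Longrightarrow> u \<in> T \<Longrightarrow> v \<in> T \<Longrightarrow> u + v \<in> T"
  and subspace_sc: "subspace T \<Longrightarrow> u \<in> T \<Longrightarrow> sc c * u \<in> T"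
  by (auto simp: subspace_def)

lemma subspace_minus: "subspace T \<Longrightarrow> u \<in> T \<Longrightarrow> - u \<in> T"
  using subspace_sc[of T u "- 1"] by (simp add: sc_minus sc_one)

lemma subspace_diff: "subspace T \<Longrightarrow> u \<in> T \<Longrightarrow> v \<in> T \<Longrightarrow> u - v \<in> T"
  using subspace_add[of T u "- v"] by (simp add: subspace_minus)

lemma subspace_of_nat: "subspace T \<Longrightarrow> u \<in> T \<Longrightarrow> of_nat n * u \<in> T"
  using subspace_sc[of T u "of_nat n"] by (simp add: sc_of_nat)

lemma subspace_sum: "subspace T \<Longrightarrow> (\<And>i. i \<in> A \<Longrightarrow> t i \<in> T) \<Longrightarrow> sum t A \<in> T"
  by (induction A rule: infinite_finite_induct) (auto simp: subspace_0 subspace_add)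

definition layer :: "'h \<Rightarrow> 'h set \<Rightarrow> 'h set" where
  "layer g T = {\<Sum>i<p. g ^ i * t i | t. \<forall>i. t i \<in> T}"

lemma layer_subspace:
  assumes T: "subspace T" shows "subspace (layer g T)"
  unfolding subspace_def
proof (intro conjI ballI allI)
  show "0 \<in> layer g T"
    unfolding layer_def using T by (auto intro!: exI[of _ "\<lambda>_. 0"] simp: subspace_0)
  fix u v assume "u \<in> layer g T" "v \<in> layer g T"
  then obtain s t where "\<forall>i. s i \<in> T" "\<forall>i. t i \<in> T"
    "u = (\<Sum>i<p. g ^ i * s i)" "v = (\<Sum>i<p. g ^ i * t i)" by (auto simp: layer_def)
  then show "u + v \<in> layer g T"
    unfolding layer_def using T
    by (auto intro!: exI[of _ "\<lambda>i. s i + t i"] simp: subspace_add distrib_left sum.distrib)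
next
  fix c u assume "u \<in> layer g T"
  then obtain t where "\<forall>i. t i \<in> T" "u = (\<Sum>i<p. g ^ i * t i)" by (auto simp: layer_def)
  then show "sc c * u \<in> layer g T"
    unfolding layer_def using T
    by (auto intro!: exI[of _ "\<lambda>i. sc c * t i"] simp: subspace_sc sum_distrib_left sc_left_commute)
qed

lemma layer_power:
  assumes T: "subspace T" and t: "t \<in> T" and i: "i < p"
  shows "g ^ i * t \<in> layer g T"
proof -
  have "g ^ i * t = (\<Sum>j<p. g ^ j * (if j = i then t else 0))"
    using i by (simp add: if_distrib cong: if_cong)
  then show ?thesis
    unfolding layer_def using T t by (auto simp: subspace_0 intro!: exI[of _ "\<lambda>j. if j = i then t else 0"])
qed

lemma layer_superset: "subspace T \<Longrightarrow> T \<subseteq> layer g T"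
  using layer_power[of T _ 0 g] p_gt_2 by auto

lemma layer_subset:
  assumes N: "subspace N" and g: "\<And>u. u \<in> N \<Longrightarrow> g * u \<in> N" and T: "T \<subseteq> N"
  shows "layer g T \<subseteq> N"
proof -
  have "g ^ i * t \<in> N" if "t \<in> T" for i t
    using that T by (induction i) (auto simp: mult.assoc g)
  then show ?thesis by (auto simp: layer_def intro!: subspace_sum[OF N])
qed

lemma layer_mult:
  assumes L: "subspace L" and u: "\<And>i t. i < p \<Longrightarrow> t \<in> T \<Longrightarrow> u * (g ^ i * t) \<in> L"
    and s: "s \<in> layer g T"
  shows "u * s \<in> L"
proof -
  obtain t where t: "\<forall>i. t i \<in> T" "s = (\<Sum>i<p. g ^ i * t i)"
    using s by (auto simp: layer_def)
  have "(\<Sum>i<p. u * (g ^ i * t i)) \<in> L"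
    using t u by (intro subspace_sum[OF L]) auto
  then show ?thesis by (simp add: t sum_distrib_left)
qed

text \<open>
  Adjoining the powers of \<open>g\<close> to a subspace stable under \<open>U\<close> gives a subspace stable under \<open>U\<close> and
  \<open>g\<close>, as soon as \<open>g\<^sup>p\<close> reduces to lower powers and the commutators of \<open>U\<close> with \<open>g\<close> lie in the span of
  \<open>U\<close> and \<open>g\<close>: moving \<open>u\<close> past one factor \<open>g\<close> leaves a term with fewer factors to pass. Iterated, this is the spanning half of the
  Poincare--Birkhoff--Witt theorem, with exponents below \<open>p\<close>.
\<close>

lemma layer_closed:
  assumes T: "subspace T"
    and U: "\<And>u t. u \<in> U \<Longrightarrow> t \<in> T \<Longrightarrow> u * t \<in> T"
    and comm: "\<And>u s. u \<in> U \<Longrightarrow> (\<And>v. v \<in> insert g U \<Longrightarrow> v * s \<in> layer g T)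
        \<Longrightarrow> (u * g - g * u) * s \<in> layer g T"
    and gp: "\<And>t. t \<in> T \<Longrightarrow> g ^ p * t \<in> layer g T"
    and u: "u \<in> insert g U" and s: "s \<in> layer g T"
  shows "u * s \<in> layer g T"
proof -
  have L: "subspace (layer g T)" by (rule layer_subspace[OF T])
  have g: "g * s \<in> layer g T" if "s \<in> layer g T" for s
  proof -
    have "g * (g ^ i * t) \<in> layer g T" if "i < p" "t \<in> T" for i t
    proof (cases "Suc i = p")
      case True
      have "g * (g ^ i * t) = g ^ Suc i * t" by (simp add: mult.assoc)
      then show ?thesis using gp[OF that(2)] True by simp
    next
      case False
      then show ?thesis using layer_power[OF T that(2), of "Suc i" g] that by (simp add: mult.assoc)
    qed
    from layer_mult[OF L this that] show ?thesis .
  qed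
  have pow: "g ^ i * t \<in> layer g T" if "t \<in> T" for i t
    using that layer_superset[OF T, of g] by (induction i) (auto simp: mult.assoc g)
  have "\<forall>u\<in>U. u * (g ^ i * t) \<in> layer g T" if t: "t \<in> T" for i t
  proof (induction i)
    case 0
    show ?case using U t layer_superset[OF T, of g] by auto
  next
    case (Suc i)
    show ?case
    proof
      fix u assume u: "u \<in> U"
      have "(u * g - g * u) * (g ^ i * t) \<in> layer g T"
        using Suc u g pow[OF t, of i] by (intro comm) auto
      moreover have "g * (u * (g ^ i * t)) \<in> layer g T" using Suc u g by auto
      moreover have "u * (g ^ Suc i * t) = g * (u * (g ^ i * t)) + (u * g - g * u) * (g ^ i * t)"
        by (simp add: algebra_simps)
      ultimately show "u * (g ^ Suc i * t) \<in> layer g T" by (simp add: subspace_add[OF L])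
    qed
  qed
  then have "u * s \<in> layer g T" if "u \<in> U" for u
    using that s by (intro layer_mult[OF L, of T u g s]) simp_all
  with g u s show ?thesis by auto
qed

section \<open>The enveloping algebra is finite over its center\<close>

definition center :: "'h set" where "center = {z. central z}"

lemma center_subspace: "subspace center"
  by (auto simp: subspace_def center_def central_0 central_add central_mult central_sc)

definition center_stable :: "'h set \<Rightarrow> bool" where
  "center_stable T \<longleftrightarrow> (\<forall>z t. central z \<longrightarrow> t \<in> T \<longrightarrow> z * t \<in> T)"

lemma layer_center_stable: "center_stable T \<Longrightarrow> center_stable (layer g T)"
  unfolding center_stable_def layer_def
proof (intro allI impI)
  fix z s assume T: "\<forall>z t. central z \<longrightarrow> t \<in> T \<longrightarrow> z * t \<in> T" and z: "central z"
    and "s \<in> {\<Sum>i<p. g ^ i * t i |t. \<forall>i. t i \<in> T}"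
  then obtain t where t: "\<forall>i. t i \<in> T" "s = (\<Sum>i<p. g ^ i * t i)" by auto
  then show "z * s \<in> {\<Sum>i<p. g ^ i * t i |t. \<forall>i. t i \<in> T}"
    using T z by (auto intro!: exI[of _ "\<lambda>i. z * t i"] simp: sum_distrib_left central_left_commute)
qed

text \<open>
  The combinations of the entries of a list: in Nakayama's lemma the generators leave one at a time,
  from the head.
\<close>

fun combos :: "'h set \<Rightarrow> 'h list \<Rightarrow> 'h set" where
  "combos C [] = {0}"
| "combos C (b # bs) = {c * b + s | c s. c \<in> C \<and> s \<in> combos C bs}"

lemma combos_append: "u \<in> combos C bs \<Longrightarrow> v \<in> combos C bs' \<Longrightarrow> u + v \<in> combos C (bs @ bs')"
proof (induction bs arbitrary: u)
  case (Cons b bs)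
  then obtain c s where c: "c \<in> C" "s \<in> combos C bs" "u = c * b + s" by auto
  then have "s + v \<in> combos C (bs @ bs')" using Cons by simp
  with c show ?case by (auto simp: add.assoc)
qed simp

lemma combos_map: "u \<in> combos center bs \<Longrightarrow> g * u \<in> combos center (map ((*) g) bs)"
proof (induction bs arbitrary: u)
  case (Cons b bs)
  then obtain c s where c: "c \<in> center" "s \<in> combos center bs" "u = c * b + s" by auto
  then have "g * u = c * (g * b) + g * s"
    by (simp add: center_def distrib_left central_left_commute)
  with c Cons show ?case by auto
qed simp

definition finite_over_center :: "'h set \<Rightarrow> bool" where
  "finite_over_center T \<longleftrightarrow> (\<exists>bs. T \<subseteq> combos center bs)"

lemma layer_finite_over_center:
  assumes "finite_over_center T" shows "finite_over_center (layer g T)"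
proof -
  obtain bs where bs: "T \<subseteq> combos center bs" using assms by (auto simp: finite_over_center_def)
  have "\<exists>bs'. \<forall>t. (\<forall>i. t i \<in> T) \<longrightarrow> (\<Sum>i<n. g ^ i * t i) \<in> combos center bs'" for n
  proof (induction n)
    case 0
    show ?case by (intro exI[of _ "[]"]) simp
  next
    case (Suc n)
    then obtain bs' where "\<forall>t. (\<forall>i. t i \<in> T) \<longrightarrow> (\<Sum>i<n. g ^ i * t i) \<in> combos center bs'" by auto
    then have "\<forall>t. (\<forall>i. t i \<in> T) \<longrightarrow> (\<Sum>i<Suc n. g ^ i * t i) \<in> combos center (bs' @ map ((*) (g ^ n)) bs)"
      using bs by (auto intro!: combos_append combos_map)
    then show ?case by blast
  qed
  then show ?thesis unfolding finite_over_center_def layer_def by blast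
qed

text \<open>
  In the order \<open>y\<close>, \<open>x\<close>, \<open>f\<close>, \<open>h\<close>, \<open>e\<close> the commutator of each generator with an earlier one lies in
  the span of the generators up to this point, which is what \<open>layer_closed\<close> asks for.
\<close>

lemma finite_over_center_UNIV: "finite_over_center UNIV"
proof -
  define T1 where "T1 = layer y center"
  define T2 where "T2 = layer x T1"
  define T3 where "T3 = layer f T2"
  define T4 where "T4 = layer h T3"
  define T5 where "T5 = layer e T4"
  note defs = T1_def T2_def T3_def T4_def T5_def
  have sub: "subspace T1" "subspace T2" "subspace T3" "subspace T4" "subspace T5"
    unfolding defs by (intro layer_subspace center_subspace)+
  have cs: "center_stable center" "center_stable T1" "center_stable T2" "center_stable T3"
      "center_stable T4" "center_stable T5"
  proof -
    show "center_stable center" by (simp add: center_stable_def center_def central_mult)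
    then show "center_stable T1" "center_stable T2" "center_stable T3" "center_stable T4" "center_stable T5"
      unfolding defs by (simp_all add: layer_center_stable)
  qed
  have fin: "finite_over_center T5"
    unfolding defs
    by (intro layer_finite_over_center) (auto simp: finite_over_center_def intro!: exI[of _ "[1]"])
  have gp: "g ^ p * t \<in> layer g T" if "central (g ^ p)" "center_stable T" "subspace T" "t \<in> T" for g t T
    using that layer_superset[of T g] by (auto simp: center_stable_def)
  note cl = subspace_add subspace_minus subspace_diff subspace_0
  have 1: "u * s \<in> T1" if "u \<in> {y}" "s \<in> T1" for u s
    using layer_closed[of center "{}" y u s] gp[OF central_y_p cs(1) center_subspace]
      center_subspace that by (auto simp: T1_def)
  have 2: "u * s \<in> T2" if "u \<in> {x, y}" "s \<in> T2" for u s
    unfolding T2_def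
  proof (rule layer_closed[where U = "{y}"])
    show "(u * x - x * u) * s \<in> layer x T1" if "u \<in> {y}" for u s
      using that sub(2) by (simp add: xy subspace_0 flip: T2_def)
  qed (use that sub 1 gp[OF central_x_p cs(2) sub(1)] in \<open>auto simp: T2_def\<close>)
  have 3: "u * s \<in> T3" if "u \<in> {f, x, y}" "s \<in> T3" for u s
    unfolding T3_def
  proof (rule layer_closed[where U = "{x, y}"])
    show "(u * f - f * u) * s \<in> layer f T2"
      if "u \<in> {x, y}" "\<And>v. v \<in> insert f {x, y} \<Longrightarrow> v * s \<in> layer f T2" for u s
      using that(1) sub(3) that(2) by (elim insertE) (simp_all add: brackets distrib_right left_diff_distrib cl flip: T3_def)
  qed (use that sub 2 gp[OF central_f_p cs(3) sub(2)] in \<open>auto simp: T3_def\<close>)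
  have 4: "u * s \<in> T4" if "u \<in> {h, f, x, y}" "s \<in> T4" for u s
    unfolding T4_def
  proof (rule layer_closed[where U = "{f, x, y}"])
    show "(u * h - h * u) * s \<in> layer h T3"
      if "u \<in> {f, x, y}" "\<And>v. v \<in> insert h {f, x, y} \<Longrightarrow> v * s \<in> layer h T3" for u s
      using that(1) sub(4) that(2) by (elim insertE) (simp_all add: brackets distrib_right left_diff_distrib cl flip: T4_def)
    show "h ^ p * t \<in> layer h T3" if t: "t \<in> T3" for t
    proof -
      have "(h ^ p - h) * t \<in> T4"
        using cs(4) t central_h_p layer_superset[OF sub(3)] by (auto simp: center_stable_def T4_def)
      moreover have "h * t \<in> T4" using layer_power[OF sub(3) t, of 1 h] p_gt_2 by (simp add: T4_def)
      ultimately show ?thesis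
        using subspace_add[OF sub(4)] by (fastforce simp: left_diff_distrib T4_def[symmetric])
    qed
  qed (use that sub 3 in \<open>auto simp: T4_def\<close>)
  have 5: "u * s \<in> T5" if "u \<in> {e, h, f, x, y}" "s \<in> T5" for u s
    unfolding T5_def
  proof (rule layer_closed[where U = "{h, f, x, y}"])
    show "(u * e - e * u) * s \<in> layer e T4"
      if "u \<in> {h, f, x, y}" "\<And>v. v \<in> insert e {h, f, x, y} \<Longrightarrow> v * s \<in> layer e T4" for u s
      using that(1) sub(5) that(2) by (elim insertE) (simp_all add: brackets distrib_right left_diff_distrib cl flip: T5_def)
  qed (use that sub 4 gp[OF central_e_p cs(5) sub(4)] in \<open>auto simp: T5_def\<close>)
  have "center \<subseteq> T1" "T1 \<subseteq> T2" "T2 \<subseteq> T3" "T3 \<subseteq> T4" "T4 \<subseteq> T5"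
    using sub center_subspace by (simp_all only: layer_superset defs)
  then have "center \<subseteq> T5" by blast
  then have "1 \<in> T5" by (auto simp: center_def central_1)
  then have "T5 = UNIV"
    using sub(5) 5 by (intro gen_induct) (auto simp: subspace_add subspace_sc)
  with fin show ?thesis by simp
qed

end

section \<open>Left ideals over a point of the center\<close>

locale sl2V_point = sl2V_algebra_char sc e f h x y p
  for sc :: "'k::alg_closed_field \<Rightarrow> 'h::ring_1" and e f h x y :: 'h and p :: nat +
  fixes chi :: "'h \<Rightarrow> 'k"
  assumes chi_add: "central u \<Longrightarrow> central v \<Longrightarrow> chi (u + v) = chi u + chi v"
    and chi_mult: "central u \<Longrightarrow> central v \<Longrightarrow> chi (u * v) = chi u * chi v"
    and chi_sc: "chi (sc c) = c"
begin

lemma chi_0: "chi 0 = 0" and chi_1: "chi 1 = 1"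
  using chi_sc[of 0] chi_sc[of 1] by (simp_all add: sc_0 sc_one)

lemma chi_diff: "central u \<Longrightarrow> central v \<Longrightarrow> chi (u - v) = chi u - chi v"
  using chi_add[of "u - v" v] by (simp add: central_diff)

text \<open>
  The annihilators of nonzero vectors in modules on which the center acts through \<open>chi\<close>.
\<close>

definition point_ideal :: "'h set \<Rightarrow> bool" where
  "point_ideal J \<longleftrightarrow> 0 \<in> J \<and> (\<forall>u\<in>J. \<forall>v\<in>J. u + v \<in> J) \<and> (\<forall>u. \<forall>v\<in>J. u * v \<in> J) \<and>
     (\<forall>z. central z \<longrightarrow> chi z = 0 \<longrightarrow> z \<in> J) \<and> 1 \<notin> J"

lemma point_ideal_mult: "point_ideal J \<Longrightarrow> v \<in> J \<Longrightarrow> u * v \<in> J"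
  and point_ideal_one: "point_ideal J \<Longrightarrow> 1 \<notin> J"
  by (auto simp: point_ideal_def)

lemma point_ideal_subspace: "point_ideal J \<Longrightarrow> subspace J"
  by (auto simp: point_ideal_def subspace_def)

lemma point_ideal_central: "point_ideal J \<Longrightarrow> central z \<Longrightarrow> z * u - sc (chi z) * u \<in> J"
proof -
  assume J: "point_ideal J" and z: "central z"
  have c: "central (z - sc (chi z))" by (intro central_diff z central_sc)
  moreover have "chi (z - sc (chi z)) = 0" by (simp add: chi_diff z central_sc chi_sc)
  ultimately have "u * (z - sc (chi z)) \<in> J" using J by (auto simp: point_ideal_def)
  then show ?thesis using centralD[OF c, of u] by (simp add: left_diff_distrib)
qed

lemma point_ideal_sc_cancel: "point_ideal J \<Longrightarrow> sc c * u \<in> J \<Longrightarrow> c \<noteq> 0 \<Longrightarrow> u \<in> J"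
  using point_ideal_mult[of J "sc c * u" "sc (inverse c)"]
  by (simp flip: mult.assoc sc_mult) (simp add: sc_one)

lemma point_ideal_sc: "point_ideal J \<Longrightarrow> sc c \<in> J \<longleftrightarrow> c = 0"
  using point_ideal_sc_cancel[of J c 1] point_ideal_one[of J] subspace_0[OF point_ideal_subspace]
  by (auto simp: sc_0)

lemma point_ideal_diff_iff: "point_ideal J \<Longrightarrow> u - v \<in> J \<Longrightarrow> u \<in> J \<longleftrightarrow> v \<in> J"
  using subspace_diff[OF point_ideal_subspace, of J u "u - v"]
    subspace_add[OF point_ideal_subspace, of J "u - v" v] by auto

text \<open>
  In terms of modules, \<open>J\<close> is the annihilator of a vector \<open>w\<close>, and \<open>colon J a\<close> that of \<open>a w\<close>.
\<close>

definition colon :: "'h set \<Rightarrow> 'h \<Rightarrow> 'h set" where "colon J a = {u. u * a \<in> J}"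

lemma colon_colon: "colon (colon J a) b = colon J (b * a)"
  by (simp add: colon_def mult.assoc)

lemma point_ideal_colon: "point_ideal J \<Longrightarrow> a \<notin> J \<Longrightarrow> point_ideal (colon J a)"
  unfolding point_ideal_def colon_def
  by (auto simp: distrib_right mult.assoc) (metis centralD)

inductive_set ker_ideal :: "'h set" where
  ker_mult: "central z \<Longrightarrow> chi z = 0 \<Longrightarrow> z * u \<in> ker_ideal"
| ker_add: "u \<in> ker_ideal \<Longrightarrow> v \<in> ker_ideal \<Longrightarrow> u + v \<in> ker_ideal"

lemma combos_mult:
  "(\<And>c. c \<in> C \<Longrightarrow> z * c \<in> D) \<Longrightarrow> u \<in> combos C bs \<Longrightarrow> z * u \<in> combos D bs"
proof (induction bs arbitrary: u)
  case (Cons b bs)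
  then obtain c s where "c \<in> C" "s \<in> combos C bs" "u = c * b + s" by auto
  with Cons show ?case by (auto simp: distrib_left mult.assoc[symmetric])
qed simp

lemma combos_add:
  "(\<And>c d. c \<in> C \<Longrightarrow> d \<in> C \<Longrightarrow> c + d \<in> C) \<Longrightarrow> u \<in> combos C bs \<Longrightarrow> v \<in> combos C bs
    \<Longrightarrow> u + v \<in> combos C bs"
proof (induction bs arbitrary: u v)
  case (Cons b bs)
  from Cons.prems obtain c s d t where c: "c \<in> C" "s \<in> combos C bs" "d \<in> C" "t \<in> combos C bs"
    and uv: "u = c * b + s" "v = d * b + t" by auto
  have "u + v = (c + d) * b + (s + t)" by (simp add: uv algebra_simps)
  moreover have "c + d \<in> C" "s + t \<in> combos C bs" using Cons c by blast+
  ultimately show ?case unfolding combos.simps by blast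
qed simp

lemma combos_mono: "C \<subseteq> D \<Longrightarrow> combos C bs \<subseteq> combos D bs"
  by (induction bs) auto

text \<open>
  The left ideal generated by the kernel of a character of the center is proper. This is
  Nakayama's lemma: if it were everything, the generators of the algebra over its center could be
  dropped one at a time, each at the price of a central factor on which the character is 1.
\<close>

lemma one_notin_ker_ideal: "1 \<notin> ker_ideal"
proof
  assume one: "1 \<in> ker_ideal"
  let ?m = "{z. central z \<and> chi z = 0}"
  have center_ops: "\<And>c d. c \<in> center \<Longrightarrow> d \<in> center \<Longrightarrow> c + d \<in> center"
    "\<And>c d. c \<in> center \<Longrightarrow> d \<in> center \<Longrightarrow> c * d \<in> center"
    by (simp_all add: center_def central_add central_mult)
  have drop: "\<exists>s'. central s' \<and> chi s' = 1 \<and> (\<forall>u. s' * u \<in> combos center bs)"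
    if s: "central s" "chi s = 1" "\<And>u. s * u \<in> combos center (b # bs)" for s b bs
  proof -
    \<comment> \<open>As \<open>1\<close> lies in the ideal, \<open>s b\<close> has coefficients in the kernel; that of \<open>b\<close> moves to the left.\<close>
    have "v \<in> ker_ideal \<Longrightarrow> s * (v * b) \<in> combos ?m (b # bs)" for v
    proof (induction v rule: ker_ideal.induct)
      case (ker_mult z u)
      have "z * (s * (u * b)) \<in> combos ?m (b # bs)"
        by (rule combos_mult[OF _ s(3)]) (use ker_mult in \<open>simp add: center_def central_mult chi_mult\<close>)
      then show ?case by (metis central_left_commute ker_mult(1) mult.assoc)
    next
      case (ker_add u v)
      then have "s * (u * b) + s * (v * b) \<in> combos ?m (b # bs)"
        by (intro combos_add) (auto simp: central_add chi_add)
      then show ?case by (simp add: distrib_right distrib_left)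
    qed
    from this[OF one] have "s * b \<in> combos ?m (b # bs)" by simp
    then obtain c t where c: "central c" "chi c = 0" and t: "t \<in> combos ?m bs" and sb: "s * b = c * b + t"
      by auto
    have t: "t \<in> combos center bs" using t combos_mono[of ?m center bs] by (auto simp: center_def)
    have sc: "central (s - c)" by (intro central_diff s c)
    have "((s - c) * s) * u \<in> combos center bs" for u
    proof -
      obtain c' t' where c': "c' \<in> center" "t' \<in> combos center bs" "s * u = c' * b + t'"
        using s(3)[of u] by auto
      have "((s - c) * s) * u = c' * ((s - c) * b) + (s - c) * t'"
        using c'(1) by (simp add: c'(3) mult.assoc distrib_left center_def central_left_commute)
      also have "(s - c) * b = t" by (simp add: sb left_diff_distrib)
      finally have eq: "(s - c) * s * u = c' * t + (s - c) * t'" .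
      have "c' * t \<in> combos center bs"
        by (rule combos_mult[OF _ t]) (use c'(1) in \<open>simp add: center_def central_mult\<close>)
      moreover have "(s - c) * t' \<in> combos center bs"
        by (rule combos_mult[OF _ c'(2)]) (use sc in \<open>simp add: center_def central_mult\<close>)
      ultimately show ?thesis unfolding eq by (intro combos_add[OF center_ops(1)])
    qed
    moreover have "central ((s - c) * s)" "chi ((s - c) * s) = 1"
      using s c sc by (simp_all add: central_mult chi_mult chi_diff)
    ultimately show ?thesis by blast
  qed
  obtain bs where "UNIV = combos center bs"
    using finite_over_center_UNIV by (auto simp: finite_over_center_def)
  then have "\<exists>s. central s \<and> chi s = 1 \<and> (\<forall>u. s * u \<in> combos center bs)"
    by (intro exI[of _ 1]) (auto simp: central_1 chi_1)
  then have "\<exists>s. central s \<and> chi s = 1 \<and> (\<forall>u. s * u \<in> combos center [])"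
  proof (induction bs)
    case (Cons b bs)
    then show ?case using drop by blast
  qed
  then obtain s where s: "chi s = 1" "\<forall>u. s * u \<in> combos center []" by blast
  then have "s * 1 = 0" by (metis combos.simps(1) singletonD)
  with s(1) show False by (simp add: chi_0)
qed

lemma ker_ideal_point_ideal: "point_ideal ker_ideal"
  unfolding point_ideal_def
proof (intro conjI ballI allI impI)
  show "0 \<in> ker_ideal" using ker_mult[of 0 0] by (simp add: central_0 chi_0)
  fix u v assume "v \<in> ker_ideal"
  then show "u * v \<in> ker_ideal"
    by induction (auto simp: distrib_left central_left_commute intro: ker_ideal.intros)
next
  fix z assume "central z" "chi z = 0"
  then show "z \<in> ker_ideal" using ker_mult[of z 1] by simp
qed (auto intro: ker_add simp: one_notin_ker_ideal)

section \<open>Eigenvectors\<close>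

lemma peval_normalized: "d * u = (u + sc c) * d \<Longrightarrow> \<exists>b. d * peval Q u = b * d"
proof (induction Q)
  case (pCons a Q)
  then obtain b where b: "d * peval Q u = b * d" by auto
  then have "d * peval (pCons a Q) u = (sc a + (u + sc c) * b) * d"
  proof -
    have "d * (u * peval Q u) = (u + sc c) * (d * peval Q u)"
      by (simp only: mult.assoc[symmetric] pCons.prems)
    also have "\<dots> = (u + sc c) * b * d" by (simp only: mult.assoc b)
    finally show ?thesis by (simp add: distrib_left distrib_right sc_central)
  qed
  then show ?case by blast
qed (auto intro: exI[of _ 0])

text \<open>
  A nonzero polynomial \<open>P\<close> of least degree with \<open>P(u)\<close> in \<open>J\<close> has a linear factor, and the
  complementary factor is an eigenvector. It inherits each annihilator \<open>d\<close> that normalizes the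
  polynomials in \<open>u\<close>.
\<close>

lemma eigenvector_exists:
  assumes J: "point_ideal J" and P: "P \<noteq> 0" "peval P u \<in> J"
  shows "\<exists>c a. a \<notin> J \<and> u - sc c \<in> colon J a \<and>
    (\<forall>d\<in>J. (\<exists>c'. d * u = (u + sc c') * d) \<longrightarrow> d \<in> colon J a)"
proof -
  obtain P where P: "P \<noteq> 0" "peval P u \<in> J"
    and least: "\<And>Q. Q \<noteq> 0 \<Longrightarrow> peval Q u \<in> J \<Longrightarrow> degree P \<le> degree Q"
    using ex_has_least_nat[of "\<lambda>P. P \<noteq> 0 \<and> peval P u \<in> J" P degree] P by auto
  have "degree P \<noteq> 0"
  proof
    assume "degree P = 0"
    then obtain a where "P = [:a:]" by (rule degree_eq_zeroE)
    then show False using P point_ideal_sc[OF J] by simp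
  qed
  then obtain r where "poly P r = 0" using alg_closed_imp_poly_has_root by blast
  then obtain Q where Q: "P = [:- r, 1:] * Q" by (auto simp: poly_eq_0_iff_dvd)
  moreover from this have "Q \<noteq> 0" using P by auto
  ultimately have "degree P = Suc (degree Q)"
    using degree_mult_eq[of "[:- r, 1:]" Q] by (simp only: Q) simp
  with \<open>Q \<noteq> 0\<close> have "peval Q u \<notin> J" using least[of Q] by auto
  moreover have "u - sc r \<in> colon J (peval Q u)"
    using P(2) unfolding Q peval_mult by (simp add: colon_def sc_minus sc_one)
  moreover have "d \<in> colon J (peval Q u)" if "d \<in> J" "d * u = (u + sc c') * d" for d c'
    using peval_normalized[OF that(2), of Q] that(1) point_ideal_mult[OF J] by (auto simp: colon_def)
  ultimately show ?thesis by blast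
qed

lemma eigenvalue_power:
  assumes J: "point_ideal J" and u: "u - sc c \<in> J"
  shows "u ^ n - sc (c ^ n) \<in> J"
proof (induction n)
  case 0
  show ?case using subspace_0[OF point_ideal_subspace[OF J]] by (simp add: sc_one)
next
  case (Suc n)
  have "u ^ Suc n - sc (c ^ Suc n) = u * (u ^ n - sc (c ^ n)) + sc (c ^ n) * (u - sc c)"
    using sc_central[of "c ^ n" u] sc_central[of "c ^ n" "sc c"]
    by (simp add: right_diff_distrib sc_mult)
  then show ?case
    using Suc u point_ideal_mult[OF J] by (simp add: subspace_add[OF point_ideal_subspace[OF J]])
qed

lemma eigenvalue_central_power:
  assumes J: "point_ideal J" and u: "u - sc c \<in> J" and n: "central (u ^ n)"
  shows "c ^ n = chi (u ^ n)"
proof -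
  have "(u ^ n - sc (c ^ n)) - (u ^ n * 1 - sc (chi (u ^ n)) * 1) \<in> J"
    using eigenvalue_power[OF J u] point_ideal_central[OF J n]
    by (rule subspace_diff[OF point_ideal_subspace[OF J]])
  then have "sc (chi (u ^ n) - c ^ n) \<in> J" by (simp add: sc_diff)
  then show ?thesis by (simp add: point_ideal_sc[OF J])
qed

text \<open>
  The Frobenius map of a field is injective, so the central character determines the eigenvalues of
  elements with central \<open>p\<close>-th power.
\<close>

lemma p_root_unique: "(c :: 'k) ^ p = d ^ p \<Longrightarrow> c = d"
proof -
  assume "c ^ p = d ^ p"
  moreover have "(c + - d) ^ p = c ^ p + (- d) ^ p"
    by (rule freshmans_dream) (simp_all only: CHAR prime_p)
  ultimately have "(c + - d) ^ p = 0" unfolding minus_power_p by (simp only: right_minus)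
  then show "c = d" by (simp only: power_eq_0_iff) simp
qed

lemma p_root_exists: "\<exists>d :: 'k. d ^ p = c"
  using nth_root_exists[of p c] p_gt_2 by auto

lemma eigenvector_p_root:
  assumes J: "point_ideal J" and u: "central (u ^ p)" and c: "c ^ p = chi (u ^ p)"
  shows "\<exists>a. a \<notin> J \<and> u - sc c \<in> colon J a \<and>
    (\<forall>d\<in>J. (\<exists>c'. d * u = (u + sc c') * d) \<longrightarrow> d \<in> colon J a)"
proof -
  let ?P = "monom 1 p - [:chi (u ^ p):]"
  have "coeff ?P p = 1" using p_gt_2 by (simp add: coeff_pCons split: nat.split)
  then have "?P \<noteq> 0" by (metis coeff_0 zero_neq_one)
  moreover have "?P = monom 1 p + [:- chi (u ^ p):]" by simp
  then have "peval ?P u \<in> J"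
    using point_ideal_central[OF J u, of 1]
    by (simp only: peval_add peval_monom peval_pCons peval_0) (simp add: sc_one sc_minus)
  ultimately obtain d a where a: "a \<notin> J" "u - sc d \<in> colon J a"
    "\<forall>b\<in>J. (\<exists>c'. b * u = (u + sc c') * b) \<longrightarrow> b \<in> colon J a"
    using eigenvector_exists[OF J] by blast
  have "d ^ p = c ^ p"
    using eigenvalue_central_power[OF point_ideal_colon[OF J a(1)] a(2) u] c by simp
  then have "d = c" by (rule p_root_unique)
  with a show ?thesis by blast
qed

section \<open>Lowering\<close>

text \<open>
  The sums of \<open>g\<^sup>i t\<^sub>i\<close> for \<open>i < n\<close>, modulo \<open>J\<close>, in the nested form that lets operators pass one factor
  \<open>g\<close> at a time.
\<close>

fun below :: "'h set \<Rightarrow> 'h \<Rightarrow> 'h set \<Rightarrow> nat \<Rightarrow> 'h set" where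
  "below J g T 0 = J"
| "below J g T (Suc n) = {t + g * w | t w. t \<in> T \<and> w \<in> below J g T n}"

text \<open>
  The setting of the lowering argument: \<open>D\<close> kills the coefficients in \<open>T\<close>, its commutator \<open>E\<close> with \<open>g\<close>
  preserves them, and \<open>E\<close> moves past \<open>g\<close> at the price of a shift. The model is \<open>D = d/dg\<close>, \<open>E = 1\<close>.
\<close>

context
  fixes J T :: "'h set" and g D E :: 'h and c :: 'k
  assumes J: "point_ideal J" and T: "subspace T" and JT: "J \<subseteq> T"
    and DT: "\<And>t. t \<in> T \<Longrightarrow> D * t \<in> J" and ET: "\<And>t. t \<in> T \<Longrightarrow> E * t \<in> T"
    and Dg: "D * g = g * D + E" and Eg: "E * g = (g + sc c) * E"
begin

abbreviation "B \<equiv> below J g T"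

lemma below_SucI: "t \<in> T \<Longrightarrow> w \<in> B n \<Longrightarrow> t + g * w \<in> B (Suc n)"
  by auto

lemma below_subspace: "subspace (B n)"
proof (induction n)
  case (Suc n)
  show ?case unfolding subspace_def
  proof (intro conjI ballI allI)
    show "0 \<in> B (Suc n)"
      using below_SucI[OF subspace_0[OF T] subspace_0[OF Suc]] by simp
    fix u v assume "u \<in> B (Suc n)" "v \<in> B (Suc n)"
    then obtain t w t' w' where "t \<in> T" "w \<in> B n" "t' \<in> T" "w' \<in> B n" "u = t + g * w" "v = t' + g * w'"
      by auto
    moreover from this have "u + v = (t + t') + g * (w + w')" by (simp add: algebra_simps)
    ultimately show "u + v \<in> B (Suc n)"
      by (simp only:) (intro below_SucI subspace_add[OF T] subspace_add[OF Suc])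
  next
    fix d u assume "u \<in> B (Suc n)"
    then obtain t w where "t \<in> T" "w \<in> B n" "u = t + g * w" by auto
    moreover from this have "sc d * u = sc d * t + g * (sc d * w)"
      by (simp add: distrib_left sc_left_commute)
    ultimately show "sc d * u \<in> B (Suc n)"
      by (simp only:) (intro below_SucI subspace_sc[OF T] subspace_sc[OF Suc])
  qed
qed (simp add: point_ideal_subspace[OF J])

lemma below_step: "w \<in> B n \<Longrightarrow> g * w \<in> B (Suc n)"
  using below_SucI[OF subspace_0[OF T]] by simp

lemma below_T: "t \<in> T \<Longrightarrow> t \<in> B (Suc n)"
  using below_SucI[OF _ subspace_0[OF below_subspace], of t n] by simp

lemma below_Suc: "w \<in> B n \<Longrightarrow> w \<in> B (Suc n)"
proof (induction n arbitrary: w)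
  case 0
  then show ?case using JT below_T[of w 0] by (simp only: below.simps(1)) blast
next
  case (Suc n)
  then obtain t v where "t \<in> T" "v \<in> B n" "w = t + g * v" by auto
  then show ?case using below_SucI[of t v "Suc n"] Suc.IH by blast
qed

lemma below_mono: "m \<le> n \<Longrightarrow> w \<in> B m \<Longrightarrow> w \<in> B n"
  by (induction n rule: dec_induct) (auto simp del: below.simps(2) intro: below_Suc)

lemma below_power: "t \<in> T \<Longrightarrow> g ^ n * t \<in> B (Suc n)"
  by (induction n) (auto simp del: below.simps simp: below_T mult.assoc below_step)

lemma below_E: "w \<in> B n \<Longrightarrow> E * w \<in> B n"
proof (induction n arbitrary: w)
  case 0
  then show ?case using point_ideal_mult[OF J] by simp
next
  case (Suc n)
  then obtain t v where w: "t \<in> T" "v \<in> B n" "w = t + g * v" by auto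
  have "E * w = E * t + (g * (E * v) + sc c * (E * v))"
    by (simp add: w(3) distrib_left) (metis Eg distrib_right mult.assoc)
  moreover have "E * v \<in> B n" using Suc w by simp
  ultimately show ?case
    using w below_T[OF ET[OF w(1)], of n]
    by (simp del: below.simps add: below_step below_Suc subspace_add[OF below_subspace] subspace_sc[OF below_subspace])
qed

lemma below_D: "w \<in> B (Suc n) \<Longrightarrow> D * w \<in> B n"
proof (induction n arbitrary: w)
  case 0
  then obtain t v where w: "t \<in> T" "v \<in> J" "w = t + g * v" by auto
  then have "D * w = D * t + (D * g) * v" by (simp add: distrib_left mult.assoc)
  then show ?case
    using w DT point_ideal_mult[OF J] by (simp add: subspace_add[OF point_ideal_subspace[OF J]])
next
  case (Suc n)
  then obtain t v where w: "t \<in> T" "v \<in> B (Suc n)" "w = t + g * v"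
    unfolding below.simps(2)[of J g T "Suc n"] by blast
  have "D * w = D * t + (g * (D * v) + E * v)"
    by (simp add: w(3) distrib_left) (metis Dg distrib_right mult.assoc)
  moreover have "D * t \<in> B (Suc n)" using DT[OF w(1)] below_mono[of 0 "Suc n"] by simp
  ultimately show ?case
    using w Suc below_E[OF w(2)]
    by (simp del: below.simps(2) add: below_step subspace_add[OF below_subspace])
qed

lemma E_power_leading: "t \<in> T \<Longrightarrow> E * (g ^ n * t) - g ^ n * (E * t) \<in> B n"
proof (induction n)
  case 0
  show ?case using subspace_0[OF below_subspace, of 0] by simp
next
  case (Suc n)
  have "E * (g ^ Suc n * t) - g ^ Suc n * (E * t)
      = g * (E * (g ^ n * t) - g ^ n * (E * t)) + sc c * (E * (g ^ n * t))"
    by (simp add: mult.assoc right_diff_distrib) (metis Eg add_diff_eq diff_add_eq distrib_right mult.assoc)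
  then show ?case
    using Suc below_E[OF below_power[OF Suc.prems, of n]]
    by (simp del: below.simps add: below_step subspace_add[OF below_subspace] subspace_sc[OF below_subspace])
qed

lemma D_power_leading: "t \<in> T \<Longrightarrow> D * (g ^ Suc n * t) - of_nat (Suc n) * (g ^ n * (E * t)) \<in> B n"
proof (induction n)
  case 0
  have "D * (g * t) - E * t = g * (D * t)" by (metis Dg add_diff_cancel_right' distrib_right mult.assoc)
  then show ?case using DT[OF 0] point_ideal_mult[OF J] by simp
next
  case (Suc n)
  have "D * (g ^ Suc (Suc n) * t) = g * (D * (g ^ Suc n * t)) + E * (g ^ Suc n * t)"
    by (simp only: power_Suc[of g "Suc n"] mult.assoc) (metis Dg distrib_right mult.assoc)
  moreover have "g * (of_nat k * v) = of_nat k * (g * v)" for k v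
    by (metis mult.assoc mult_of_nat_commute)
  ultimately have "D * (g ^ Suc (Suc n) * t) - of_nat (Suc (Suc n)) * (g ^ Suc n * (E * t))
      = g * (D * (g ^ Suc n * t) - of_nat (Suc n) * (g ^ n * (E * t)))
        + (E * (g ^ Suc n * t) - g ^ Suc n * (E * t))"
    by (simp add: right_diff_distrib distrib_right distrib_left mult.assoc)
  then show ?case
    using below_step[OF Suc.IH[OF Suc.prems]] E_power_leading[OF Suc.prems, of "Suc n"]
    by (simp only: subspace_add[OF below_subspace])
qed

text \<open>
  \<open>D\<close> acts on polynomials in \<open>g\<close> like \<open>E\<close> times a derivation, up to terms of lower degree.
\<close>

lemma lowering: "t \<in> T \<Longrightarrow> w \<in> B n \<Longrightarrow> D ^ n * (g ^ n * t + w) - of_nat (fact n) * (E ^ n * t) \<in> J"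
proof (induction n arbitrary: t w)
  case 0
  then show ?case by simp
next
  case (Suc n)
  define t' where "t' = of_nat (Suc n) * (E * t)"
  have t': "t' \<in> T" unfolding t'_def using Suc.prems ET by (intro subspace_of_nat[OF T])
  define w' where "w' = D * (g ^ Suc n * t + w) - g ^ n * t'"
  have n: "g ^ n * (of_nat k * v) = of_nat k * (g ^ n * v)" "E ^ n * (of_nat k * v) = of_nat k * (E ^ n * v)" for k v
    by (metis mult.assoc mult_of_nat_commute)+
  have "w' = (D * (g ^ Suc n * t) - of_nat (Suc n) * (g ^ n * (E * t))) + D * w"
    unfolding w'_def t'_def n by (simp add: algebra_simps)
  then have "w' \<in> B n"
    using D_power_leading[OF Suc.prems(1)] below_D[OF Suc.prems(2)]
    by (simp only: subspace_add[OF below_subspace])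
  from Suc.IH[OF t' this]
  have "D ^ n * (D * (g ^ Suc n * t + w)) - of_nat (fact n) * (E ^ n * t') \<in> J"
    by (simp add: w'_def)
  moreover have "D ^ n * (D * (g ^ Suc n * t + w)) = D ^ Suc n * (g ^ Suc n * t + w)"
    by (simp only: power_Suc2 mult.assoc)
  moreover have "of_nat (fact n) * (E ^ n * t') = of_nat (fact (Suc n)) * (E ^ Suc n * t)"
  proof -
    have "of_nat (fact n) * (of_nat (Suc n) * v) = of_nat (fact (Suc n)) * v" for v :: 'h
      by (simp only: mult.assoc[symmetric] of_nat_mult[symmetric] fact_Suc of_nat_id mult.commute[of "fact n"])
    then show ?thesis by (simp only: t'_def n power_Suc2 mult.assoc)
  qed
  ultimately show ?case by simp
qed

text \<open>
  Of the coefficients \<open>t\<^sub>i\<close> outside \<open>J\<close> let \<open>t\<^sub>n\<close> be the last. Then \<open>D\<^sup>n\<close> isolates \<open>n! E\<^sup>n t\<^sub>n\<close>, and \<open>n!\<close> is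
  invertible because \<open>n < p\<close>.
\<close>

lemma leading_term:
  assumes t: "\<forall>i. t i \<in> T" and n: "n < p" "t n \<notin> J" and cancel: "\<And>t. t \<in> T \<Longrightarrow> E * t \<in> J \<Longrightarrow> t \<in> J"
  shows "\<exists>a s. s \<in> T \<and> s \<notin> J \<and> a * (\<Sum>i<p. g ^ i * t i) - s \<in> J"
proof -
  obtain n where n: "n < p" "t n \<notin> J" and max: "\<And>i. n < i \<Longrightarrow> i < p \<Longrightarrow> t i \<in> J"
    using ex_has_greatest_nat[of "\<lambda>n. n < p \<and> t n \<notin> J" n id p] n
    by (metis id_apply linorder_not_le order_less_imp_le)
  define w where "w = (\<Sum>i\<in>{..<p} - {n}. g ^ i * t i)"
  have w: "w \<in> B n"
    unfolding w_def
  proof (rule subspace_sum[OF below_subspace])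
    fix i assume i: "i \<in> {..<p} - {n}"
    show "g ^ i * t i \<in> B n"
    proof (cases "i < n")
      case True
      then show ?thesis using below_mono[OF _ below_power, of i n] t by auto
    next
      case False
      then have "g ^ i * t i \<in> B 0" using i max point_ideal_mult[OF J] by auto
      then show ?thesis by (rule below_mono[rotated]) simp
    qed
  qed
  have sum: "(\<Sum>i<p. g ^ i * t i) = g ^ n * t n + w"
    unfolding w_def using n by (intro sum.remove) auto
  have En: "E ^ k * t n \<in> T \<and> E ^ k * t n \<notin> J" for k
  proof (induction k)
    case 0
    show ?case using t n by simp
  next
    case (Suc k)
    then show ?case using ET cancel[of "E ^ k * t n"] unfolding power_Suc mult.assoc by blast
  qed
  moreover have "(of_nat (fact n) :: 'k) \<noteq> 0"
    unfolding of_nat_eq_0_iff_char_dvd CHAR prime_dvd_fact_iff[OF prime_p] using n by simp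
  ultimately have fact: "of_nat (fact n) * (E ^ n * t n) \<notin> J"
    using point_ideal_sc_cancel[OF J, of "of_nat (fact n)" "E ^ n * t n"] by (auto simp only: sc_of_nat)
  moreover have "of_nat (fact n) * (E ^ n * t n) \<in> T"
    using En by (intro subspace_of_nat[OF T]) simp
  moreover have "D ^ n * (\<Sum>i<p. g ^ i * t i) - of_nat (fact n) * (E ^ n * t n) \<in> J"
    unfolding sum using t w by (intro lowering) auto
  ultimately show ?thesis by blast
qed

lemma layer_independent:
  assumes cancel: "\<And>t. t \<in> T \<Longrightarrow> E * t \<in> J \<Longrightarrow> t \<in> J"
    and t: "\<forall>i. t i \<in> T" and s: "(\<Sum>i<p. g ^ i * t i) \<in> J" and i: "i < p"
  shows "t i \<in> J"
proof (rule ccontr)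
  assume "t i \<notin> J"
  then obtain a s where "s \<notin> J" "a * (\<Sum>i<p. g ^ i * t i) - s \<in> J"
    using leading_term[OF t i _ cancel] by blast
  then show False using s point_ideal_mult[OF J] point_ideal_diff_iff[OF J] by blast
qed

lemma layer_generates:
  assumes cancel: "\<And>t. t \<in> T \<Longrightarrow> E * t \<in> J \<Longrightarrow> t \<in> J"
    and T_gen: "\<And>t. t \<in> T \<Longrightarrow> t \<notin> J \<Longrightarrow> \<exists>a. a * t - 1 \<in> J"
    and s: "s \<in> layer g T" "s \<notin> J"
  shows "\<exists>a. a * s - 1 \<in> J"
proof -
  obtain t where t: "\<forall>i. t i \<in> T" and st: "s = (\<Sum>i<p. g ^ i * t i)"
    using s(1) by (auto simp: layer_def)
  have "\<exists>i<p. t i \<notin> J"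
  proof (rule ccontr)
    assume "\<not> (\<exists>i<p. t i \<notin> J)"
    then have "s \<in> J" unfolding st
      by (intro subspace_sum[OF point_ideal_subspace[OF J]] point_ideal_mult[OF J]) auto
    with s(2) show False by simp
  qed
  then obtain a r where r: "r \<in> T" "r \<notin> J" "a * s - r \<in> J"
    using leading_term[OF t _ _ cancel] unfolding st by blast
  then obtain b where b: "b * r - 1 \<in> J" using T_gen by blast
  have "b * (a * s - r) + (b * r - 1) \<in> J"
    by (intro subspace_add[OF point_ideal_subspace[OF J]] point_ideal_mult[OF J] r b)
  then have "(b * a) * s - 1 \<in> J" by (simp add: right_diff_distrib mult.assoc)
  then show ?thesis by blast
qed

end

end

section \<open>The left ideals of singular vectors\<close>

context sl2V_point
begin

text \<open>
  For a proper left ideal \<open>J\<close> over the character, this says that the module of which \<open>J\<close> is the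
  annihilator of a generator is irreducible, with basis the \<open>p\<^sup>2\<close> classes of \<open>g\<^sup>i g'\<^sup>j\<close>.
\<close>

definition frame :: "'h \<Rightarrow> 'h \<Rightarrow> 'h set \<Rightarrow> bool" where
  "frame g g' J \<longleftrightarrow> point_ideal J \<and>
     (\<forall>u. u \<notin> J \<longrightarrow> (\<exists>a. a * u - 1 \<in> J)) \<and>
     (\<forall>u. \<exists>c. u - (\<Sum>i<p. g ^ i * (\<Sum>j<p. g' ^ j * sc (c i j))) \<in> J) \<and>
     (\<forall>c. (\<Sum>i<p. g ^ i * (\<Sum>j<p. g' ^ j * sc (c i j))) \<in> J \<longrightarrow> (\<forall>i<p. \<forall>j<p. c i j = 0))"

definition scalars_mod :: "'h set \<Rightarrow> 'h set" where
  "scalars_mod J = {sc c + j | c j. j \<in> J}"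

context
  fixes J assumes J: "point_ideal J"
begin

lemma Jsub: "subspace J" by (rule point_ideal_subspace[OF J])

lemma scalars_modI: "j \<in> J \<Longrightarrow> sc c + j \<in> scalars_mod J"
  by (auto simp: scalars_mod_def)

lemma scalars_mod_iff: "t \<in> scalars_mod J \<longleftrightarrow> (\<exists>c. t - sc c \<in> J)"
proof
  assume "\<exists>c. t - sc c \<in> J"
  then obtain c where "t - sc c \<in> J" by blast
  from scalars_modI[OF this, of c] show "t \<in> scalars_mod J" by simp
next
  assume "t \<in> scalars_mod J"
  then obtain c j where "j \<in> J" "t = sc c + j" by (auto simp: scalars_mod_def)
  then have "t - sc c \<in> J" by simp
  then show "\<exists>c. t - sc c \<in> J" by blast
qed

lemma sc_scalars_mod: "sc c \<in> scalars_mod J"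
  using scalars_modI[OF subspace_0[OF Jsub]] by simp

lemma scalars_mod_subspace: "subspace (scalars_mod J)"
  unfolding subspace_def
proof (intro conjI ballI allI)
  show "0 \<in> scalars_mod J" using sc_scalars_mod[of 0] by (simp add: sc_0)
next
  fix u v assume "u \<in> scalars_mod J" "v \<in> scalars_mod J"
  then obtain c j d k where "u = sc c + j" "v = sc d + k" "j \<in> J" "k \<in> J" by (auto simp: scalars_mod_def)
  moreover from this have "u + v = sc (c + d) + (j + k)" by (simp add: sc_add)
  ultimately show "u + v \<in> scalars_mod J"
    unfolding scalars_mod_def using subspace_add[OF Jsub] by blast
next
  fix c u assume "u \<in> scalars_mod J"
  then obtain d j where "u = sc d + j" "j \<in> J" by (auto simp: scalars_mod_def)
  moreover from this have "sc c * u = sc (c * d) + sc c * j" by (simp add: sc_mult distrib_left)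
  ultimately show "sc c * u \<in> scalars_mod J"
    unfolding scalars_mod_def using subspace_sc[OF Jsub] by blast
qed

lemma scalars_mod_superset: "J \<subseteq> scalars_mod J"
  using scalars_modI[of _ 0] by (auto simp: sc_0)

lemma scalars_mod_one: "1 \<in> scalars_mod J"
  using sc_scalars_mod[of 1] by (simp add: sc_one)

lemma scalars_mod_eigen:
  assumes u: "u - sc d \<in> J" and t: "t \<in> scalars_mod J"
  shows "u * t - sc d * t \<in> J"
proof -
  obtain c j where t: "t = sc c + j" "j \<in> J" using t by (auto simp: scalars_mod_def)
  have "u * t - sc d * t = sc c * (u - sc d) + (u * j - sc d * j)"
    using sc_central[of c u] sc_central[of c "sc d"] by (simp add: t(1) distrib_left right_diff_distrib)
  then show ?thesis
    using u t(2) by (simp add: subspace_add[OF Jsub] subspace_diff[OF Jsub] point_ideal_mult[OF J])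
qed

lemma scalars_mod_stable:
  assumes u: "u - sc d \<in> J" and t: "t \<in> scalars_mod J"
  shows "u * t \<in> scalars_mod J"
proof -
  have "(u * t - sc d * t) + sc d * t \<in> scalars_mod J"
    using scalars_mod_eigen[OF u t] scalars_mod_superset
    by (intro subspace_add[OF scalars_mod_subspace] subspace_sc[OF scalars_mod_subspace] t) auto
  then show ?thesis by simp
qed

lemma scalars_mod_cancel:
  assumes u: "u - sc d \<in> J" "d \<noteq> 0" and t: "t \<in> scalars_mod J" "u * t \<in> J"
  shows "t \<in> J"
  using point_ideal_diff_iff[OF J scalars_mod_eigen[OF u(1) t(1)]] t(2) u(2)
    point_ideal_sc_cancel[OF J] by blast

lemma scalars_mod_generates:
  assumes t: "t \<in> scalars_mod J" "t \<notin> J"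
  shows "\<exists>a. a * t - 1 \<in> J"
proof -
  obtain c j where c: "t = sc c + j" "j \<in> J" using t by (auto simp: scalars_mod_def)
  then have "c \<noteq> 0" using t(2) by (auto simp: sc_0)
  then have "sc (inverse c) * t - 1 = sc (inverse c) * j"
    by (simp add: c(1) distrib_left sc_one flip: sc_mult)
  then have "sc (inverse c) * t - 1 \<in> J" using point_ideal_mult[OF J c(2)] by simp
  then show ?thesis by blast
qed

lemma central_stable:
  assumes "subspace T" "J \<subseteq> T" "central z" "t \<in> T"
  shows "z * t \<in> T"
proof -
  have "(z * t - sc (chi z) * t) + sc (chi z) * t \<in> T"
    using assms point_ideal_central[OF J assms(3), of t]
    by (intro subspace_add subspace_sc) auto
  then show ?thesis by simp
qed

text \<open>
  The power \<open>g\<^sup>p\<close>, or \<open>h\<^sup>p - h\<close> for \<open>g = h\<close>, is central and hence acts by a scalar modulo \<open>J\<close>. So exponents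
  below \<open>p\<close> suffice.
\<close>

lemma layer_p_power:
  assumes T: "subspace T" "J \<subseteq> T" and t: "t \<in> T" and g: "g \<in> {e, f, h, x, y}"
  shows "g ^ p * t \<in> layer g T"
proof (cases "g = h")
  case True
  have "(h ^ p - h) * t \<in> layer h T"
    using central_stable[OF T central_h_p t] layer_superset[OF T(1)] by auto
  moreover have "h * t \<in> layer h T" using layer_power[OF T(1) t, of 1 h] p_gt_2 by simp
  ultimately have "(h ^ p - h) * t + h * t \<in> layer h T" by (rule subspace_add[OF layer_subspace[OF T(1)]])
  then show ?thesis by (simp add: True left_diff_distrib)
next
  case False
  then have "central (g ^ p)" using g central_e_p central_f_p central_x_p central_y_p by auto
  then show ?thesis using central_stable[OF T _ t] layer_superset[OF T(1)] by auto
qed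

text \<open>
  Two lowering arguments: \<open>D\<close> and \<open>E\<close> remove the powers of \<open>g\<close> and leave a combination of powers of
  \<open>g'\<close>, and \<open>D'\<close> and \<open>E'\<close> reduce this to a nonzero scalar.
\<close>

lemma frameI:
  assumes g: "D * g = g * D + E" "E * g = (g + sc c) * E"
    and g': "D' * g' = g' * D' + E'" "E' * g' = (g' + sc c') * E'"
    and D': "D' \<in> J" and E': "E' - sc d \<in> J" "d \<noteq> 0"
    and D: "\<And>t. t \<in> layer g' (scalars_mod J) \<Longrightarrow> D * t \<in> J"
    and E: "\<And>t. t \<in> layer g' (scalars_mod J) \<Longrightarrow> E * t \<in> layer g' (scalars_mod J)"
    and E_cancel: "\<And>t. E * t \<in> J \<Longrightarrow> t \<in> J"
    and stable: "\<And>u s. u \<in> {e, f, h, x, y} \<Longrightarrow> s \<in> layer g (layer g' (scalars_mod J))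
        \<Longrightarrow> u * s \<in> layer g (layer g' (scalars_mod J))"
  shows "frame g g' J"
  unfolding frame_def
proof (intro conjI allI impI)
  define T where "T = layer g' (scalars_mod J)"
  have T: "subspace T" unfolding T_def by (intro layer_subspace scalars_mod_subspace)
  have "scalars_mod J \<subseteq> T" unfolding T_def by (rule layer_superset[OF scalars_mod_subspace])
  then have JT: "J \<subseteq> T" using scalars_mod_superset by blast
  have D't: "D' * t \<in> J" if "t \<in> scalars_mod J" for t
    using scalars_mod_eigen[of D' 0 t] D' that by (simp add: sc_0)
  have UNIV: "layer g T = UNIV"
  proof (rule gen_induct)
    show "1 \<in> layer g T"
      using layer_superset[OF T] layer_superset[OF scalars_mod_subspace] scalars_mod_one T_def by blast
  qed (use stable layer_subspace[OF T] in \<open>auto simp: T_def subspace_add subspace_sc\<close>)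
  note inner = J scalars_mod_subspace scalars_mod_superset D't scalars_mod_stable[OF E'(1)] g'
  note outer = J T JT D[folded T_def] E[folded T_def] g
  show "point_ideal J" by (rule J)
  have T_gen: "\<exists>a. a * t - 1 \<in> J" if "t \<in> T" "t \<notin> J" for t
    by (rule layer_generates[OF inner scalars_mod_cancel[OF E'] scalars_mod_generates])
      (assumption | rule that[unfolded T_def])+
  show "\<exists>a. a * u - 1 \<in> J" if u: "u \<notin> J" for u
    by (rule layer_generates[OF outer E_cancel T_gen _ u]) (assumption | simp only: UNIV UNIV_I)+
  show "\<exists>c. u - (\<Sum>i<p. g ^ i * (\<Sum>j<p. g' ^ j * sc (c i j))) \<in> J" for u
  proof -
    obtain t where t: "\<forall>i. t i \<in> T" "u = (\<Sum>i<p. g ^ i * t i)"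
      using UNIV unfolding layer_def by blast
    have "\<exists>c. t i - (\<Sum>j<p. g' ^ j * sc (c j)) \<in> J" for i
    proof -
      obtain s where s: "\<forall>j. s j \<in> scalars_mod J" "t i = (\<Sum>j<p. g' ^ j * s j)"
        using t(1) unfolding T_def layer_def by blast
      have "\<forall>j. \<exists>c. s j - sc c \<in> J" using s(1) by (simp add: scalars_mod_iff)
      then obtain c where "\<forall>j. s j - sc (c j) \<in> J" by metis
      then have "(\<Sum>j<p. g' ^ j * (s j - sc (c j))) \<in> J"
        by (intro subspace_sum[OF Jsub] point_ideal_mult[OF J]) auto
      then show ?thesis by (auto simp: s(2) right_diff_distrib sum_subtractf)
    qed
    then obtain c where "\<forall>i. t i - (\<Sum>j<p. g' ^ j * sc (c i j)) \<in> J" by metis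
    then have "(\<Sum>i<p. g ^ i * (t i - (\<Sum>j<p. g' ^ j * sc (c i j)))) \<in> J"
      by (intro subspace_sum[OF Jsub] point_ideal_mult[OF J]) auto
    then have "u - (\<Sum>i<p. g ^ i * (\<Sum>j<p. g' ^ j * sc (c i j))) \<in> J"
      by (simp only: t(2) right_diff_distrib sum_subtractf)
    then show ?thesis by blast
  qed
  show "c i j = 0" if c: "(\<Sum>i<p. g ^ i * (\<Sum>j<p. g' ^ j * sc (c i j))) \<in> J"
    and ij: "i < p" "j < p" for c i j
  proof -
    have s: "(\<Sum>j<p. g' ^ j * sc (c i j)) \<in> J"
      by (rule layer_independent[OF outer E_cancel _ c ij(1)])
        (auto simp: T_def layer_def sc_scalars_mod)
    have "sc (c i j) \<in> J"
    proof (rule layer_independent[OF inner _ _ s ij(2)])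
      show "t \<in> J" if "t \<in> scalars_mod J" "E' * t \<in> J" for t
        by (rule scalars_mod_cancel[OF E' that])
    qed (assumption | simp add: sc_scalars_mod)+
    then show ?thesis by (simp add: point_ideal_sc[OF J])
  qed
qed

end

text \<open>
  A frame is a maximal left ideal.
\<close>

lemma frame_unique:
  assumes J: "frame g g' J" and J': "frame g g' J'" and sub: "J' \<subseteq> J"
  shows "J = J'"
proof (rule ccontr)
  assume "J \<noteq> J'"
  then obtain u a where "u \<in> J" "a * u - 1 \<in> J'" using sub J' unfolding frame_def by blast
  then show False
    using J sub point_ideal_mult[of J u a] point_ideal_diff_iff[of J "a * u" 1] point_ideal_one[of J]
    unfolding frame_def by blast
qed

end

context sl2V_point
begin

text \<open>The difference operator of a grouplike \<open>u\<close>, which shifts \<open>g\<close>, lowers the degree in \<open>g\<close>.\<close>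

lemma shift_ops:
  assumes "u * g = g * u + sc m * u"
  shows "(sc a * u - 1) * g = g * (sc a * u - 1) + sc (a * m) * u"
    and "(sc (a * m) * u) * g = (g + sc m) * (sc (a * m) * u)"
proof -
  have "sc a * (u * g) = g * (sc a * u) + sc (a * m) * u"
    by (simp only: assms distrib_left sc_left_commute[of g] sc_mult mult.assoc)
  then show "(sc a * u - 1) * g = g * (sc a * u - 1) + sc (a * m) * u"
    by (simp add: left_diff_distrib right_diff_distrib mult.assoc)
  have "sc (a * m) * (u * g) = (g + sc m) * (sc (a * m) * u)"
    by (simp only: assms distrib_left distrib_right sc_left_commute[of g] sc_left_commute[of "sc m"])
  then show "(sc (a * m) * u) * g = (g + sc m) * (sc (a * m) * u)" by (simp add: mult.assoc)
qed

lemma sc_inverse_mult: "c \<noteq> 0 \<Longrightarrow> sc (inverse c) * (sc c * u) = u"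
  by (metis left_inverse mult.assoc mult_1 sc_mult sc_one)

definition commutators_in :: "'h \<Rightarrow> 'h set \<Rightarrow> bool" where
  "commutators_in g U \<longleftrightarrow> (\<forall>u\<in>U. \<forall>T s. subspace T \<longrightarrow> (\<forall>v\<in>insert g U. v * s \<in> T) \<longrightarrow> (u * g - g * u) * s \<in> T)"

lemmas subspace_closure = subspace_0 subspace_add subspace_diff subspace_minus

lemma commutators_in_gens:
  "commutators_in y {e, x}" "commutators_in h {y, e, x}" "commutators_in x {f, y}" "commutators_in h {x, f, y}"
  "commutators_in h {f, x, y}" "commutators_in e {h, f, x, y}" "commutators_in y {e, x, h}"
  "commutators_in f {y, e, x, h}"
  by (simp_all add: commutators_in_def brackets)
    (simp_all add: left_diff_distrib distrib_right subspace_closure)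

context
  fixes J assumes J: "point_ideal J"
begin

lemma shift_ops_mod:
  assumes u: "u - sc c \<in> J" and c: "c \<noteq> 0"
  shows "sc (inverse c) * u - 1 \<in> J" and "sc (inverse c * m) * u - sc m \<in> J"
proof -
  have "sc (inverse c * m) * (u - sc c) = sc (inverse c * m) * u - sc m" for m
    using c by (simp add: right_diff_distrib field_simps flip: sc_mult)
  then show *: "sc (inverse c * m) * u - sc m \<in> J" for m using point_ideal_mult[OF J u] by metis
  show "sc (inverse c) * u - 1 \<in> J" using *[of 1] by (simp add: sc_one)
qed

lemma annihilated_subspace: "subspace {t. u * t \<in> J}"
  using Jsub[OF J]
  by (auto simp: subspace_def distrib_left sc_left_commute)

lemma annihilates_scalars: "u \<in> J \<Longrightarrow> scalars_mod J \<subseteq> {t. u * t \<in> J}"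
  using scalars_mod_eigen[OF J, of u 0] by (auto simp: sc_0)

lemma central_power_cancel:
  assumes u: "central (u ^ p)" "chi (u ^ p) \<noteq> 0" and t: "u * t \<in> J"
  shows "t \<in> J"
proof -
  have "u ^ p * t = u ^ (p - 1) * (u * t)"
    using p_gt_2 by (metis gr_implies_not0 mult.assoc power_minus_mult not_gr_zero)
  then have "u ^ p * t \<in> J" using point_ideal_mult[OF J t] by simp
  then show ?thesis
    using point_ideal_diff_iff[OF J point_ideal_central[OF J u(1), of t]] point_ideal_sc_cancel[OF J _ u(2)] by blast
qed

text \<open>
  Where \<open>u\<^sup>p\<close> acts as a nonzero scalar, each \<open>t\<close> is a multiple of \<open>u\<^sup>p t = u\<^sup>2 (u\<^bsup>p-2\<^esup> t)\<close>. This inverts the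
  \<open>x\<^sup>2\<close> and \<open>y\<^sup>2\<close> of the Casimir relation.
\<close>

lemma central_power_divides:
  assumes T: "subspace T" "J \<subseteq> T" and u: "central (u ^ p)" "chi (u ^ p) \<noteq> 0"
    and st: "\<And>t. t \<in> T \<Longrightarrow> u * t \<in> T" and w: "\<And>t. t \<in> T \<Longrightarrow> w * (u * (u * t)) \<in> T" and t: "t \<in> T"
  shows "w * t \<in> T"
proof -
  have pow: "u ^ n * t \<in> T" for n using st t by (induction n) (simp_all add: mult.assoc)
  have "u ^ p * t = u * (u * (u ^ (p - 2) * t))"
  proof -
    have "p = Suc (Suc (p - 2))" using p_gt_2 by simp
    then have "u ^ p = u ^ Suc (Suc (p - 2))" by simp
    then show ?thesis by (simp add: mult.assoc)
  qed
  then have "w * (u ^ p * t) \<in> T" using w[OF pow] by simp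
  moreover have "w * (u ^ p * t - sc (chi (u ^ p)) * t) \<in> J"
    using point_ideal_mult[OF J point_ideal_central[OF J u(1)]] .
  ultimately have "w * (u ^ p * t) - w * (u ^ p * t - sc (chi (u ^ p)) * t) \<in> T"
    using subspace_diff[OF T(1)] T(2) by blast
  then have "sc (inverse (chi (u ^ p))) * (sc (chi (u ^ p)) * (w * t)) \<in> T"
    by (rule_tac subspace_sc[OF T(1)]) (simp add: right_diff_distrib sc_left_commute)
  then show ?thesis by (simp only: sc_inverse_mult[OF u(2)])
qed

text \<open>
  By the Casimir relation \<open>f x\<^sup>2 = e y\<^sup>2 + h x y - casimir\<close>, the other generators determine \<open>f\<close> on the
  multiples of \<open>x\<^sup>2\<close>.
\<close>

lemma f_stable:
  assumes T: "subspace T" "J \<subseteq> T" and a: "chi (x ^ p) \<noteq> 0"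
    and st: "\<And>u t. u \<in> {e, h, x, y} \<Longrightarrow> t \<in> T \<Longrightarrow> u * t \<in> T" and t: "t \<in> T"
  shows "f * t \<in> T"
proof (rule central_power_divides[OF T central_x_p a _ _ t])
  fix t assume t: "t \<in> T"
  have "f * (x * (x * t)) = e * (y * (y * t)) + h * (x * (y * t)) - casimir * t"
    by (simp add: casimir_def algebra_simps)
  also have "\<dots> \<in> T"
    using st t central_stable[OF J T casimir_central]
    by (intro subspace_diff[OF T(1)] subspace_add[OF T(1)]) auto
  finally show "f * (x * (x * t)) \<in> T" .
qed (use st in auto)

lemma e_stable:
  assumes T: "subspace T" "J \<subseteq> T" and a: "chi (y ^ p) \<noteq> 0"
    and st: "\<And>u t. u \<in> {f, h, x, y} \<Longrightarrow> t \<in> T \<Longrightarrow> u * t \<in> T" and t: "t \<in> T"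
  shows "e * t \<in> T"
proof (rule central_power_divides[OF T central_y_p a _ _ t])
  fix t assume t: "t \<in> T"
  have "e * (y * (y * t)) = casimir * t + f * (x * (x * t)) - h * (x * (y * t))"
    by (simp add: casimir_def algebra_simps)
  also have "\<dots> \<in> T"
    using st t central_stable[OF J T casimir_central]
    by (intro subspace_diff[OF T(1)] subspace_add[OF T(1)]) auto
  finally show "e * (y * (y * t)) \<in> T" .
qed (use st in auto)

text \<open>
  Generators that act by scalars on the starting vector stabilize both layers, provided that their
  commutators with \<open>g'\<close> and then with \<open>g\<close> close up.
\<close>

lemma layers_stable:
  assumes U: "\<forall>u\<in>U. \<exists>c. u - sc c \<in> J"
    and g: "g \<in> {e, f, h, x, y}" "g' \<in> {e, f, h, x, y}"
    and comm: "commutators_in g' U" "commutators_in g (insert g' U)"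
  shows "\<And>u s. u \<in> insert g' U \<Longrightarrow> s \<in> layer g' (scalars_mod J) \<Longrightarrow> u * s \<in> layer g' (scalars_mod J)"
    and "\<And>u s. u \<in> insert g (insert g' U) \<Longrightarrow> s \<in> layer g (layer g' (scalars_mod J))
        \<Longrightarrow> u * s \<in> layer g (layer g' (scalars_mod J))"
    and "subspace (layer g (layer g' (scalars_mod J)))"
    and "J \<subseteq> layer g (layer g' (scalars_mod J))"
proof -
  let ?T1 = "layer g' (scalars_mod J)"
  have T0: "subspace (scalars_mod J)" "J \<subseteq> scalars_mod J"
    by (rule scalars_mod_subspace[OF J] scalars_mod_superset[OF J])+
  have T1: "subspace ?T1" "J \<subseteq> ?T1"
    using layer_subspace[OF T0(1)] layer_superset[OF T0(1), of g'] T0(2) by auto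
  show T2: "subspace (layer g ?T1)" "J \<subseteq> layer g ?T1"
    using layer_subspace[OF T1(1)] layer_superset[OF T1(1), of g] T1(2) by auto
  show st: "u * s \<in> ?T1" if "u \<in> insert g' U" "s \<in> ?T1" for u s
  proof (rule layer_closed[OF T0(1) _ _ _ that])
    show "u * t \<in> scalars_mod J" if "u \<in> U" "t \<in> scalars_mod J" for u t
      using U that(1) scalars_mod_stable[OF J _ that(2)] by blast
    show "(u * g' - g' * u) * s \<in> ?T1" if "u \<in> U" "\<And>v. v \<in> insert g' U \<Longrightarrow> v * s \<in> ?T1" for u s
      using comm(1) that T1(1) unfolding commutators_in_def by blast
  qed (rule layer_p_power[OF J T0 _ g(2)])
  show "u * s \<in> layer g ?T1" if "u \<in> insert g (insert g' U)" "s \<in> layer g ?T1" for u s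
  proof (rule layer_closed[OF T1(1) _ _ _ that])
    show "(u * g - g * u) * s \<in> layer g ?T1"
      if "u \<in> insert g' U" "\<And>v. v \<in> insert g (insert g' U) \<Longrightarrow> v * s \<in> layer g ?T1" for u s
      using comm(2) that T2(1) unfolding commutators_in_def by blast
  qed (use st layer_p_power[OF J T1 _ g(1)] in auto)
qed

lemma gens: "e \<in> {e, f, h, x, y}" "f \<in> {e, f, h, x, y}" "h \<in> {e, f, h, x, y}" "x \<in> {e, f, h, x, y}" "y \<in> {e, f, h, x, y}"
  by simp_all

lemma zero_eigen: "u \<in> J \<Longrightarrow> \<exists>c. u - sc c \<in> J"
  by (rule exI[of _ 0]) (simp add: sc_0)

lemma eigenvalue_nonzero: "u - sc c \<in> J \<Longrightarrow> central (u ^ p) \<Longrightarrow> chi (u ^ p) \<noteq> 0 \<Longrightarrow> c \<noteq> 0"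
  using eigenvalue_central_power[OF J, of u c p] p_gt_2 by (auto simp: zero_power)

text \<open>
  Both frames with \<open>h\<close> as outer element start from an invertible \<open>u\<close> that shifts \<open>h\<close> and commutes with
  the inner element: its difference operator removes the powers of \<open>h\<close>, and then \<open>D'\<close> acts as \<open>u\<close>
  times the derivative in \<open>g'\<close>.
\<close>

lemma frame_shift:
  assumes u: "u - sc a \<in> J" "central (u ^ p)" "chi (u ^ p) \<noteq> 0"
    and uh: "u * h = h * u + sc m * u" "m \<noteq> 0" and ug': "u * g' = g' * u"
    and D': "D' * g' = g' * D' + u" "D' \<in> J"
    and u_stable: "\<And>t. t \<in> layer g' (scalars_mod J) \<Longrightarrow> u * t \<in> layer g' (scalars_mod J)"
    and stable: "\<And>v s. v \<in> {e, f, h, x, y} \<Longrightarrow> s \<in> layer h (layer g' (scalars_mod J))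
        \<Longrightarrow> v * s \<in> layer h (layer g' (scalars_mod J))"
  shows "frame h g' J"
proof -
  have a0: "a \<noteq> 0" by (rule eigenvalue_nonzero[OF u])
  show ?thesis
  proof (rule frameI[OF J shift_ops[OF uh(1), of "inverse a"], where D' = D' and E' = u and c' = 0 and d = a])
    have "layer g' (scalars_mod J) \<subseteq> {t. (sc (inverse a) * u - 1) * t \<in> J}"
    proof (rule layer_subset[OF annihilated_subspace _ annihilates_scalars])
      have "(sc (inverse a) * u - 1) * (g' * t) = g' * ((sc (inverse a) * u - 1) * t)" for t
        by (simp add: left_diff_distrib right_diff_distrib mult.assoc sc_left_commute[of g'])
          (simp add: ug' flip: mult.assoc)
      then show "g' * t \<in> {t. (sc (inverse a) * u - 1) * t \<in> J}"
        if "t \<in> {t. (sc (inverse a) * u - 1) * t \<in> J}" for t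
        using that point_ideal_mult[OF J] by simp
    qed (rule shift_ops_mod[OF u(1) a0])
    then show "(sc (inverse a) * u - 1) * t \<in> J" if "t \<in> layer g' (scalars_mod J)" for t
      using that by blast
    show "sc (inverse a * m) * u * t \<in> layer g' (scalars_mod J)" if "t \<in> layer g' (scalars_mod J)" for t
      unfolding mult.assoc
      by (intro subspace_sc[OF layer_subspace[OF scalars_mod_subspace[OF J]]] u_stable that)
    show "t \<in> J" if "sc (inverse a * m) * u * t \<in> J" for t
      by (rule central_power_cancel[OF u(2,3)], rule point_ideal_sc_cancel[OF J, of "inverse a * m"])
        (use that a0 uh(2) in \<open>simp_all add: mult.assoc\<close>)
  qed (use D' u(1) a0 ug' stable in \<open>simp_all add: sc_0\<close>)
qed

lemma frame_x_invertible:
  assumes e: "e \<in> J" and x: "x - sc a \<in> J" and a: "chi (x ^ p) \<noteq> 0"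
  shows "frame h y J"
proof -
  have U: "\<forall>u\<in>{e, x}. \<exists>c. u - sc c \<in> J" using x zero_eigen[OF e] by auto
  note st = layers_stable[OF U gens(3) gens(5) commutators_in_gens(1) commutators_in_gens(2)]
  show ?thesis
  proof (rule frame_shift[OF x central_x_p a, where m = "- 1" and D' = e])
    show "x * t \<in> layer y (scalars_mod J)" if "t \<in> layer y (scalars_mod J)" for t
      by (rule st(1)[OF _ that]) blast
    fix v s assume v: "v \<in> {e, f, h, x, y}" and s: "s \<in> layer h (layer y (scalars_mod J))"
    have "f * s \<in> layer h (layer y (scalars_mod J))"
    proof (rule f_stable[OF st(3,4) a _ s])
      show "w * t \<in> layer h (layer y (scalars_mod J))"
        if "w \<in> {e, h, x, y}" "t \<in> layer h (layer y (scalars_mod J))" for w t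
        by (rule st(2)[OF _ that(2)]) (use that(1) in blast)
    qed
    then show "v * s \<in> layer h (layer y (scalars_mod J))"
      using v st(2)[OF _ s, of v] by blast
  qed (simp_all add: hx xy ey e sc_minus sc_one)
qed

lemma frame_y_invertible:
  assumes f: "f - sc b \<in> J" and y: "y - sc a \<in> J" and a: "chi (y ^ p) \<noteq> 0"
  shows "frame h x J"
proof -
  have U: "\<forall>u\<in>{f, y}. \<exists>c. u - sc c \<in> J" using f y by auto
  note st = layers_stable[OF U gens(3) gens(4) commutators_in_gens(3) commutators_in_gens(4)]
  show ?thesis
  proof (rule frame_shift[OF y central_y_p a, where m = 1 and D' = "f - sc b"])
    show "(f - sc b) * x = x * (f - sc b) + y"
      using sc_central[of b x] by (simp add: fx algebra_simps)
    show "y * t \<in> layer x (scalars_mod J)" if "t \<in> layer x (scalars_mod J)" for t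
      by (rule st(1)[OF _ that]) blast
    fix v s assume v: "v \<in> {e, f, h, x, y}" and s: "s \<in> layer h (layer x (scalars_mod J))"
    have "e * s \<in> layer h (layer x (scalars_mod J))"
    proof (rule e_stable[OF st(3,4) a _ s])
      show "w * t \<in> layer h (layer x (scalars_mod J))"
        if "w \<in> {f, h, x, y}" "t \<in> layer h (layer x (scalars_mod J))" for w t
        by (rule st(2)[OF _ that(2)]) (use that(1) in blast)
    qed
    then show "v * s \<in> layer h (layer x (scalars_mod J))"
      using v st(2)[OF _ s, of v] by blast
  qed (simp_all add: hy xy f sc_one)
qed

text \<open>
  If \<open>y\<close> annihilates the generator and \<open>f\<close> acts on it by a nonzero scalar, the Casimir relation
  makes \<open>x\<^sup>2\<close> act by a scalar, hence also \<open>x\<close>, as \<open>x\<^sup>p\<close> does and \<open>p\<close> is odd.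
\<close>

lemma x_scalar:
  assumes f: "f - sc b \<in> J" and y: "y \<in> J" and b: "b \<noteq> 0" and a: "chi (x ^ p) \<noteq> 0"
  shows "\<exists>c. x - sc c \<in> J"
proof -
  define d where "d = - chi casimir / b"
  have "f * x * x = x * x * f + 2 * x * y"
    using fx xy by (simp add: distrib_right distrib_left mult_2) (metis fx distrib_left mult.assoc)
  then have "casimir * 1 - sc (chi casimir) * 1
      = (e * y + h * x - 2 * x) * y - x * x * (f - sc b) - sc b * (x * x) - sc (chi casimir)"
    using sc_central[of b "x * x"] by (simp add: casimir_def algebra_simps)
  then have "sc b * (x * x) + sc (chi casimir)
      = (e * y + h * x - 2 * x) * y - x * x * (f - sc b) - (casimir * 1 - sc (chi casimir) * 1)"
    by simp
  also have "\<dots> \<in> J"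
    by (rule subspace_diff[OF Jsub[OF J] subspace_diff[OF Jsub[OF J]]])
      (rule point_ideal_mult[OF J] f y point_ideal_central[OF J casimir_central])+
  finally have "sc (inverse b) * (sc b * (x * x) + sc (chi casimir)) \<in> J"
    by (rule point_ideal_mult[OF J])
  moreover have "sc (inverse b) * (sc b * (x * x) + sc (chi casimir)) = x * x - sc d"
  proof -
    have "sc (inverse b) * (sc b * (x * x)) = x * x" using b by (simp flip: mult.assoc sc_mult) (simp add: sc_one)
    moreover have "sc (inverse b) * sc (chi casimir) = - sc d"
      unfolding d_def by (simp add: field_simps flip: sc_mult sc_minus)
    ultimately show ?thesis by (simp add: distrib_left)
  qed
  ultimately have xx: "x * x - sc d \<in> J" by simp
  obtain m where m: "p = 2 * m + 1" using prime_odd_nat[OF prime_p p_gt_2] by (elim oddE)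
  have "(x * x) ^ m - sc (d ^ m) \<in> J" by (rule eigenvalue_power[OF J xx])
  then have "x * ((x * x) ^ m - sc (d ^ m)) \<in> J" by (rule point_ideal_mult[OF J])
  moreover have "x * (x * x) ^ m = x ^ p"
    unfolding m by (simp add: power_mult power2_eq_square)
  ultimately have "x ^ p - sc (d ^ m) * x \<in> J" by (simp add: right_diff_distrib sc_central)
  from subspace_diff[OF Jsub[OF J] point_ideal_central[OF J central_x_p, of 1] this]
  have xd: "sc (d ^ m) * x - sc (chi (x ^ p)) \<in> J" by simp
  have "d ^ m \<noteq> 0"
  proof
    assume "d ^ m = 0"
    then have "sc (- chi (x ^ p)) \<in> J" using xd by (simp only: sc_0 sc_minus) simp
    then show False using point_ideal_sc[OF J] a by simp
  qed
  then have "sc (inverse (d ^ m)) * (sc (d ^ m) * x - sc (chi (x ^ p))) = x - sc (inverse (d ^ m) * chi (x ^ p))"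
    by (simp only: right_diff_distrib mult.assoc[symmetric] sc_mult[symmetric]) (simp add: sc_one)
  then have "x - sc (inverse (d ^ m) * chi (x ^ p)) \<in> J"
    using point_ideal_mult[OF J xd] by metis
  then show ?thesis by blast
qed

text \<open>
  With \<open>x\<close> acting by a scalar, \<open>y\<close> lowers the powers of \<open>e\<close> and the difference operator of \<open>x\<close> those of
  \<open>h\<close>. As \<open>y\<close> shifts \<open>h\<close>, it still kills the span of the powers of \<open>h\<close>.
\<close>

lemma frame_f_invertible:
  assumes f: "f - sc b \<in> J" and y: "y \<in> J" and b: "b \<noteq> 0" and a: "chi (x ^ p) \<noteq> 0"
  shows "frame e h J"
proof -
  obtain c where x: "x - sc c \<in> J" using x_scalar[OF assms] by blast
  have c0: "c \<noteq> 0" by (rule eigenvalue_nonzero[OF x central_x_p a])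
  have U: "\<forall>u\<in>{f, x, y}. \<exists>c. u - sc c \<in> J" using f x zero_eigen[OF y] by auto
  note st = layers_stable[OF U gens(1) gens(3) commutators_in_gens(5) commutators_in_gens(6)]
  have xh: "x * h = h * x + sc (- 1) * x" by (simp add: hx sc_minus sc_one)
  show ?thesis
  proof (rule frameI[OF J _ _ shift_ops[OF xh, of "inverse c"], where D = y and E = "- x" and c = 0 and d = "- 1"])
    have "layer h (scalars_mod J) \<subseteq> {t. y * t \<in> J}"
    proof (rule layer_subset[OF annihilated_subspace _ annihilates_scalars[OF y]])
      have "y * (h * t) = (h + 1) * (y * t)" for t
        by (simp add: hy distrib_right left_diff_distrib flip: mult.assoc)
      then show "h * t \<in> {t. y * t \<in> J}" if "t \<in> {t. y * t \<in> J}" for t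
        using that point_ideal_mult[OF J] by simp
    qed
    then show "y * t \<in> J" if "t \<in> layer h (scalars_mod J)" for t
      using that by blast
    show "- x * t \<in> layer h (scalars_mod J)" if "t \<in> layer h (scalars_mod J)" for t
      unfolding mult_minus_left
      by (intro subspace_minus[OF layer_subspace[OF scalars_mod_subspace[OF J]]] st(1)[OF _ that]) blast
    show "t \<in> J" if "- x * t \<in> J" for t
      using that central_power_cancel[OF central_x_p a, of t] subspace_minus[OF Jsub[OF J], of "- x * t"] by simp
    show "sc (inverse c) * x - 1 \<in> J" "sc (inverse c * - 1) * x - sc (- 1) \<in> J"
      by (rule shift_ops_mod[OF x c0])+
    show "u * s \<in> layer e (layer h (scalars_mod J))"
      if "u \<in> {e, f, h, x, y}" "s \<in> layer e (layer h (scalars_mod J))" for u s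
      by (rule st(2)[OF _ that(2)]) (use that(1) in blast)
  qed (simp_all add: ey ex sc_0)
qed

text \<open>
  Here \<open>x\<close> lowers the powers of \<open>f\<close>, and \<open>y\<close> acts on the remaining span of the powers of \<open>y\<close> as an
  invertible operator. On this span \<open>h - c\<close> is \<open>- y d/dy\<close>, so \<open>y\<^bsup>p-1\<^esup> (h - c)\<close> is a multiple of the
  derivative.
\<close>

lemma frame_highest_weight:
  assumes e: "e \<in> J" and x: "x \<in> J" and h: "h - sc c \<in> J" and b: "chi (y ^ p) \<noteq> 0"
  shows "frame f y J"
proof -
  have U: "\<forall>u\<in>{e, x, h}. \<exists>c. u - sc c \<in> J" using h zero_eigen[OF e] zero_eigen[OF x] by auto
  note st = layers_stable[OF U gens(2) gens(5) commutators_in_gens(7) commutators_in_gens(8)]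
  have p: "y ^ (p - 1) * y = y ^ p"
    using p_gt_2 by (metis not_gr_zero not_less_zero power_minus_mult)
  show ?thesis
  proof (rule frameI[OF J, where D = x and E = "- y" and c = 0 and D' = "y ^ (p - 1) * (h - sc c)"
        and E' = "- (y ^ p)" and c' = 0 and d = "- chi (y ^ p)"])
    have "(h - sc c) * y = y * (h - sc c) - y"
      using sc_central[of c y] by (simp add: hy algebra_simps)
    then have "y ^ (p - 1) * (h - sc c) * y = y ^ (p - 1) * (y * (h - sc c) - y)"
      by (simp only: mult.assoc)
    also have "\<dots> = y ^ (p - 1) * y * (h - sc c) - y ^ (p - 1) * y"
      by (simp only: right_diff_distrib[of _ "y * (h - sc c)" y] mult.assoc)
    finally show "y ^ (p - 1) * (h - sc c) * y = y * (y ^ (p - 1) * (h - sc c)) + - (y ^ p)"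
      by (simp only: p[symmetric] power_commutes mult.assoc) simp
    show "- (y ^ p) * y = (y + sc 0) * - (y ^ p)" by (simp add: sc_0 power_commutes)
    have "- (y ^ p * 1 - sc (chi (y ^ p)) * 1) \<in> J"
      by (intro subspace_minus[OF Jsub[OF J]] point_ideal_central[OF J central_y_p])
    then show "- (y ^ p) - sc (- chi (y ^ p)) \<in> J" by (simp add: sc_minus)
    have "layer y (scalars_mod J) \<subseteq> {t. x * t \<in> J}"
    proof (rule layer_subset[OF annihilated_subspace _ annihilates_scalars[OF x]])
      have "x * (y * t) = y * (x * t)" for t by (simp add: xy flip: mult.assoc)
      then show "y * t \<in> {t. x * t \<in> J}" if "t \<in> {t. x * t \<in> J}" for t
        using that point_ideal_mult[OF J] by simp
    qed
    then show "x * t \<in> J" if "t \<in> layer y (scalars_mod J)" for t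
      using that by blast
    show "- y * t \<in> layer y (scalars_mod J)" if "t \<in> layer y (scalars_mod J)" for t
      unfolding mult_minus_left
      by (intro subspace_minus[OF layer_subspace[OF scalars_mod_subspace[OF J]]] st(1)[OF _ that]) blast
    show "t \<in> J" if "- y * t \<in> J" for t
      using that central_power_cancel[OF central_y_p b, of t] subspace_minus[OF Jsub[OF J], of "- y * t"] by simp
    show "u * s \<in> layer f (layer y (scalars_mod J))"
      if "u \<in> {e, f, h, x, y}" "s \<in> layer f (layer y (scalars_mod J))" for u s
      by (rule st(2)[OF _ that(2)]) (use that(1) in blast)
  qed (use h b point_ideal_mult[OF J] in \<open>simp_all add: fx fy sc_0\<close>)
qed

end

section \<open>Existence of singular vectors\<close>

lemma commute_normalized: "d * u = u * d \<Longrightarrow> \<exists>c. d * u = (u + sc c) * d"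
  by (rule exI[of _ 0]) (simp add: sc_0)

text \<open>
  The eigenvector of \<open>v\<close> arises from one of \<open>u\<close> by applying a polynomial in \<open>v\<close>, and this commutes
  with \<open>u\<close>.
\<close>

lemma common_eigenvector:
  assumes J: "point_ideal J" and comm: "u * v = v * u"
    and u: "central (u ^ p)" "c ^ p = chi (u ^ p)" and v: "central (v ^ p)" "d ^ p = chi (v ^ p)"
  shows "\<exists>a. a \<notin> J \<and> u - sc c \<in> colon J a \<and> v - sc d \<in> colon J a"
proof -
  obtain a where a: "a \<notin> J" "u - sc c \<in> colon J a"
    using eigenvector_p_root[OF J u] by blast
  have "(u - sc c) * v = v * (u - sc c)"
    using comm sc_central[of c v] by (simp add: left_diff_distrib right_diff_distrib)
  then obtain b where "b \<notin> colon J a" "u - sc c \<in> colon (colon J a) b" "v - sc d \<in> colon (colon J a) b"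
    using eigenvector_p_root[OF point_ideal_colon[OF J a(1)] v] a(2) commute_normalized by metis
  then show ?thesis unfolding colon_colon by (auto simp: colon_def)
qed

lemma zero_eigenvector:
  assumes J: "point_ideal J" and comm: "u * v = v * u"
    and u: "central (u ^ p)" "chi (u ^ p) = 0" and v: "central (v ^ p)" "chi (v ^ p) = 0"
  shows "\<exists>a. a \<notin> J \<and> u \<in> colon J a \<and> v \<in> colon J a"
proof -
  have "(0 :: 'k) ^ p = 0" using p_gt_2 by simp
  then show ?thesis
    using common_eigenvector[OF J comm u(1) _ v(1), of 0 0] u(2) v(2) by (simp add: sc_0)
qed

text \<open>
  The difference of two solutions is fixed by the Frobenius map, and the \<open>p\<close> elements of the prime field
  exhaust the roots of \<open>t\<^sup>p - t\<close>.
\<close>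

lemma artin_schreier_roots:
  assumes "(c :: 'k) ^ p - c = d ^ p - d"
  shows "\<exists>n<p. c = d + of_nat n"
proof -
  define P :: "'k poly" where "P = monom 1 p - monom 1 1"
  have dP: "P \<noteq> 0" "degree P \<le> p"
  proof -
    have "coeff P p = 1" using p_gt_2 by (simp add: P_def)
    then show "P \<noteq> 0" by (metis coeff_0 zero_neq_one)
    show "degree P \<le> p" unfolding P_def
      using p_gt_2 by (intro degree_diff_le degree_monom_le order_trans[OF degree_monom_le]) auto
  qed
  have root: "poly P t = 0 \<longleftrightarrow> t ^ p = t" for t by (simp add: P_def poly_monom)
  let ?F = "(of_nat :: nat \<Rightarrow> 'k) ` {..<p}"
  have "inj_on (of_nat :: nat \<Rightarrow> 'k) {..<p}"
  proof (rule inj_onI)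
    have less: False if "m < n" "n < p" "(of_nat m :: 'k) = of_nat n" for m n
    proof -
      have "(of_nat (n - m) :: 'k) = 0" using that by (simp add: of_nat_diff)
      then have "p dvd n - m" using CHAR by (simp only: of_nat_eq_0_iff_char_dvd)
      then show False using that by (auto dest!: dvd_imp_le)
    qed
    fix m n assume "m \<in> {..<p}" "n \<in> {..<p}" "(of_nat m :: 'k) = of_nat n"
    then show "m = n" using less[of m n] less[of n m] by (cases m n rule: linorder_cases) auto
  qed
  then have "card ?F = p" by (simp add: card_image)
  moreover have "?F \<subseteq> {t. poly P t = 0}" by (auto simp: root of_nat_power_p)
  moreover have "finite {t. poly P t = 0}" "card {t. poly P t = 0} \<le> p"
    using poly_roots_finite[OF dP(1)] card_poly_roots_bound[OF dP(1)] dP(2) by auto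
  ultimately have F: "?F = {t. poly P t = 0}" by (metis card_seteq)
  have "(c + - d) ^ p = c ^ p + (- d) ^ p"
    by (rule freshmans_dream) (simp_all only: CHAR prime_p)
  then have "(c - d) ^ p = c ^ p - d ^ p" by (simp add: minus_power_p)
  also have "\<dots> = c - d" using assms by (simp add: algebra_simps)
  finally have "(c - d) ^ p = c - d" .
  then have "c - d \<in> ?F" by (simp add: F root)
  then obtain n where "n < p" "c - d = of_nat n" by auto
  then show ?thesis by (intro exI[of _ n]) (simp add: algebra_simps)
qed

text \<open>
  The weights of the vectors killed by \<open>e\<close> and \<open>x\<close> solve one Artin--Schreier equation. The
  invertible \<open>y\<close> preserves these vectors and lowers the weight by 1, so all solutions occur.
\<close>

lemma highest_weight_vector:
  assumes J: "point_ideal J" and e: "chi (e ^ p) = 0" and x: "chi (x ^ p) = 0"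
    and y: "chi (y ^ p) \<noteq> 0" and c: "c ^ p - c = chi (h ^ p - h)"
  shows "\<exists>a. a \<notin> J \<and> e \<in> colon J a \<and> x \<in> colon J a \<and> h - sc c \<in> colon J a"
proof -
  obtain a1 where a1: "a1 \<notin> J" "e \<in> colon J a1" "x \<in> colon J a1"
    using zero_eigenvector[OF J ex central_e_p e central_x_p x] by blast
  define J1 where "J1 = colon J a1"
  have J1: "point_ideal J1" unfolding J1_def by (rule point_ideal_colon[OF J a1(1)])
  let ?P = "monom 1 p + [:- chi (h ^ p - h), - 1:]"
  have "coeff ?P p = 1" using p_gt_2 by (simp add: coeff_pCons split: nat.split)
  then have "?P \<noteq> 0" by (metis coeff_0 zero_neq_one)
  moreover have "peval ?P h = (h ^ p - h) * 1 - sc (chi (h ^ p - h)) * 1"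
    by (simp only: peval_add peval_monom peval_pCons peval_0) (simp add: sc_one sc_minus)
  then have "peval ?P h \<in> J1" using point_ideal_central[OF J1 central_h_p, of 1] by simp
  ultimately obtain d a2 where a2: "a2 \<notin> J1" "h - sc d \<in> colon J1 a2"
    and pres: "\<And>b. b \<in> J1 \<Longrightarrow> \<exists>c'. b * h = (h + sc c') * b \<Longrightarrow> b \<in> colon J1 a2"
    using eigenvector_exists[OF J1] by blast
  define J2 where "J2 = colon J1 a2"
  have J2: "point_ideal J2" unfolding J2_def by (rule point_ideal_colon[OF J1 a2(1)])
  have h2: "h - sc d \<in> J2" using a2(2) by (simp add: J2_def)
  have "e * h = (h + sc (- 2)) * e"
    using sc_of_nat[of 2] by (simp add: he sc_minus left_diff_distrib)
  then have e2: "e \<in> J2" using a1(2) pres[of e] by (auto simp: J1_def J2_def)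
  have "x * h = (h + sc (- 1)) * x" by (simp add: hx sc_minus sc_one left_diff_distrib)
  then have x2: "x \<in> J2" using a1(3) pres[of x] by (auto simp: J1_def J2_def)
  have "d ^ p - d = chi (h ^ p - h)"
  proof -
    have "(h ^ p - sc (d ^ p)) - (h - sc d) - ((h ^ p - h) * 1 - sc (chi (h ^ p - h)) * 1) \<in> J2"
      by (intro subspace_diff[OF Jsub[OF J2]] eigenvalue_power[OF J2 h2] h2 point_ideal_central[OF J2 central_h_p])
    then have "sc (chi (h ^ p - h) - (d ^ p - d)) \<in> J2" by (simp add: sc_diff sc_add algebra_simps)
    then show ?thesis by (simp add: point_ideal_sc[OF J2])
  qed
  then obtain n where n: "n < p" "d = c + of_nat n" using artin_schreier_roots[of d c] c by auto
  have ypow: "h * y ^ n = y ^ n * (h - of_nat n)" for n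
  proof (induction n)
    case (Suc n)
    have "h * y ^ Suc n = (h * y ^ n) * y" by (simp add: power_Suc2 mult.assoc del: power_Suc)
    also have "\<dots> = y ^ n * (y * (h - of_nat (Suc n)))"
      unfolding Suc by (simp add: mult.assoc left_diff_distrib right_diff_distrib hy distrib_left mult_of_nat_commute)
    finally show ?case by (simp add: power_Suc2 mult.assoc del: power_Suc of_nat_Suc)
  qed simp
  have "y ^ n \<notin> J2"
  proof
    assume "y ^ n \<in> J2"
    then have "y ^ (p - n) * y ^ n \<in> J2" by (rule point_ideal_mult[OF J2])
    then have "y ^ p * 1 \<in> J2" using n by (simp flip: power_add)
    then have "sc (chi (y ^ p)) \<in> J2"
      using point_ideal_diff_iff[OF J2 point_ideal_central[OF J2 central_y_p, of 1]] by simp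
    then show False using y point_ideal_sc[OF J2] by simp
  qed
  moreover have ye: "e * y ^ n \<in> J2 \<and> x * y ^ n \<in> J2" for n
  proof (induction n)
    case 0
    show ?case using e2 x2 by simp
  next
    case (Suc n)
    have "e * y ^ Suc n = y * (e * y ^ n) + x * y ^ n" "x * y ^ Suc n = y * (x * y ^ n)"
      by (simp_all add: ey xy distrib_right flip: mult.assoc)
    then show ?case
      using Suc point_ideal_mult[OF J2] by (simp add: subspace_add[OF Jsub[OF J2]])
  qed
  moreover have "(h - sc c) * y ^ n = y ^ n * (h - sc d)"
    using ypow[of n] sc_central[of c "y ^ n"] by (simp add: n left_diff_distrib right_diff_distrib sc_add sc_of_nat distrib_left)
  then have "(h - sc c) * y ^ n \<in> J2" using point_ideal_mult[OF J2 h2] by simp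
  ultimately have "y ^ n \<notin> J2" "e \<in> colon J2 (y ^ n)" "x \<in> colon J2 (y ^ n)" "h - sc c \<in> colon J2 (y ^ n)"
    by (simp_all add: colon_def)
  then show ?thesis
    unfolding J2_def J1_def colon_colon by (intro exI[of _ "y ^ n * (a2 * a1)"]) (auto simp: colon_def mult.assoc)
qed

end

section \<open>Induced modules\<close>

lemma (in left_module) smult_zero_left: "m \<in> carrier M \<Longrightarrow> \<zero>\<^bsub>A\<^esub> \<odot>\<^bsub>M\<^esub> m = \<zero>\<^bsub>M\<^esub>"
  using smult_l_distr[of "\<zero>\<^bsub>A\<^esub>" "\<zero>\<^bsub>A\<^esub>" m] smult_closed[of "\<zero>\<^bsub>A\<^esub>" m]
  by (simp add: M.add.l_cancel_one)

lemma (in left_module) smult_zero_right: "a \<in> carrier A \<Longrightarrow> a \<odot>\<^bsub>M\<^esub> \<zero>\<^bsub>M\<^esub> = \<zero>\<^bsub>M\<^esub>"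
  using smult_r_distr[of a "\<zero>\<^bsub>M\<^esub>" "\<zero>\<^bsub>M\<^esub>"] smult_closed[of a "\<zero>\<^bsub>M\<^esub>"]
  by (simp add: M.add.l_cancel_one)

locale tensor = ring A for A :: "('a, 'x) ring_scheme" (structure) +
  fixes B :: "'a set" and W :: "('a, 'w) module"
  assumes B_carrier: "B \<subseteq> carrier A"
    and W_add: "w \<in> carrier W \<Longrightarrow> w' \<in> carrier W \<Longrightarrow> w \<oplus>\<^bsub>W\<^esub> w' \<in> carrier W"
    and W_smult: "b \<in> B \<Longrightarrow> w \<in> carrier W \<Longrightarrow> b \<odot>\<^bsub>W\<^esub> w \<in> carrier W"
begin

definition tfree :: "('a \<times> 'w \<Rightarrow>\<^sub>0 int) monoid" where
  "tfree = free_Abelian_group (carrier A \<times> carrier W)"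

definition trel :: "('a \<times> 'w \<Rightarrow>\<^sub>0 int) set" where
  "trel = generate tfree (tensor_rels A B W)"

definition lact :: "'a \<Rightarrow> ('a \<times> 'w \<Rightarrow>\<^sub>0 int) \<Rightarrow> ('a \<times> 'w \<Rightarrow>\<^sub>0 int)" where
  "lact a = frag_extend (\<lambda>(a', w). frag_of (a \<otimes> a', w))"

definition tcls :: "('a \<times> 'w \<Rightarrow>\<^sub>0 int) \<Rightarrow> ('a \<times> 'w \<Rightarrow>\<^sub>0 int) set" where
  "tcls t = trel #>\<^bsub>tfree\<^esub> t"

sublocale tfree: comm_group tfree
  unfolding tfree_def by (rule abelian_free_Abelian_group)

lemma tfree_simps [simp]:
  "t \<in> carrier tfree \<longleftrightarrow> Poly_Mapping.keys t \<subseteq> carrier A \<times> carrier W"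
  "monoid.mult tfree = (+)" "monoid.one tfree = 0"
  by (simp_all add: tfree_def free_Abelian_group_def)

lemma tfree_inv: "t \<in> carrier tfree \<Longrightarrow> inv\<^bsub>tfree\<^esub> t = - t"
  unfolding tfree_def by simp

lemma tfree_ops:
  assumes "s \<in> carrier tfree" "t \<in> carrier tfree"
  shows "s + t \<in> carrier tfree" "s - t \<in> carrier tfree" "- s \<in> carrier tfree"
  using tfree.m_closed[OF assms] tfree.m_closed[OF assms(1) tfree.inv_closed[OF assms(2)]]
    tfree.inv_closed[OF assms(1)] assms
  by (simp_all only: tfree_inv tfree_simps(2)) simp_all

lemma tensor_rels_carrier: "tensor_rels A B W \<subseteq> carrier tfree"
proof -
  have g: "frag_of (a, w) \<in> carrier tfree" if "a \<in> carrier A" "w \<in> carrier W" for a w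
    using that by simp
  have "b \<in> carrier A" if "b \<in> B" for b using that B_carrier by blast
  then show ?thesis
    unfolding tensor_rels_def
    by (intro Un_least subsetI; elim CollectE exE conjE; hypsubst;
        intro tfree_ops g a_closed m_closed W_add W_smult; simp)
qed

sublocale trel: subgroup trel tfree
  unfolding trel_def by (rule tfree.generate_is_subgroup[OF tensor_rels_carrier])

sublocale tnormal: normal trel tfree
  by (rule tfree.subgroup_imp_normal) (rule trel.subgroup_axioms)

lemma trel_ops: "s \<in> trel \<Longrightarrow> t \<in> trel \<Longrightarrow> s + t \<in> trel" "s \<in> trel \<Longrightarrow> - s \<in> trel"
    "s \<in> trel \<Longrightarrow> t \<in> trel \<Longrightarrow> s - t \<in> trel"
proof -
  show a: "s \<in> trel \<Longrightarrow> t \<in> trel \<Longrightarrow> s + t \<in> trel" for s t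
    using trel.m_closed[of s t] by simp
  show m: "s \<in> trel \<Longrightarrow> - s \<in> trel" for s
    using trel.m_inv_closed[of s] tfree_inv[OF trel.mem_carrier, of s] by simp
  show "s \<in> trel \<Longrightarrow> t \<in> trel \<Longrightarrow> s - t \<in> trel" using a[of s "- t"] m[of t] by simp
qed

lemma trelI: "t \<in> tensor_rels A B W \<Longrightarrow> t \<in> trel"
  unfolding trel_def by (rule generate.incl)

lemma trel_zero: "0 \<in> trel"
  using trel.one_closed by simp

lemma tfree_induct [consumes 1, case_names zero of diff]:
  assumes "t \<in> carrier tfree" "P 0"
    "\<And>a w. a \<in> carrier A \<Longrightarrow> w \<in> carrier W \<Longrightarrow> P (frag_of (a, w))"
    "\<And>s t. s \<in> carrier tfree \<Longrightarrow> t \<in> carrier tfree \<Longrightarrow> P s \<Longrightarrow> P t \<Longrightarrow> P (s - t)"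
  shows "P t"
  using assms(1) unfolding tfree_simps
  by (rule free_Abelian_group_induct) (use assms in auto)

lemma tcls_eq_iff:
  assumes "s \<in> carrier tfree" "t \<in> carrier tfree"
  shows "tcls s = tcls t \<longleftrightarrow> s - t \<in> trel"
proof -
  have "s \<in> trel #>\<^bsub>tfree\<^esub> t \<longleftrightarrow> s - t \<in> trel"
    by (force simp: r_coset_def eq_diff_eq[symmetric])
  moreover have "s \<in> trel #>\<^bsub>tfree\<^esub> t \<longleftrightarrow> tcls s = tcls t"
    unfolding tcls_def
    using tfree.repr_independence[of s trel t] tfree.rcos_self[OF assms(1), of trel] assms trel.subgroup_axioms
    by blast
  ultimately show ?thesis by simp
qed

lemma lact_diff: "lact a (s - t) = lact a s - lact a t"
  and lact_add: "lact a (s + t) = lact a s + lact a t"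
  and lact_minus: "lact a (- t) = - lact a t"
  and lact_zero: "lact a 0 = 0"
  and lact_of: "lact a (frag_of (a', w)) = frag_of (a \<otimes> a', w)"
  by (simp_all add: lact_def frag_extend_diff frag_extend_add frag_extend_minus)

lemma lact_closed:
  assumes a: "a \<in> carrier A" and t: "t \<in> carrier tfree"
  shows "lact a t \<in> carrier tfree"
  using t
proof (induction t rule: tfree_induct)
  case (diff s t)
  from tfree_ops(2)[OF diff(3,4)] show ?case by (simp only: lact_diff)
qed (use a in \<open>simp_all add: lact_of lact_zero\<close>)

lemma tensor_relsI:
  "\<lbrakk>a \<in> carrier A; a' \<in> carrier A; w \<in> carrier W\<rbrakk>
    \<Longrightarrow> frag_of (a \<oplus> a', w) - frag_of (a, w) - frag_of (a', w) \<in> tensor_rels A B W"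
  "\<lbrakk>a \<in> carrier A; w \<in> carrier W; w' \<in> carrier W\<rbrakk>
    \<Longrightarrow> frag_of (a, w \<oplus>\<^bsub>W\<^esub> w') - frag_of (a, w) - frag_of (a, w') \<in> tensor_rels A B W"
  "\<lbrakk>a \<in> carrier A; b \<in> B; w \<in> carrier W\<rbrakk>
    \<Longrightarrow> frag_of (a \<otimes> b, w) - frag_of (a, b \<odot>\<^bsub>W\<^esub> w) \<in> tensor_rels A B W"
  unfolding tensor_rels_def by blast+

text \<open>Left multiplication maps relations to relations, so it acts on the tensor product.\<close>

lemma lact_tensor_rels:
  assumes a: "a \<in> carrier A" and t: "t \<in> tensor_rels A B W"
  shows "lact a t \<in> tensor_rels A B W"
proof -
  consider a1 a2 w where "a1 \<in> carrier A" "a2 \<in> carrier A" "w \<in> carrier W"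
      "t = frag_of (a1 \<oplus> a2, w) - frag_of (a1, w) - frag_of (a2, w)"
    | a1 w w' where "a1 \<in> carrier A" "w \<in> carrier W" "w' \<in> carrier W"
      "t = frag_of (a1, w \<oplus>\<^bsub>W\<^esub> w') - frag_of (a1, w) - frag_of (a1, w')"
    | a1 b w where "a1 \<in> carrier A" "b \<in> B" "w \<in> carrier W"
      "t = frag_of (a1 \<otimes> b, w) - frag_of (a1, b \<odot>\<^bsub>W\<^esub> w)"
    using t unfolding tensor_rels_def by blast
  then show ?thesis
  proof cases
    case 1
    then show ?thesis
      using a tensor_relsI(1)[of "a \<otimes> a1" "a \<otimes> a2" w] by (simp add: lact_diff lact_of r_distr)
  next
    case 2
    then show ?thesis
      using a tensor_relsI(2)[of "a \<otimes> a1" w w'] by (simp add: lact_diff lact_of)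
  next
    case 3
    moreover have "b \<in> carrier A" using 3(2) B_carrier by blast
    ultimately show ?thesis
      using a tensor_relsI(3)[of "a \<otimes> a1" b w] by (simp add: lact_diff lact_of m_assoc)
  qed
qed

lemma lact_trel:
  assumes a: "a \<in> carrier A" and t: "t \<in> trel" shows "lact a t \<in> trel"
  using t unfolding trel_def
proof (induction rule: generate.induct)
  case one
  then show ?case using trel_zero by (simp add: lact_zero trel_def)
next
  case (incl t)
  then show ?case by (intro generate.incl lact_tensor_rels[OF a])
next
  case (inv t)
  have t: "t \<in> carrier tfree" using inv tensor_rels_carrier by blast
  have "lact a t \<in> trel" by (rule trelI[OF lact_tensor_rels[OF a inv]])
  then show ?case
    using trel_ops(2) by (simp add: tfree_inv[OF t] lact_minus trel_def)
next
  case (eng s t)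
  then show ?case using trel_ops(1) by (simp add: lact_add trel_def)
qed

lemma tensor_fields:
  "carrier (tensor_module A B W) = carrier (tfree Mod trel)"
  "ring.zero (tensor_module A B W) = monoid.one (tfree Mod trel)"
  "ring.add (tensor_module A B W) = monoid.mult (tfree Mod trel)"
  "module.smult (tensor_module A B W) = (\<lambda>a C. \<Union>t\<in>C. tcls (lact a t))"
  by (simp_all add: tensor_module_def Let_def tfree_def trel_def tcls_def lact_def)

lemma tcls_closed: "t \<in> carrier tfree \<Longrightarrow> tcls t \<in> carrier (tensor_module A B W)"
  by (auto simp: tensor_fields carrier_FactGroup tcls_def)

lemma tcls_surj: "C \<in> carrier (tensor_module A B W) \<Longrightarrow> \<exists>t\<in>carrier tfree. C = tcls t"
  by (auto simp: tensor_fields carrier_FactGroup tcls_def)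

lemma tcls_add: "s \<in> carrier tfree \<Longrightarrow> t \<in> carrier tfree \<Longrightarrow>
    tcls s \<oplus>\<^bsub>tensor_module A B W\<^esub> tcls t = tcls (s + t)"
  using tnormal.rcos_sum[of s t] by (simp add: tensor_fields tcls_def)

lemma tcls_zero: "\<zero>\<^bsub>tensor_module A B W\<^esub> = tcls 0"
proof -
  have "tcls 0 = trel"
    unfolding tcls_def using tfree.coset_join2[of 0 trel] trel.subgroup_axioms trel_zero by simp
  then show ?thesis by (simp add: tensor_fields)
qed

lemma tcls_smult:
  assumes a: "a \<in> carrier A" and t: "t \<in> carrier tfree"
  shows "a \<odot>\<^bsub>tensor_module A B W\<^esub> tcls t = tcls (lact a t)"
proof -
  have t_mem: "t \<in> tcls t"
    unfolding tcls_def using tfree.rcos_self[OF t] trel.subgroup_axioms by blast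
  have "tcls (lact a s) = tcls (lact a t)" if s_mem: "s \<in> tcls t" for s
  proof -
    obtain r where "r \<in> trel" "s = r + t" using s_mem by (auto simp: tcls_def r_coset_def)
    then have s: "s \<in> carrier tfree" "s - t \<in> trel"
      using tfree_ops(1)[OF trel.mem_carrier t] by auto
    then show ?thesis
      using lact_trel[OF a s(2)] a t by (simp only: tcls_eq_iff lact_closed lact_diff)
  qed
  then show ?thesis unfolding tensor_fields using t_mem by blast
qed

lemma tensor_left_module: "left_module A (tensor_module A B W)"
proof -
  let ?T = "tensor_module A B W"
  have "0 \<in> carrier tfree" by simp
  note tcls_simps = tcls_add tcls_zero tcls_closed[OF this] tfree_ops this
  have "abelian_group ?T"
  proof (rule abelian_groupI)
    show "C \<oplus>\<^bsub>?T\<^esub> D \<in> carrier ?T" if "C \<in> carrier ?T" "D \<in> carrier ?T" for C D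
      using tcls_surj[OF that(1)] tcls_surj[OF that(2)]
      by (elim bexE) (simp only: tcls_simps tcls_closed)
    show "(C \<oplus>\<^bsub>?T\<^esub> D) \<oplus>\<^bsub>?T\<^esub> G = C \<oplus>\<^bsub>?T\<^esub> (D \<oplus>\<^bsub>?T\<^esub> G)"
      if "C \<in> carrier ?T" "D \<in> carrier ?T" "G \<in> carrier ?T" for C D G
      using tcls_surj[OF that(1)] tcls_surj[OF that(2)] tcls_surj[OF that(3)]
      by (elim bexE) (simp only: tcls_simps add.assoc)
    show "C \<oplus>\<^bsub>?T\<^esub> D = D \<oplus>\<^bsub>?T\<^esub> C" if "C \<in> carrier ?T" "D \<in> carrier ?T" for C D
      using tcls_surj[OF that(1)] tcls_surj[OF that(2)]
      by (elim bexE) (simp only: tcls_simps add.commute)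
    show "\<zero>\<^bsub>?T\<^esub> \<oplus>\<^bsub>?T\<^esub> C = C" if "C \<in> carrier ?T" for C
      using tcls_surj[OF that] by (elim bexE) (simp only: tcls_simps add_0_left)
    show "\<exists>D\<in>carrier ?T. D \<oplus>\<^bsub>?T\<^esub> C = \<zero>\<^bsub>?T\<^esub>" if C: "C \<in> carrier ?T" for C
    proof -
      obtain s where s: "s \<in> carrier tfree" "C = tcls s" using tcls_surj[OF C] by blast
      have "tcls (- s) \<oplus>\<^bsub>?T\<^esub> C = \<zero>\<^bsub>?T\<^esub>"
        using s tfree_ops(3)[OF s(1) s(1)] by (simp only: tcls_simps left_minus)
      then show ?thesis using tcls_closed[OF tfree_ops(3)[OF s(1) s(1)]] by blast
    qed
  qed (simp only: tcls_simps)
  then interpret T: abelian_group ?T .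
  show ?thesis
  proof unfold_locales
    show "a \<odot>\<^bsub>?T\<^esub> C \<in> carrier ?T" if "a \<in> carrier A" "C \<in> carrier ?T" for a C
      using that(1) tcls_surj[OF that(2)] by (elim bexE) (simp only: tcls_smult tcls_closed lact_closed)
    show "a \<odot>\<^bsub>?T\<^esub> (C \<oplus>\<^bsub>?T\<^esub> D) = a \<odot>\<^bsub>?T\<^esub> C \<oplus>\<^bsub>?T\<^esub> a \<odot>\<^bsub>?T\<^esub> D"
      if "a \<in> carrier A" "C \<in> carrier ?T" "D \<in> carrier ?T" for a C D
      using that(1) tcls_surj[OF that(2)] tcls_surj[OF that(3)]
      by (elim bexE) (simp only: tcls_smult tcls_add lact_closed tfree_ops lact_add)
    have "lact \<one> s = s" if "s \<in> carrier tfree" for s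
      using that by (induction s rule: tfree_induct) (simp_all add: lact_diff lact_of lact_zero)
    then show "\<one> \<odot>\<^bsub>?T\<^esub> C = C" if "C \<in> carrier ?T" for C
      using tcls_surj[OF that] by (elim bexE) (simp only: tcls_smult one_closed)
    fix a b C assume a: "a \<in> carrier A" and b: "b \<in> carrier A" and C: "C \<in> carrier ?T"
    obtain s where s: "s \<in> carrier tfree" "C = tcls s" using tcls_surj[OF C] by blast
    have "lact (a \<otimes> b) s = lact a (lact b s)"
      using s(1) by (induction s rule: tfree_induct) (use a b in \<open>simp_all add: lact_diff lact_of lact_zero m_assoc\<close>)
    then show "(a \<otimes> b) \<odot>\<^bsub>?T\<^esub> C = a \<odot>\<^bsub>?T\<^esub> (b \<odot>\<^bsub>?T\<^esub> C)"
      using a b s by (simp only: tcls_smult lact_closed m_closed)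
    have "lact (a \<oplus> b) s - (lact a s + lact b s) \<in> trel"
      using s(1)
    proof (induction s rule: tfree_induct)
      case (of c w)
      have "frag_of (a \<otimes> c \<oplus> b \<otimes> c, w) - frag_of (a \<otimes> c, w) - frag_of (b \<otimes> c, w) \<in> trel"
        using of a b by (intro trelI tensor_relsI) simp_all
      then show ?case using of a b by (simp add: lact_of l_distr diff_diff_eq)
    next
      case (diff s t)
      have "lact (a \<oplus> b) (s - t) - (lact a (s - t) + lact b (s - t))
          = (lact (a \<oplus> b) s - (lact a s + lact b s)) - (lact (a \<oplus> b) t - (lact a t + lact b t))"
        by (simp add: lact_diff)
      then show ?case using trel_ops(3)[OF diff(3,4)] by simp
    qed (simp add: lact_zero trel_zero)
    then show "(a \<oplus> b) \<odot>\<^bsub>?T\<^esub> C = a \<odot>\<^bsub>?T\<^esub> C \<oplus>\<^bsub>?T\<^esub> b \<odot>\<^bsub>?T\<^esub> C"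
      using a b s by (simp only: tcls_smult tcls_add lact_closed tfree_ops tcls_eq_iff a_closed)
  qed
qed

text \<open>
  A biadditive balanced map to an abelian group kills the relations, so it detects nonzero elements
  of the tensor product.
\<close>

lemma tensor_nonzero:
  assumes M: "abelian_group M"
    and \<beta>: "\<And>a w. a \<in> carrier A \<Longrightarrow> w \<in> carrier W \<Longrightarrow> \<beta> a w \<in> carrier M"
    and add_l: "\<And>a a' w. a \<in> carrier A \<Longrightarrow> a' \<in> carrier A \<Longrightarrow> w \<in> carrier W \<Longrightarrow> \<beta> (a \<oplus> a') w = \<beta> a w \<oplus>\<^bsub>M\<^esub> \<beta> a' w"
    and add_r: "\<And>a w w'. a \<in> carrier A \<Longrightarrow> w \<in> carrier W \<Longrightarrow> w' \<in> carrier W \<Longrightarrow> \<beta> a (w \<oplus>\<^bsub>W\<^esub> w') = \<beta> a w \<oplus>\<^bsub>M\<^esub> \<beta> a w'"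
    and bal: "\<And>a b w. a \<in> carrier A \<Longrightarrow> b \<in> B \<Longrightarrow> w \<in> carrier W \<Longrightarrow> \<beta> (a \<otimes> b) w = \<beta> a (b \<odot>\<^bsub>W\<^esub> w)"
    and aw: "a \<in> carrier A" "w \<in> carrier W" and nz: "\<beta> a w \<noteq> \<zero>\<^bsub>M\<^esub>"
  shows "tcls (frag_of (a, w)) \<noteq> \<zero>\<^bsub>tensor_module A B W\<^esub>"
proof
  interpret M: abelian_group M by (rule M)
  have "(\<lambda>(a, w). \<beta> a w) ` (carrier A \<times> carrier W) \<subseteq> carrier (add_monoid M)"
    using \<beta> by auto
  from comm_group.free_Abelian_group_universal[OF M.a_comm_group this]
  obtain \<phi> where \<phi>: "\<phi> \<in> hom tfree (add_monoid M)"
    and \<phi>_of: "\<And>z. z \<in> carrier A \<times> carrier W \<Longrightarrow> \<phi> (frag_of z) = (\<lambda>(a, w). \<beta> a w) z"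
    unfolding tfree_def by blast
  interpret \<phi>: group_hom tfree "add_monoid M" \<phi>
    using \<phi> tfree.group_axioms M.a_group by (simp add: group_hom_def group_hom_axioms_def)
  have \<phi>_diff: "\<phi> (s - t) = \<phi> s \<ominus>\<^bsub>M\<^esub> \<phi> t" if "s \<in> carrier tfree" "t \<in> carrier tfree" for s t
    using \<phi>.hom_mult[OF that(1) tfree.inv_closed[OF that(2)]] \<phi>.hom_inv[OF that(2)] that
    by (simp only: tfree_inv) (simp add: a_minus_def a_inv_def)
  have g: "frag_of (a, w) \<in> carrier tfree" if "a \<in> carrier A" "w \<in> carrier W" for a w
    using that by simp
  have B: "b \<in> carrier A" if "b \<in> B" for b using that B_carrier by blast
  have cancel: "u \<oplus>\<^bsub>M\<^esub> v \<ominus>\<^bsub>M\<^esub> u \<ominus>\<^bsub>M\<^esub> v = \<zero>\<^bsub>M\<^esub>" if "u \<in> carrier M" "v \<in> carrier M" for u v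
    using that M.r_neg1[of u v] M.a_comm[of "u \<oplus>\<^bsub>M\<^esub> v" "\<ominus>\<^bsub>M\<^esub> u"] by (simp add: a_minus_def M.r_neg)
  have cancel': "u \<ominus>\<^bsub>M\<^esub> u = \<zero>\<^bsub>M\<^esub>" if "u \<in> carrier M" for u
    using that by (simp add: a_minus_def M.r_neg)
  have "\<phi> t = \<zero>\<^bsub>M\<^esub>" if "t \<in> tensor_rels A B W" for t
    using that unfolding tensor_rels_def
    by (elim UnE CollectE exE conjE; hypsubst)
      (simp_all only: \<phi>_diff \<phi>_of g tfree_ops a_closed m_closed W_add W_smult add_l add_r bal B mem_Times_iff fst_conv snd_conv case_prod_conv,
       simp_all add: cancel cancel' \<beta> B W_smult)
  then have "tensor_rels A B W \<subseteq> kernel tfree (add_monoid M) \<phi>"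
    using tensor_rels_carrier by (auto simp: kernel_def simp del: tfree_simps(1))
  then have "trel \<subseteq> kernel tfree (add_monoid M) \<phi>"
    unfolding trel_def by (rule tfree.generate_subgroup_incl[OF _ \<phi>.subgroup_kernel])
  moreover assume "tcls (frag_of (a, w)) = \<zero>\<^bsub>tensor_module A B W\<^esub>"
  then have "frag_of (a, w) - 0 \<in> trel"
    using aw tcls_eq_iff[of "frag_of (a, w)" 0] by (simp add: tcls_zero)
  ultimately have "\<phi> (frag_of (a, w)) = \<zero>\<^bsub>M\<^esub>" by (auto simp: kernel_def)
  then show False using nz aw \<phi>_of by simp
qed

end

section \<open>Modules induced from characters of subalgebras\<close>

context assoc_alg
begin

lemma sm_as_mult: "a \<in> carrier A \<Longrightarrow> c \<odot> a = (c \<odot> \<one>) \<otimes> a"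
  using sm_mult_left[of \<one> a c] by simp

lemma sm_as_mult_right: "a \<in> carrier A \<Longrightarrow> c \<odot> a = a \<otimes> (c \<odot> \<one>)"
  using sm_mult_right[of a \<one> c] by simp

lemma sm_0_left: "a \<in> carrier A \<Longrightarrow> 0 \<odot> a = \<zero>"
  using sm_add_left[of a 0 0] by (simp add: add.l_cancel_one)

context
  fixes S assumes S: "S \<subseteq> carrier A"
begin

lemma subalg_gen_carrier: "subalg_gen A S \<subseteq> carrier A"
  unfolding subalg_gen_def using S by (intro generate_ring_incl) auto

lemma subalg_gen_intros:
  "s \<in> S \<Longrightarrow> s \<in> subalg_gen A S" "\<one> \<in> subalg_gen A S" "c \<odot> \<one> \<in> subalg_gen A S"
  "a \<in> subalg_gen A S \<Longrightarrow> b \<in> subalg_gen A S \<Longrightarrow> a \<oplus> b \<in> subalg_gen A S"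
  "a \<in> subalg_gen A S \<Longrightarrow> b \<in> subalg_gen A S \<Longrightarrow> a \<otimes> b \<in> subalg_gen A S"
  "a \<in> subalg_gen A S \<Longrightarrow> \<ominus> a \<in> subalg_gen A S"
  unfolding subalg_gen_def by (auto intro: generate_ring.intros)

lemma subalg_gen_sm: "a \<in> subalg_gen A S \<Longrightarrow> c \<odot> a \<in> subalg_gen A S"
  using sm_as_mult[of a c] subalg_gen_carrier subalg_gen_intros(3,5) by auto

lemma sm_inject:
  assumes v: "v \<in> carrier A" "v \<noteq> \<zero>" and eq: "c \<odot> v = d \<odot> v"
  shows "c = d"
proof (rule ccontr)
  assume "c \<noteq> d"
  have "(c - d) \<odot> v \<oplus> d \<odot> v = d \<odot> v" using v eq by (simp flip: sm_add_left)
  then have "(c - d) \<odot> v = \<zero>" using v by (simp add: add.l_cancel_one)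
  then have "inverse (c - d) \<odot> ((c - d) \<odot> v) = inverse (c - d) \<odot> \<zero>" by simp
  also have "\<dots> = \<zero>" using sm_mult_left[of \<zero> \<zero> "inverse (c - d)"] by simp
  finally show False using v \<open>c \<noteq> d\<close> by (simp add: sm_sm sm_one)
qed

lemma eigen_mult:
  assumes "a \<in> carrier A" "b \<in> carrier A" "v \<in> carrier A" "a \<otimes> v = c \<odot> v" "b \<otimes> v = d \<odot> v"
  shows "(a \<otimes> b) \<otimes> v = (c * d) \<odot> v"
proof -
  have "(a \<otimes> b) \<otimes> v = d \<odot> (a \<otimes> v)" using assms by (simp add: m_assoc flip: sm_mult_right)
  then show ?thesis using assms by (simp add: sm_sm mult.commute)
qed

lemma eigen_minus:
  assumes "a \<in> carrier A" "v \<in> carrier A" "a \<otimes> v = c \<odot> v"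
  shows "(\<ominus> a) \<otimes> v = (- c) \<odot> v"
proof -
  have "(- c) \<odot> v \<oplus> c \<odot> v = \<zero>"
    using assms(2) by (simp add: sm_0_left flip: sm_add_left)
  then show ?thesis using assms by (simp add: l_minus minus_equality)
qed

text \<open>A common eigenvector of the generators is an eigenvector of the whole subalgebra.\<close>

lemma eigenvector_subalg_gen:
  assumes v: "v \<in> carrier A" and eig: "\<And>s. s \<in> S \<Longrightarrow> \<exists>c. s \<otimes> v = c \<odot> v"
    and b: "b \<in> subalg_gen A S"
  shows "\<exists>c. b \<otimes> v = c \<odot> v"
  using b unfolding subalg_gen_def
proof (induction rule: generate_ring.induct)
  case one
  show ?case using v by (intro exI[of _ 1]) (simp add: sm_one)
next
  case (incl b)
  then consider "b \<in> S" | c where "b = c \<odot> \<one>" by blast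
  then show ?case
  proof cases
    case 2
    then have "b \<otimes> v = c \<odot> v" using sm_as_mult[OF v, of c] by simp
    then show ?thesis by blast
  qed (rule eig)
next
  case (a_inv b)
  then show ?case using eigen_minus v subalg_gen_carrier unfolding subalg_gen_def by blast
next
  case (eng_add a b)
  then obtain c d where "a \<otimes> v = c \<odot> v" "b \<otimes> v = d \<odot> v" by blast
  moreover have "a \<in> carrier A" "b \<in> carrier A"
    using eng_add subalg_gen_carrier unfolding subalg_gen_def by blast+
  ultimately have "(a \<oplus> b) \<otimes> v = (c + d) \<odot> v" using v by (simp add: l_distr sm_add_left)
  then show ?case by blast
next
  case (eng_mult a b)
  moreover have "a \<in> carrier A" "b \<in> carrier A"
    using eng_mult subalg_gen_carrier unfolding subalg_gen_def by blast+
  ultimately show ?case using eigen_mult v by blast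
qed

text \<open>
  An eigenvector turns the action of the subalgebra into a character; it is well defined because the
  vector is nonzero.
\<close>

lemma character_of_eigenvector:
  assumes v: "v \<in> carrier A" "v \<noteq> \<zero>" and eig: "\<And>s. s \<in> S \<Longrightarrow> s \<otimes> v = \<mu> s \<odot> v"
  shows "\<exists>\<rho>. alg_character (A\<lparr>carrier := subalg_gen A S\<rparr>) \<rho> \<and> (\<forall>s\<in>S. \<rho> s = \<mu> s)"
proof -
  have "\<forall>b\<in>subalg_gen A S. \<exists>c. b \<otimes> v = c \<odot> v"
    using eigenvector_subalg_gen[OF v(1)] eig by blast
  then obtain \<rho> where \<rho>: "\<And>b. b \<in> subalg_gen A S \<Longrightarrow> b \<otimes> v = \<rho> b \<odot> v" by metis
  have \<rho>I: "\<rho> b = c" if "b \<in> subalg_gen A S" "b \<otimes> v = c \<odot> v" for b c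
    using sm_inject[OF v, of "\<rho> b" c] \<rho>[OF that(1)] that(2) by simp
  note cl = subsetD[OF subalg_gen_carrier]
  have "alg_character (A\<lparr>carrier := subalg_gen A S\<rparr>) \<rho>"
    unfolding alg_character_def
  proof (intro conjI allI ballI ring_hom_memI)
    fix a b assume "a \<in> carrier (A\<lparr>carrier := subalg_gen A S\<rparr>)" "b \<in> carrier (A\<lparr>carrier := subalg_gen A S\<rparr>)"
    then have ab: "a \<in> subalg_gen A S" "b \<in> subalg_gen A S" by simp_all
    have "(a \<otimes> b) \<otimes> v = (\<rho> a * \<rho> b) \<odot> v"
      using eigen_mult[OF cl cl v(1) \<rho> \<rho>] ab by blast
    then show "\<rho> (a \<otimes>\<^bsub>A\<lparr>carrier := subalg_gen A S\<rparr>\<^esub> b) = \<rho> a \<otimes>\<^bsub>ring_of_type_algebra\<^esub> \<rho> b"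
      using \<rho>I[OF subalg_gen_intros(5)[OF ab]] by (simp add: ring_of_type_algebra_def)
    have "(a \<oplus> b) \<otimes> v = (\<rho> a + \<rho> b) \<odot> v"
      using ab cl v(1) \<rho> by (simp add: l_distr sm_add_left)
    then show "\<rho> (a \<oplus>\<^bsub>A\<lparr>carrier := subalg_gen A S\<rparr>\<^esub> b) = \<rho> a \<oplus>\<^bsub>ring_of_type_algebra\<^esub> \<rho> b"
      using \<rho>I[OF subalg_gen_intros(4)[OF ab]] by (simp add: ring_of_type_algebra_def)
  next
    have "\<one> \<otimes> v = 1 \<odot> v" using v by (simp add: sm_one)
    then show "\<rho> \<one>\<^bsub>A\<lparr>carrier := subalg_gen A S\<rparr>\<^esub> = \<one>\<^bsub>ring_of_type_algebra\<^esub>"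
      using \<rho>I[OF subalg_gen_intros(2)] by (simp add: ring_of_type_algebra_def)
  next
    fix c a assume "a \<in> carrier (A\<lparr>carrier := subalg_gen A S\<rparr>)"
    then have a: "a \<in> subalg_gen A S" by simp
    have "(c \<odot> a) \<otimes> v = (c * \<rho> a) \<odot> v"
      using \<rho>[OF a] cl[OF a] v(1) by (simp add: sm_sm flip: sm_mult_left)
    then show "\<rho> (c \<odot>\<^bsub>A\<lparr>carrier := subalg_gen A S\<rparr>\<^esub> a) = c * \<rho> a"
      using \<rho>I[OF subalg_gen_sm[OF a]] by simp
  qed (simp add: ring_of_type_algebra_def)
  moreover have "\<forall>s\<in>S. \<rho> s = \<mu> s" using \<rho>I[OF subalg_gen_intros(1)] eig by blast
  ultimately show ?thesis by blast
qed

context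
  fixes \<rho> assumes \<rho>: "alg_character (A\<lparr>carrier := subalg_gen A S\<rparr>) \<rho>"
begin

lemma character_simps:
  assumes "a \<in> subalg_gen A S" "b \<in> subalg_gen A S"
  shows "\<rho> (a \<oplus> b) = \<rho> a + \<rho> b" "\<rho> (a \<otimes> b) = \<rho> a * \<rho> b" "\<rho> (c \<odot> a) = c * \<rho> a" "\<rho> \<one> = 1"
proof -
  have hom: "\<rho> \<in> ring_hom (A\<lparr>carrier := subalg_gen A S\<rparr>) ring_of_type_algebra"
    using \<rho> by (simp add: alg_character_def)
  show "\<rho> (a \<oplus> b) = \<rho> a + \<rho> b" "\<rho> (a \<otimes> b) = \<rho> a * \<rho> b" "\<rho> \<one> = 1"
    using ring_hom_add[OF hom, of a b] ring_hom_mult[OF hom, of a b] ring_hom_one[OF hom] assms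
    by (simp_all add: ring_of_type_algebra_def)
  show "\<rho> (c \<odot> a) = c * \<rho> a" using \<rho> assms(1) by (simp add: alg_character_def)
qed

lemma character_eigenvector:
  assumes v: "v \<in> carrier A" "v \<noteq> \<zero>" and eig: "\<And>s. s \<in> S \<Longrightarrow> s \<otimes> v = \<rho> s \<odot> v"
    and b: "b \<in> subalg_gen A S"
  shows "b \<otimes> v = \<rho> b \<odot> v"
proof -
  note cl = subsetD[OF subalg_gen_carrier]
  have fold: "a \<in> generate_ring A (S \<union> range (\<lambda>c. c \<odot> \<one>)) \<Longrightarrow> a \<in> subalg_gen A S" for a
    by (simp add: subalg_gen_def)
  show ?thesis
    using b unfolding subalg_gen_def
  proof (induction rule: generate_ring.induct)
    case one
    show ?case using v character_simps(4)[OF subalg_gen_intros(2) subalg_gen_intros(2)] by (simp add: sm_one)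
  next
    case (incl b)
    then consider "b \<in> S" | c where "b = c \<odot> \<one>" by blast
    then show ?case
    proof cases
      case 2
      then show ?thesis
        using v character_simps(3,4)[OF subalg_gen_intros(2) subalg_gen_intros(2)]
        by (simp add: sm_as_mult[of v])
    qed (rule eig)
  next
    case (a_inv b)
    note b = fold[OF a_inv.hyps]
    have "\<rho> (\<ominus> b \<oplus> b) = \<rho> (0 \<odot> \<one>)"
      using cl[OF b] by (simp add: l_neg sm_0_left)
    then have "\<rho> (\<ominus> b) + \<rho> b = 0"
      using character_simps(1)[OF subalg_gen_intros(6)[OF b] b]
        character_simps(3)[OF subalg_gen_intros(2) subalg_gen_intros(2), of 0] by simp
    then have "\<rho> (\<ominus> b) = - \<rho> b" by (simp add: eq_neg_iff_add_eq_0)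
    then show ?case using a_inv.IH eigen_minus[OF cl[OF b] v(1)] by simp
  next
    case (eng_add a b)
    note ab = fold[OF eng_add.hyps(1)] fold[OF eng_add.hyps(2)]
    then show ?case
      using v(1) cl eng_add.IH by (simp add: l_distr sm_add_left character_simps)
  next
    case (eng_mult a b)
    note ab = fold[OF eng_mult.hyps(1)] fold[OF eng_mult.hyps(2)]
    then show ?case
      using eigen_mult[OF cl[OF ab(1)] cl[OF ab(2)] v(1) eng_mult.IH] by (simp add: character_simps)
  qed
qed

text \<open>
  The vector \<open>1 \<otimes> 1\<close> generates the induced module. It is nonzero if the character occurs in the
  regular module, by the balanced map \<open>(a, t) \<mapsto> t a v\<close>.
\<close>

lemma induced_module:
  assumes v: "v \<in> carrier A" "v \<noteq> \<zero>" and eig: "\<And>s. s \<in> S \<Longrightarrow> s \<otimes> v = \<rho> s \<odot> v"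
  defines "T \<equiv> tensor_module A (subalg_gen A S) (character_module \<rho>)"
  shows "left_module A T"
    and "\<exists>w\<in>carrier T. w \<noteq> \<zero>\<^bsub>T\<^esub> \<and> (\<forall>m\<in>carrier T. \<exists>a\<in>carrier A. m = a \<odot>\<^bsub>T\<^esub> w) \<and>
      (\<forall>s\<in>S. s \<odot>\<^bsub>T\<^esub> w = (\<rho> s \<odot> \<one>) \<odot>\<^bsub>T\<^esub> w)"
proof -
  let ?W = "character_module \<rho>"
  have W: "carrier ?W = UNIV" "\<And>s t. s \<oplus>\<^bsub>?W\<^esub> t = s + t" "\<And>b t. b \<odot>\<^bsub>?W\<^esub> t = \<rho> b * t"
    by (simp_all add: character_module_def)
  interpret tensor A "subalg_gen A S" ?W
    by unfold_locales (use subalg_gen_carrier in \<open>auto simp: W\<close>)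
  show "left_module A T" unfolding T_def by (rule tensor_left_module)
  then interpret T: left_module A T .
  define w where "w = tcls (frag_of (\<one>, 1))"
  have fr: "frag_of (a, t) \<in> carrier tfree" if "a \<in> carrier A" for a t
    using that by (simp add: W)
  have w: "w \<in> carrier T" unfolding w_def T_def by (intro tcls_closed fr one_closed)
  have act: "a \<odot>\<^bsub>T\<^esub> w = tcls (frag_of (a, 1))" if "a \<in> carrier A" for a
    unfolding w_def T_def using that fr[OF one_closed, of 1] by (simp add: tcls_smult lact_of del: tfree_simps)
  have bal: "tcls (frag_of (a \<otimes> b, t)) = tcls (frag_of (a, \<rho> b * t))"
    if "a \<in> carrier A" "b \<in> subalg_gen A S" for a b t
  proof -
    have "frag_of (a \<otimes> b, t) - frag_of (a, b \<odot>\<^bsub>?W\<^esub> t) \<in> trel"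
      using that by (intro trelI) (auto simp: tensor_rels_def W)
    then show ?thesis
      using that subalg_gen_carrier by (subst tcls_eq_iff) (auto simp: W(3) intro!: fr simp del: tfree_simps)
  qed
  have gen: "tcls (frag_of (a, t)) = (t \<odot> a) \<odot>\<^bsub>T\<^esub> w" if a: "a \<in> carrier A" for a t
  proof -
    have "tcls (frag_of (a \<otimes> (t \<odot> \<one>), 1)) = tcls (frag_of (a, \<rho> (t \<odot> \<one>) * 1))"
      by (rule bal[OF a subalg_gen_intros(3)])
    then show ?thesis
      using a character_simps(3)[OF subalg_gen_intros(2) subalg_gen_intros(2), of t]
        character_simps(4)[OF subalg_gen_intros(2) subalg_gen_intros(2)]
      by (simp add: act sm_as_mult_right[OF a])
  qed
  have cyc: "\<exists>a\<in>carrier A. tcls t = a \<odot>\<^bsub>T\<^esub> w" if "t \<in> carrier tfree" for t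
    using that
  proof (induction t rule: tfree_induct)
    case zero
    have "\<zero> \<odot>\<^bsub>T\<^esub> w = tcls 0"
      using T.smult_zero_left[OF w] by (simp add: T_def tcls_zero)
    then show ?case by (metis zero_closed)
  next
    case (of a t)
    then show ?case using gen[of a t] by auto
  next
    case (diff s t)
    then obtain a b where ab: "a \<in> carrier A" "b \<in> carrier A" "tcls s = a \<odot>\<^bsub>T\<^esub> w" "tcls t = b \<odot>\<^bsub>T\<^esub> w" by blast
    have "tcls (s - t) \<oplus>\<^bsub>T\<^esub> tcls t = tcls s"
      using diff(1,2) tfree_ops(2)[OF diff(1,2)] by (simp add: T_def tcls_add del: tfree_simps)
    moreover have "(a \<ominus> b) \<odot>\<^bsub>T\<^esub> w \<oplus>\<^bsub>T\<^esub> b \<odot>\<^bsub>T\<^esub> w = a \<odot>\<^bsub>T\<^esub> w"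
      using ab w by (simp add: minus_eq a_assoc l_neg flip: T.smult_l_distr)
    ultimately have "tcls (s - t) \<oplus>\<^bsub>T\<^esub> tcls t = (a \<ominus> b) \<odot>\<^bsub>T\<^esub> w \<oplus>\<^bsub>T\<^esub> tcls t"
      using ab by simp
    then have "tcls (s - t) = (a \<ominus> b) \<odot>\<^bsub>T\<^esub> w"
      using ab w diff(1,2) tfree_ops(2)[OF diff(1,2)] tcls_closed
      by (simp add: T_def[symmetric] T.smult_closed del: tfree_simps)
    then show ?case using ab by blast
  qed
  have "w \<noteq> \<zero>\<^bsub>T\<^esub>"
    unfolding w_def T_def
  proof (rule tensor_nonzero[where M = A and \<beta> = "\<lambda>a t. t \<odot> (a \<otimes> v)"])
    fix a b t assume "a \<in> carrier A" "b \<in> subalg_gen A S"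
    then show "t \<odot> (a \<otimes> b \<otimes> v) = (b \<odot>\<^bsub>?W\<^esub> t) \<odot> (a \<otimes> v)"
      using v(1) character_eigenvector[OF v eig] subsetD[OF subalg_gen_carrier]
      by (simp add: m_assoc W sm_sm mult.commute flip: sm_mult_right)
  qed (use v in \<open>simp_all add: W l_distr sm_add_right sm_add_left sm_one abelian_group_axioms\<close>)
  moreover have "s \<odot>\<^bsub>T\<^esub> w = (\<rho> s \<odot> \<one>) \<odot>\<^bsub>T\<^esub> w" if "s \<in> S" for s
    using bal[OF one_closed subalg_gen_intros(1)[OF that], of 1] gen[OF one_closed, of "\<rho> s"]
      act[of s] that S by auto
  moreover have "\<forall>m\<in>carrier T. \<exists>a\<in>carrier A. m = a \<odot>\<^bsub>T\<^esub> w"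
    using tcls_surj cyc unfolding T_def by metis
  ultimately show "\<exists>w\<in>carrier T. w \<noteq> \<zero>\<^bsub>T\<^esub> \<and> (\<forall>m\<in>carrier T. \<exists>a\<in>carrier A. m = a \<odot>\<^bsub>T\<^esub> w) \<and>
      (\<forall>s\<in>S. s \<odot>\<^bsub>T\<^esub> w = (\<rho> s \<odot> \<one>) \<odot>\<^bsub>T\<^esub> w)"
    using w by blast
qed

end
end
end

section \<open>Fibers of the enveloping algebra\<close>

locale central_character =
  fixes chi :: "'k::alg_closed_field Helem \<Rightarrow> 'k" and p :: nat
  assumes CHAR_p: "CHAR('k) = p" and two_less_p: "p > 2"
    and chi: "alg_character Zalg chi"
begin

lemma alg_center_iff: "rep_env u \<in> alg_center Halg \<longleftrightarrow> (\<forall>v :: 'k env. u * v = v * u)"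
proof -
  have "(\<forall>a\<in>carrier Halg. rep_env u \<otimes>\<^bsub>Halg\<^esub> a = a \<otimes>\<^bsub>Halg\<^esub> rep_env u) \<longleftrightarrow> (\<forall>v. u * v = v * u)"
  proof
    assume *: "\<forall>a\<in>carrier Halg. rep_env u \<otimes>\<^bsub>Halg\<^esub> a = a \<otimes>\<^bsub>Halg\<^esub> rep_env u"
    show "\<forall>v. u * v = v * u"
    proof
      fix v
      show "u * v = v * u"
        using bspec[OF * rep_env[of v]] by (simp add: rep_env_inject[symmetric] rep_env_simps)
    qed
  next
    assume *: "\<forall>v. u * v = v * u"
    show "\<forall>a\<in>carrier Halg. rep_env u \<otimes>\<^bsub>Halg\<^esub> a = a \<otimes>\<^bsub>Halg\<^esub> rep_env u"
    proof
      fix a :: "'k Helem" assume "a \<in> carrier Halg"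
      then have "a = rep_env (abs_env a)" by (simp add: abs_env_inverse)
      then show "rep_env u \<otimes>\<^bsub>Halg\<^esub> a = a \<otimes>\<^bsub>Halg\<^esub> rep_env u"
        using * by (metis rep_env_simps(6))
    qed
  qed
  then show ?thesis using rep_env[of u] by (simp add: alg_center_def)
qed

sublocale sl2V_algebra sc env_e env_f env_h env_x "env_y :: 'k env"
proof (unfold_locales, goal_cases)
  case (15 S)
  show ?case by (rule env_induct[OF 15])
qed (rule sc_add sc_mult sc_one sc_central env_relations)+

lemma chi_central:
  shows "central u \<Longrightarrow> central v \<Longrightarrow> chi (rep_env (u + v)) = chi (rep_env u) + chi (rep_env v)"
    and "central u \<Longrightarrow> central v \<Longrightarrow> chi (rep_env (u * v)) = chi (rep_env u) * chi (rep_env v)"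
    and "chi (rep_env (sc c)) = c"
proof -
  have hom: "chi \<in> ring_hom Zalg ring_of_type_algebra" using chi by (simp add: alg_character_def)
  have mem: "rep_env w \<in> carrier Zalg" if "central w" for w
    using that alg_center_iff[of w] by (simp add: Zalg_def central_def)
  have Z: "monoid.mult Zalg = monoid.mult Halg" "ring.add Zalg = ring.add Halg"
    "monoid.one Zalg = monoid.one Halg" "module.smult Zalg = module.smult Halg"
    by (simp_all add: Zalg_def)
  show "chi (rep_env (u + v)) = chi (rep_env u) + chi (rep_env v)"
    "chi (rep_env (u * v)) = chi (rep_env u) * chi (rep_env v)" if "central u" "central v"
    using ring_hom_add[OF hom mem mem] ring_hom_mult[OF hom mem mem] that
    by (simp_all add: rep_env_simps Z ring_of_type_algebra_def)
  have "chi (c \<odot>\<^bsub>Zalg\<^esub> rep_env 1) = c * chi (rep_env 1)"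
    using chi mem[OF central_1] by (simp only: alg_character_def)
  then show "chi (rep_env (sc c)) = c"
    using ring_hom_one[OF hom] by (simp add: rep_env_simps rep_env_sc Z ring_of_type_algebra_def)
qed

sublocale sl2V_point sc env_e env_f env_h env_x "env_y :: 'k env" p "\<lambda>u. chi (rep_env u)"
  by unfold_locales (simp_all add: CHAR_p two_less_p chi_central central_1)

text \<open>
  Central elements commute with everything, so the ideal defining the fiber is the left ideal
  generated by the kernel of the character. Nakayama's lemma therefore makes the fiber nonzero.
\<close>

lemma fiber_ideal_eq: "fiber_ideal chi = rep_env ` ker_ideal"
proof
  have Z: "z \<in> carrier Zalg \<longleftrightarrow> (\<exists>u. z = rep_env u \<and> central u)" for z :: "'k Helem"
  proof
    assume z: "z \<in> carrier Zalg"
    then have "z = rep_env (abs_env z)" by (simp add: Zalg_def alg_center_def abs_env_inverse)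
    then show "\<exists>u. z = rep_env u \<and> central u"
      using z alg_center_iff[of "abs_env z"] by (auto simp: Zalg_def central_def)
  qed (use alg_center_iff in \<open>auto simp: Zalg_def central_def\<close>)
  show "fiber_ideal chi \<subseteq> rep_env ` ker_ideal"
  proof
    fix a assume "a \<in> fiber_ideal chi"
    then show "a \<in> rep_env ` ker_ideal"
      unfolding fiber_ideal_def
    proof (induction rule: ideal_prod.induct)
      case (prod z b)
      then obtain u where u: "z = rep_env u" "central u" "chi (rep_env u) = 0" by (auto simp: Z)
      have "z \<otimes>\<^bsub>Halg\<^esub> b = rep_env (u * abs_env b)"
        using prod u by (simp add: rep_env_simps abs_env_inverse)
      then show ?case using ker_mult[OF u(2,3)] by blast
    next
      case (sum a b)
      then obtain u v where "a = rep_env u" "b = rep_env v" "u \<in> ker_ideal" "v \<in> ker_ideal" by blast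
      moreover from this have "a \<oplus>\<^bsub>Halg\<^esub> b = rep_env (u + v)" by (simp add: rep_env_simps)
      ultimately show ?case using ker_add by blast
    qed
  qed
  have "rep_env u \<in> fiber_ideal chi" if "u \<in> ker_ideal" for u
    using that unfolding fiber_ideal_def
  proof induction
    case (ker_mult z u)
    then show ?case unfolding rep_env_simps by (intro ideal_prod.prod) (auto simp: Z rep_env)
  next
    case (ker_add u v)
    then show ?case unfolding rep_env_simps by (intro ideal_prod.sum)
  qed
  then show "rep_env ` ker_ideal \<subseteq> fiber_ideal chi" by blast
qed

lemma fiber_alg_ideal: "alg_ideal Halg (fiber_ideal chi)"
proof (intro alg_ideal.intro Halg_assoc_alg idealI)
  show "ring (Halg :: ('k, 'k Helem) module)" by (rule Halg.ring_axioms)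
  show "subgroup (fiber_ideal chi) (add_monoid Halg)"
  proof (rule Halg.add.subgroupI)
    show "fiber_ideal chi \<subseteq> carrier Halg" using rep_env by (auto simp: fiber_ideal_eq)
    show "fiber_ideal chi \<noteq> {}"
      using subspace_0[OF point_ideal_subspace[OF ker_ideal_point_ideal]] by (auto simp: fiber_ideal_eq)
    show "\<ominus>\<^bsub>Halg\<^esub> a \<in> fiber_ideal chi" if "a \<in> fiber_ideal chi" for a
      using that subspace_minus[OF point_ideal_subspace[OF ker_ideal_point_ideal]]
      by (auto simp: fiber_ideal_eq simp flip: rep_env_simps)
    show "a \<oplus>\<^bsub>Halg\<^esub> b \<in> fiber_ideal chi" if "a \<in> fiber_ideal chi" "b \<in> fiber_ideal chi" for a b
      using that subspace_add[OF point_ideal_subspace[OF ker_ideal_point_ideal]]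
      by (auto simp: fiber_ideal_eq simp flip: rep_env_simps)
  qed
  fix a x assume a: "a \<in> fiber_ideal chi" and x: "x \<in> carrier (Halg :: ('k, 'k Helem) module)"
  obtain u where u: "a = rep_env u" "u \<in> ker_ideal" using a by (auto simp: fiber_ideal_eq)
  have x: "x = rep_env (abs_env x)" using x by (simp add: abs_env_inverse)
  have "u * v \<in> ker_ideal" for v
    using u(2) by induction (auto simp: distrib_right mult.assoc intro: ker_ideal.intros)
  then have "rep_env (u * abs_env x) \<in> fiber_ideal chi" by (simp add: fiber_ideal_eq)
  then show "a \<otimes>\<^bsub>Halg\<^esub> x \<in> fiber_ideal chi" by (simp only: rep_env_simps(6) u(1) x[symmetric])
  have "rep_env (abs_env x * u) \<in> fiber_ideal chi"
    using point_ideal_mult[OF ker_ideal_point_ideal u(2)] by (simp add: fiber_ideal_eq)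
  then show "x \<otimes>\<^bsub>Halg\<^esub> a \<in> fiber_ideal chi" by (simp only: rep_env_simps(6) u(1) x[symmetric])
qed

sublocale fiber: alg_ideal Halg "fiber_ideal chi" by (rule fiber_alg_ideal)

sublocale A: assoc_alg "fiber chi"
  unfolding fiber_def by (rule fiber.quot_assoc_alg)

definition cls :: "'k env \<Rightarrow> 'k Helem set" where "cls u = to_fiber chi (rep_env u)"

lemma cls_closed: "cls u \<in> carrier (fiber chi)"
  unfolding cls_def to_fiber_def fiber_def by (rule fiber.cls_closed[OF rep_env])

lemma cls_surj: "C \<in> carrier (fiber chi) \<Longrightarrow> \<exists>u. C = cls u"
  unfolding cls_def to_fiber_def fiber_def
  using fiber.cls_surj by (metis abs_env_inverse)

lemma cls_ops:
  "cls (u + v) = cls u \<oplus>\<^bsub>fiber chi\<^esub> cls v" "cls (u * v) = cls u \<otimes>\<^bsub>fiber chi\<^esub> cls v"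
  "cls 1 = \<one>\<^bsub>fiber chi\<^esub>" "cls 0 = \<zero>\<^bsub>fiber chi\<^esub>" "cls (sc c * u) = c \<odot>\<^bsub>fiber chi\<^esub> cls u"
  unfolding cls_def to_fiber_def fiber_def rep_env_sc_mult
  by (simp_all add: rep_env fiber.cls_add fiber.cls_mult fiber.cls_one fiber.cls_zero fiber.cls_sm rep_env_simps)

lemma cls_sc: "cls (sc c) = c \<odot>\<^bsub>fiber chi\<^esub> \<one>\<^bsub>fiber chi\<^esub>"
  using cls_ops(5)[of c 1] by (simp add: cls_ops(3))

lemma cls_eq_iff: "cls u = cls v \<longleftrightarrow> u - v \<in> ker_ideal"
proof -
  have "cls u = cls v \<longleftrightarrow> rep_env (u - v) \<in> fiber_ideal chi"
    unfolding cls_def to_fiber_def by (simp add: fiber.cls_eq_iff rep_env rep_env_simps)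
  then show ?thesis by (auto simp: fiber_ideal_eq rep_env_inject)
qed

lemma cls_eq_0_iff: "cls u = \<zero>\<^bsub>fiber chi\<^esub> \<longleftrightarrow> u \<in> ker_ideal"
  using cls_eq_iff[of u 0] by (simp add: cls_ops)

lemma cls_gens:
  "cls env_e = to_fiber chi He" "cls env_f = to_fiber chi Hf" "cls env_h = to_fiber chi Hh"
  "cls env_x = to_fiber chi Hx" "cls env_y = to_fiber chi Hy"
  by (simp_all add: cls_def rep_env_gens)

section \<open>Modules over a fiber\<close>

context
  fixes W :: "('k Helem set, 'w) module"
  assumes W: "left_module (fiber chi) W"
begin

interpretation W: left_module "fiber chi" W by (rule W)

abbreviation act :: "'k env \<Rightarrow> 'w \<Rightarrow> 'w" where "act u w \<equiv> cls u \<odot>\<^bsub>W\<^esub> w"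

definition ann :: "'w \<Rightarrow> 'k env set" where "ann w = {u. act u w = \<zero>\<^bsub>W\<^esub>}"

lemma act_closed: "w \<in> carrier W \<Longrightarrow> act u w \<in> carrier W"
  by (rule W.smult_closed[OF cls_closed])

lemma act_add: "w \<in> carrier W \<Longrightarrow> act (u + v) w = act u w \<oplus>\<^bsub>W\<^esub> act v w"
  by (simp add: cls_ops W.smult_l_distr cls_closed)

lemma act_mult: "w \<in> carrier W \<Longrightarrow> act (u * v) w = act u (act v w)"
  by (simp add: cls_ops W.smult_assoc cls_closed)

lemma act_one: "w \<in> carrier W \<Longrightarrow> act 1 w = w"
  by (simp add: cls_ops W.smult_one)

lemma act_0: "w \<in> carrier W \<Longrightarrow> act 0 w = \<zero>\<^bsub>W\<^esub>"
  by (simp add: cls_ops W.smult_zero_left)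

lemma act_zero: "act u \<zero>\<^bsub>W\<^esub> = \<zero>\<^bsub>W\<^esub>"
  by (rule W.smult_zero_right[OF cls_closed])

lemma act_minus: "w \<in> carrier W \<Longrightarrow> act (- u) w = \<ominus>\<^bsub>W\<^esub> act u w"
  using act_add[of w "- u" u] act_0 by (simp add: W.M.minus_equality act_closed)

lemma act_eq_iff: "w \<in> carrier W \<Longrightarrow> act u w = act v w \<longleftrightarrow> u - v \<in> ann w"
proof -
  assume w: "w \<in> carrier W"
  have "act u w = act (u - v) w \<oplus>\<^bsub>W\<^esub> act v w" using act_add[OF w, of "u - v" v] by simp
  then show ?thesis
    using w act_closed by (simp add: ann_def W.M.add.r_cancel_one)
qed

lemma ann_point_ideal:
  assumes w: "w \<in> carrier W" "w \<noteq> \<zero>\<^bsub>W\<^esub>"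
  shows "point_ideal (ann w)"
  unfolding point_ideal_def
proof (intro conjI ballI allI impI)
  fix z assume "central z" "chi (rep_env z) = 0"
  then have "z \<in> ker_ideal" using ker_mult[of z 1] by simp
  then show "z \<in> ann w" using cls_eq_0_iff[of z] W.smult_zero_left[OF w(1)] by (simp add: ann_def)
qed (use w in \<open>auto simp: ann_def act_add act_mult act_zero act_one act_0\<close>)

lemma ann_act: "w \<in> carrier W \<Longrightarrow> ann (act a w) = colon (ann w) a"
  by (simp add: ann_def colon_def act_mult)

lemma submodule_act: "submodule N (fiber chi) W \<Longrightarrow> w \<in> N \<Longrightarrow> act u w \<in> N"
  by (rule submodule.smult_closed[OF _ cls_closed])

lemma fiber_submoduleI:
  assumes "N \<subseteq> carrier W" "N \<noteq> {}" "\<And>v w. v \<in> N \<Longrightarrow> w \<in> N \<Longrightarrow> v \<oplus>\<^bsub>W\<^esub> w \<in> N" "\<And>u w. w \<in> N \<Longrightarrow> act u w \<in> N"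
  shows "submodule N (fiber chi) W"
proof (intro submodule.intro submodule_axioms.intro W.M.add.subgroupI)
  show "\<ominus>\<^bsub>W\<^esub> w \<in> N" if "w \<in> N" for w
    using assms(4)[OF that, of "- 1"] that assms(1) by (auto simp: act_minus act_one)
  show "a \<odot>\<^bsub>W\<^esub> w \<in> N" if "a \<in> carrier (fiber chi)" "w \<in> N" for a w
    using cls_surj[OF that(1)] assms(4)[OF that(2)] by auto
qed (use assms in auto)

lemma act_stable_gens:
  assumes N: "N \<subseteq> carrier W" and add: "\<And>v w. v \<in> N \<Longrightarrow> w \<in> N \<Longrightarrow> v \<oplus>\<^bsub>W\<^esub> w \<in> N"
    and gens: "\<And>a v. a \<in> range sc \<union> {env_e, env_f, env_h, env_x, env_y} \<Longrightarrow> v \<in> N \<Longrightarrow> act a v \<in> N"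
    and v: "v \<in> N"
  shows "act u v \<in> N"
proof -
  have "{u. \<forall>v\<in>N. act u v \<in> N} = UNIV"
  proof (rule gen_induct)
    show "1 \<in> {u. \<forall>v\<in>N. act u v \<in> N}" using N act_one by auto
    show "u + u' \<in> {u. \<forall>v\<in>N. act u v \<in> N}"
      if "u \<in> {u. \<forall>v\<in>N. act u v \<in> N}" "u' \<in> {u. \<forall>v\<in>N. act u v \<in> N}" for u u'
      using that N add by (auto simp: act_add subsetD)
  qed (use N gens in \<open>auto simp: act_mult subsetD\<close>)
  then show ?thesis using v by blast
qed

definition cyclic :: "'w \<Rightarrow> bool" where
  "cyclic w \<longleftrightarrow> w \<in> carrier W \<and> w \<noteq> \<zero>\<^bsub>W\<^esub> \<and> (\<forall>m\<in>carrier W. \<exists>u. m = act u w)"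

lemma irreducible_cyclic:
  assumes irr: "irreducible_module (fiber chi) W" and w: "w \<in> carrier W" "w \<noteq> \<zero>\<^bsub>W\<^esub>"
  shows "cyclic w"
proof -
  have "submodule (range (\<lambda>u. act u w)) (fiber chi) W"
  proof (rule fiber_submoduleI)
    show "v \<oplus>\<^bsub>W\<^esub> v' \<in> range (\<lambda>u. act u w)" if "v \<in> range (\<lambda>u. act u w)" "v' \<in> range (\<lambda>u. act u w)" for v v'
      using that w(1) by (auto simp flip: act_add)
    show "act u v \<in> range (\<lambda>u. act u w)" if "v \<in> range (\<lambda>u. act u w)" for u v
      using that w(1) by (auto simp flip: act_mult)
  qed (use act_closed[OF w(1)] in auto)
  moreover have "w \<in> range (\<lambda>u. act u w)" using act_one[OF w(1)] by (metis rangeI)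
  ultimately have "range (\<lambda>u. act u w) = carrier W"
    using irr w(2) by (auto simp: irreducible_module_def)
  then show ?thesis using w by (auto simp: cyclic_def)
qed

lemma irreducible_nonzero:
  assumes irr: "irreducible_module (fiber chi) W"
  shows "\<exists>w\<in>carrier W. w \<noteq> \<zero>\<^bsub>W\<^esub>"
  using irr W.M.zero_closed by (auto simp: irreducible_module_def)

text \<open>
  By maximality of the annihilator, each nonzero vector of a submodule can be carried back to the
  generator.
\<close>

lemma frame_irreducible:
  assumes w: "cyclic w" and fr: "frame g g' (ann w)"
  shows "irreducible_module (fiber chi) W"
  unfolding irreducible_module_def
proof (intro conjI W allI impI)
  have wc: "w \<in> carrier W" and w0: "w \<noteq> \<zero>\<^bsub>W\<^esub>" and gen: "\<And>m. m \<in> carrier W \<Longrightarrow> \<exists>u. m = act u w"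
    using w by (auto simp: cyclic_def)
  show "carrier W \<noteq> {\<zero>\<^bsub>W\<^esub>}" using wc w0 by auto
  fix N assume N: "submodule N (fiber chi) W"
  then interpret N: submodule N "fiber chi" W .
  have "\<zero>\<^bsub>W\<^esub> \<in> N" using N.one_closed by simp
  moreover have "N = carrier W" if n: "n \<in> N" "n \<noteq> \<zero>\<^bsub>W\<^esub>" for n
  proof -
    have "n \<in> carrier W" using N.subset n(1) by auto
    then obtain u where u: "n = act u w" using gen by blast
    then have "u \<notin> ann w" using n(2) by (simp add: ann_def)
    then obtain a where "a * u - 1 \<in> ann w" using fr by (auto simp: frame_def)
    then have "act (a * u) w = w" using act_eq_iff[OF wc, of "a * u" 1] act_one[OF wc] by simp
    then have "w \<in> N" using submodule_act[OF N n(1), of a] u by (simp add: act_mult wc)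
    then have "carrier W \<subseteq> N" using gen submodule_act[OF N] by blast
    then show ?thesis using N.subset by auto
  qed
  ultimately show "N = {\<zero>\<^bsub>W\<^esub>} \<or> N = carrier W" by blast
qed

lemma underlying_finsum:
  fixes n :: nat
  assumes w: "w \<in> carrier W"
  shows "(\<Oplus>\<^bsub>underlying_space (fiber chi) W\<^esub>i\<in>{..<n}. c i \<odot>\<^bsub>underlying_space (fiber chi) W\<^esub> act (b i) w)
    = act (\<Sum>i<n. sc (c i) * b i) w"
proof -
  have sm: "c \<odot>\<^bsub>underlying_space (fiber chi) W\<^esub> act u w = act (sc c * u) w" for c u
    using w by (simp add: underlying_space_def act_mult flip: cls_sc)
  have "(\<Oplus>\<^bsub>W\<^esub>i\<in>{..<n}. act (b' i) w) = act (\<Sum>i<n. b' i) w" for b'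
  proof (induction n)
    case 0
    then show ?case using w by (simp add: act_0)
  next
    case (Suc n)
    have "(\<Oplus>\<^bsub>W\<^esub>i\<in>insert n {..<n}. act (b' i) w) = act (b' n) w \<oplus>\<^bsub>W\<^esub> (\<Oplus>\<^bsub>W\<^esub>i\<in>{..<n}. act (b' i) w)"
      by (rule W.M.finsum_insert) (use w act_closed in auto)
    then show ?case using Suc w by (simp add: lessThan_Suc act_add add.commute)
  qed
  moreover have "finsum (underlying_space (fiber chi) W) t {..<n} = finsum W t {..<n}" for t :: "nat \<Rightarrow> 'w"
    by (simp add: finsum_def finprod_def underlying_space_def)
  ultimately show ?thesis by (simp add: sm)
qed

text \<open>
  The single index \<open>k < p\<^sup>2\<close> of the basis encodes the exponents \<open>k div p\<close> and \<open>k mod p\<close>.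
\<close>

lemma frame_dimension:
  assumes w: "cyclic w" and fr: "frame g g' (ann w)"
  shows "has_dimension (underlying_space (fiber chi) W) (p\<^sup>2)"
proof -
  have wc: "w \<in> carrier W" and gen: "\<And>m. m \<in> carrier W \<Longrightarrow> \<exists>u. m = act u w"
    using w by (auto simp: cyclic_def)
  define b where "b k = g ^ (k div p) * g' ^ (k mod p)" for k
  have p0: "p > 0" using p_gt_2 by simp
  have sum: "(\<Sum>k<p\<^sup>2. sc (c k) * b k) = (\<Sum>i<p. g ^ i * (\<Sum>j<p. g' ^ j * sc (c (i * p + j))))" for c
  proof -
    have "(\<Sum>k<p\<^sup>2. sc (c k) * b k) = (\<Sum>i<p. \<Sum>k=i*p..<i*p+p. sc (c k) * b k)"
      by (simp add: sum.nat_group power2_eq_square)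
    also have "\<dots> = (\<Sum>i<p. \<Sum>j<p. sc (c (i * p + j)) * b (i * p + j))"
    proof (rule sum.cong[OF refl])
      fix i
      show "(\<Sum>k=i*p..<i*p+p. sc (c k) * b k) = (\<Sum>j<p. sc (c (i * p + j)) * b (i * p + j))"
        using sum.shift_bounds_nat_ivl[of "\<lambda>k. sc (c k) * b k" 0 "i * p" p]
        by (simp add: add.commute lessThan_atLeast0)
    qed
    also have "\<dots> = (\<Sum>i<p. g ^ i * (\<Sum>j<p. g' ^ j * sc (c (i * p + j))))"
      by (intro sum.cong refl) (simp add: b_def sum_distrib_left mult.assoc sc_central)
    finally show ?thesis .
  qed
  show ?thesis
    unfolding has_dimension_def
  proof (intro exI[of _ "\<lambda>k. act (b k) w"] conjI allI impI ballI)
    show "act (b k) w \<in> carrier (underlying_space (fiber chi) W)" for k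
      using act_closed[OF wc] by (simp add: underlying_space_def)
    fix v assume "v \<in> carrier (underlying_space (fiber chi) W)"
    then obtain u where u: "v = act u w" using gen by (auto simp: underlying_space_def)
    obtain c where c: "u - (\<Sum>i<p. g ^ i * (\<Sum>j<p. g' ^ j * sc (c i j))) \<in> ann w"
      using fr unfolding frame_def by blast
    define c' where "c' k = (if k < p\<^sup>2 then c (k div p) (k mod p) else 0)" for k
    have less: "i * p + j < p\<^sup>2" if "i < p" "j < p" for i j
    proof -
      have "i * p + j < Suc i * p" using that by simp
      also have "\<dots> \<le> p * p" using that by (intro mult_right_mono) auto
      finally show ?thesis by (simp add: power2_eq_square)
    qed
    have c'_eq: "c' (i * p + j) = c i j" if "i < p" "j < p" for i j
      using that less[OF that] by (simp add: c'_def)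
    have "u - (\<Sum>k<p\<^sup>2. sc (c' k) * b k) \<in> ann w"
      unfolding sum using c by (simp add: c'_eq)
    then have ex: "v = act (\<Sum>k<p\<^sup>2. sc (c' k) * b k) w" using act_eq_iff[OF wc] u by simp
    show "\<exists>!c. (\<forall>k\<ge>p\<^sup>2. c k = 0) \<and> v = (\<Oplus>\<^bsub>underlying_space (fiber chi) W\<^esub>k\<in>{..<p\<^sup>2}.
        c k \<odot>\<^bsub>underlying_space (fiber chi) W\<^esub> act (b k) w)"
      unfolding underlying_finsum[OF wc]
    proof (rule ex1I[of _ c'])
      show "(\<forall>k\<ge>p\<^sup>2. c' k = 0) \<and> v = act (\<Sum>k<p\<^sup>2. sc (c' k) * b k) w"
        using ex by (simp add: c'_def)
      fix d assume d: "(\<forall>k\<ge>p\<^sup>2. d k = 0) \<and> v = act (\<Sum>k<p\<^sup>2. sc (d k) * b k) w"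
      then have "(\<Sum>k<p\<^sup>2. sc (d k) * b k) - (\<Sum>k<p\<^sup>2. sc (c' k) * b k) \<in> ann w"
        using ex act_eq_iff[OF wc] by metis
      then have "(\<Sum>k<p\<^sup>2. sc (d k - c' k) * b k) \<in> ann w"
        by (simp add: sc_diff left_diff_distrib sum_subtractf)
      then have "(\<Sum>i<p. g ^ i * (\<Sum>j<p. g' ^ j * sc (d (i * p + j) - c' (i * p + j)))) \<in> ann w"
        unfolding sum .
      then have z: "\<forall>i<p. \<forall>j<p. d (i * p + j) - c' (i * p + j) = 0"
        using fr unfolding frame_def by (elim conjE allE[where x = "\<lambda>i j. d (i * p + j) - c' (i * p + j)"]) blast
      show "d = c'"
      proof
        fix k
        show "d k = c' k"
        proof (cases "k < p\<^sup>2")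
          case True
          then have "k div p < p" "k mod p < p"
            using p0 by (simp_all add: power2_eq_square less_mult_imp_div_less)
          then show ?thesis using z by (metis div_mult_mod_eq right_minus_eq)
        qed (use d in \<open>simp add: c'_def\<close>)
      qed
    qed
  qed
qed

end
end

context central_character
begin

section \<open>The irreducible module of a singular vector\<close>

text \<open>If \<open>J\<close> is the annihilator of a vector, \<open>u\<close> multiplies this vector by \<open>c\<close> for each pair in \<open>G\<close>.\<close>

definition eigen :: "('k env \<times> 'k) set \<Rightarrow> 'k env set \<Rightarrow> bool" where
  "eigen G J \<longleftrightarrow> (\<forall>(u, c)\<in>G. u - sc c \<in> J)"

lemma eigen_Int: "eigen G J \<Longrightarrow> eigen G J' \<Longrightarrow> eigen G (J \<inter> J')"
  by (auto simp: eigen_def)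

lemma point_ideal_Int: "point_ideal J \<Longrightarrow> point_ideal J' \<Longrightarrow> point_ideal (J \<inter> J')"
  by (auto simp: point_ideal_def)

text \<open>
  Both modules are the quotient of the algebra by the common annihilator of their generators.
\<close>

lemma same_annihilator_iso:
  assumes W: "left_module (fiber chi) W" and W': "left_module (fiber chi) W'"
    and w: "cyclic W w" and w': "cyclic W' w'" and eq: "ann W w = ann W' w'"
  shows "iso_modules (fiber chi) W W'"
proof -
  have wc: "w \<in> carrier W" and gen: "\<And>m. m \<in> carrier W \<Longrightarrow> \<exists>u. m = act W u w"
    using w by (auto simp: cyclic_def[OF W])
  have wc': "w' \<in> carrier W'" and gen': "\<And>m. m \<in> carrier W' \<Longrightarrow> \<exists>u. m = act W' u w'"
    using w' by (auto simp: cyclic_def[OF W'])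
  define \<phi> where "\<phi> m = act W' (SOME u. m = act W u w) w'" for m
  have \<phi>: "\<phi> (act W u w) = act W' u w'" for u
  proof -
    have "act W u w = act W (SOME v. act W u w = act W v w) w" by (rule someI) simp
    then have "u - (SOME v. act W u w = act W v w) \<in> ann W' w'"
      using act_eq_iff[OF W wc] eq by simp
    then have "act W' u w' = act W' (SOME v. act W u w = act W v w) w'"
      using act_eq_iff[OF W' wc'] by blast
    then show ?thesis by (simp add: \<phi>_def)
  qed
  have "inj_on \<phi> (carrier W)"
  proof (rule inj_onI)
    fix m n assume "m \<in> carrier W" "n \<in> carrier W" and e: "\<phi> m = \<phi> n"
    then obtain u v where "m = act W u w" "n = act W v w" using gen by blast
    then show "m = n" using e \<phi> act_eq_iff[OF W wc] act_eq_iff[OF W' wc'] eq by simp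
  qed
  moreover have "\<phi> ` carrier W = carrier W'"
  proof
    show "\<phi> ` carrier W \<subseteq> carrier W'" using act_closed[OF W' wc'] by (auto simp: \<phi>_def)
    show "carrier W' \<subseteq> \<phi> ` carrier W"
    proof
      fix m assume "m \<in> carrier W'"
      then obtain u where "m = act W' u w'" using gen' by blast
      then show "m \<in> \<phi> ` carrier W" using \<phi>[of u] act_closed[OF W wc, of u] by (metis image_eqI)
    qed
  qed
  moreover have "\<phi> (m \<oplus>\<^bsub>W\<^esub> n) = \<phi> m \<oplus>\<^bsub>W'\<^esub> \<phi> n" if m: "m \<in> carrier W" and n: "n \<in> carrier W" for m n
  proof -
    obtain u v where "m = act W u w" "n = act W v w" using gen[OF m] gen[OF n] by blast
    then show ?thesis using \<phi> act_add[OF W wc] act_add[OF W' wc'] by metis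
  qed
  moreover have "\<phi> (a \<odot>\<^bsub>W\<^esub> m) = a \<odot>\<^bsub>W'\<^esub> \<phi> m" if a: "a \<in> carrier (fiber chi)" and m: "m \<in> carrier W" for a m
  proof -
    obtain u v where "m = act W u w" "a = cls v" using gen[OF m] cls_surj[OF a] by blast
    then show ?thesis using \<phi> act_mult[OF W wc] act_mult[OF W' wc'] by metis
  qed
  ultimately show ?thesis unfolding iso_modules_def bij_betw_def by blast
qed

text \<open>
  If all proper left ideals with the prescribed eigenvalues are frames, there is only one of them,
  and if each module contains a vector with these eigenvalues, there is only one irreducible module.
\<close>

lemma the_irreducible_moduleI:
  fixes M :: "('k Helem set, 'm) module"
  assumes M: "left_module (fiber chi) M" and v: "cyclic M v" and G: "eigen G (ann M v)"
    and fr: "\<And>J. point_ideal J \<Longrightarrow> eigen G J \<Longrightarrow> frame g g' J"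
    and ex: "\<And>J. point_ideal J \<Longrightarrow> \<exists>a. a \<notin> J \<and> eigen G (colon J a)"
  shows "the_irreducible_module TYPE('w) (fiber chi) (p\<^sup>2) M"
  unfolding the_irreducible_module_def
proof (intro conjI allI impI)
  have vc: "v \<in> carrier M" "v \<noteq> \<zero>\<^bsub>M\<^esub>" using v by (auto simp: cyclic_def[OF M])
  have Jv: "point_ideal (ann M v)" by (rule ann_point_ideal[OF M vc])
  note frv = fr[OF Jv G]
  show "irreducible_module (fiber chi) M" by (rule frame_irreducible[OF M v frv])
  show "has_dimension (underlying_space (fiber chi) M) (p\<^sup>2)" by (rule frame_dimension[OF M v frv])
  fix W :: "('k Helem set, 'w) module" assume irr: "irreducible_module (fiber chi) W"
  then have W: "left_module (fiber chi) W" by (simp add: irreducible_module_def)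
  obtain w where w: "w \<in> carrier W" "w \<noteq> \<zero>\<^bsub>W\<^esub>" using irreducible_nonzero[OF W irr] by blast
  obtain a where a: "a \<notin> ann W w" "eigen G (colon (ann W w) a)"
    using ex[OF ann_point_ideal[OF W w]] by blast
  define w' where "w' = act W a w"
  have w': "w' \<in> carrier W" "w' \<noteq> \<zero>\<^bsub>W\<^esub>"
    unfolding w'_def using act_closed[OF W w(1)] a(1) by (auto simp: ann_def[OF W])
  have G': "eigen G (ann W w')" using a(2) by (simp add: w'_def ann_act[OF W w(1)])
  have Jw: "point_ideal (ann W w')" by (rule ann_point_ideal[OF W w'])
  have "frame g g' (ann W w' \<inter> ann M v)"
    by (intro fr point_ideal_Int eigen_Int Jw Jv G G')
  then have "ann W w' = ann W w' \<inter> ann M v" "ann M v = ann W w' \<inter> ann M v"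
    using frame_unique[OF fr[OF Jw G']] frame_unique[OF frv] by blast+
  then have "ann W w' = ann M v" by blast
  then show "iso_modules (fiber chi) W M"
    by (rule same_annihilator_iso[OF W M irreducible_cyclic[OF W irr w'] v])
qed

text \<open>
  The eigenvalues define a character of the subalgebra generated by the elements in question: they
  occur in the regular module, as the kernel of the central character generates a proper left ideal.
\<close>

context
  fixes G :: "('k env \<times> 'k) set"
  assumes ex: "\<And>J. point_ideal J \<Longrightarrow> \<exists>a. a \<notin> J \<and> eigen G (colon J a)"
begin

lemma regular_eigenvector:
  obtains v where "v \<in> carrier (fiber chi)" "v \<noteq> \<zero>\<^bsub>fiber chi\<^esub>"
    "\<And>u c. (u, c) \<in> G \<Longrightarrow> cls u \<otimes>\<^bsub>fiber chi\<^esub> v = c \<odot>\<^bsub>fiber chi\<^esub> v"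
proof -
  obtain a where a: "a \<notin> ker_ideal" "eigen G (colon ker_ideal a)" using ex[OF ker_ideal_point_ideal] by blast
  show thesis
  proof (rule that[of "cls a"])
    show "cls a \<noteq> \<zero>\<^bsub>fiber chi\<^esub>" using a(1) by (simp add: cls_eq_0_iff)
    fix u c assume "(u, c) \<in> G"
    then have "(u - sc c) * a \<in> ker_ideal" using a(2) by (auto simp: eigen_def colon_def)
    then have "cls (u * a) = cls (sc c * a)" by (simp add: cls_eq_iff left_diff_distrib)
    then show "cls u \<otimes>\<^bsub>fiber chi\<^esub> cls a = c \<odot>\<^bsub>fiber chi\<^esub> cls a"
      by (simp only: cls_ops(2)[of u] cls_ops(5))
  qed (rule cls_closed)
qed

abbreviation "S \<equiv> cls ` fst ` G"

lemma S_carrier: "S \<subseteq> carrier (fiber chi)"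
  using cls_closed by blast

lemma eigen_character_exists:
  "\<exists>\<rho>. alg_character ((fiber chi)\<lparr>carrier := subalg_gen (fiber chi) S\<rparr>) \<rho> \<and> (\<forall>(u, c)\<in>G. \<rho> (cls u) = c)"
proof -
  obtain v where v: "v \<in> carrier (fiber chi)" "v \<noteq> \<zero>\<^bsub>fiber chi\<^esub>"
    and eig: "\<And>u c. (u, c) \<in> G \<Longrightarrow> cls u \<otimes>\<^bsub>fiber chi\<^esub> v = c \<odot>\<^bsub>fiber chi\<^esub> v"
    using regular_eigenvector by blast
  define \<mu> where "\<mu> s = (SOME c. s \<otimes>\<^bsub>fiber chi\<^esub> v = c \<odot>\<^bsub>fiber chi\<^esub> v)" for s
  have \<mu>: "s \<otimes>\<^bsub>fiber chi\<^esub> v = \<mu> s \<odot>\<^bsub>fiber chi\<^esub> v" if "s \<in> S" for s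
    unfolding \<mu>_def by (rule someI_ex) (use that eig in force)
  have "\<mu> (cls u) = c" if "(u, c) \<in> G" for u c
  proof (rule A.sm_inject[OF S_carrier v])
    show "\<mu> (cls u) \<odot>\<^bsub>fiber chi\<^esub> v = c \<odot>\<^bsub>fiber chi\<^esub> v"
      using eig[OF that] \<mu>[of "cls u"] that by force
  qed
  moreover obtain \<rho> where "alg_character ((fiber chi)\<lparr>carrier := subalg_gen (fiber chi) S\<rparr>) \<rho>" "\<forall>s\<in>S. \<rho> s = \<mu> s"
    using A.character_of_eigenvector[OF S_carrier v \<mu>] by blast
  ultimately show ?thesis by (intro exI[of _ \<rho>]) force
qed

lemma the_irreducible_induced:
  assumes \<rho>: "alg_character ((fiber chi)\<lparr>carrier := subalg_gen (fiber chi) S\<rparr>) \<rho>"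
    and \<rho>G: "\<forall>(u, c)\<in>G. \<rho> (cls u) = c"
    and fr: "\<And>J. point_ideal J \<Longrightarrow> eigen G J \<Longrightarrow> frame g g' J"
  shows "the_irreducible_module TYPE('w) (fiber chi) (p\<^sup>2)
    (tensor_module (fiber chi) (subalg_gen (fiber chi) S) (character_module \<rho>))"
proof -
  let ?T = "tensor_module (fiber chi) (subalg_gen (fiber chi) S) (character_module \<rho>)"
  obtain v where v: "v \<in> carrier (fiber chi)" "v \<noteq> \<zero>\<^bsub>fiber chi\<^esub>"
    and eig: "\<And>u c. (u, c) \<in> G \<Longrightarrow> cls u \<otimes>\<^bsub>fiber chi\<^esub> v = c \<odot>\<^bsub>fiber chi\<^esub> v"
    using regular_eigenvector by blast
  have eig': "s \<otimes>\<^bsub>fiber chi\<^esub> v = \<rho> s \<odot>\<^bsub>fiber chi\<^esub> v" if "s \<in> S" for s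
    using that eig \<rho>G by force
  note T = A.induced_module(1)[OF S_carrier \<rho> v eig']
  obtain w where w: "w \<in> carrier ?T" "w \<noteq> \<zero>\<^bsub>?T\<^esub>"
    and gen: "\<forall>m\<in>carrier ?T. \<exists>a\<in>carrier (fiber chi). m = a \<odot>\<^bsub>?T\<^esub> w"
    and act: "\<forall>s\<in>S. s \<odot>\<^bsub>?T\<^esub> w = (\<rho> s \<odot>\<^bsub>fiber chi\<^esub> \<one>\<^bsub>fiber chi\<^esub>) \<odot>\<^bsub>?T\<^esub> w"
    using A.induced_module(2)[OF S_carrier \<rho> v eig'] by blast
  show ?thesis
  proof (rule the_irreducible_moduleI[OF T _ _ fr ex])
    have "\<exists>u. m = act ?T u w" if m: "m \<in> carrier ?T" for m
    proof -
      obtain a where a: "a \<in> carrier (fiber chi)" "m = a \<odot>\<^bsub>?T\<^esub> w" using bspec[OF gen m] by blast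
      obtain u where "a = cls u" using cls_surj[OF a(1)] by blast
      with a(2) show ?thesis by blast
    qed
    then show "cyclic ?T w" using w by (simp add: cyclic_def[OF T])
    show "eigen G (ann ?T w)"
      unfolding eigen_def
    proof clarify
      fix u c assume uc: "(u, c) \<in> G"
      then have "act ?T u w = act ?T (sc c) w" using act \<rho>G by (force simp: cls_sc)
      then show "u - sc c \<in> ann ?T w" using act_eq_iff[OF T w(1)] by simp
    qed
  qed
qed

end

section \<open>Modules at nilpotent points\<close>

text \<open>
  The subspace killed by \<open>x\<close> and \<open>y\<close> is a submodule, and it is nonzero if \<open>x\<close> and \<open>y\<close> are nilpotent.
\<close>

lemma irreducible_V_trivial:
  assumes irr: "irreducible_module (fiber chi) W"
    and x: "chi (rep_env (env_x ^ p)) = 0" and y: "chi (rep_env (env_y ^ p)) = 0"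
    and w: "w \<in> carrier W"
  shows "act W env_x w = \<zero>\<^bsub>W\<^esub> \<and> act W env_y w = \<zero>\<^bsub>W\<^esub>"
proof -
  have W: "left_module (fiber chi) W" using irr by (simp add: irreducible_module_def)
  interpret W: left_module "fiber chi" W by (rule W)
  define N where "N = {w \<in> carrier W. act W env_x w = \<zero>\<^bsub>W\<^esub> \<and> act W env_y w = \<zero>\<^bsub>W\<^esub>}"
  obtain w0 where w0: "w0 \<in> carrier W" "w0 \<noteq> \<zero>\<^bsub>W\<^esub>" using irreducible_nonzero[OF W irr] by blast
  obtain a where a: "a \<notin> ann W w0" "env_x \<in> colon (ann W w0) a" "env_y \<in> colon (ann W w0) a"
    using zero_eigenvector[OF ann_point_ideal[OF W w0] xy central_x_p x central_y_p y] by blast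
  then have "act W a w0 \<in> N" "act W a w0 \<noteq> \<zero>\<^bsub>W\<^esub>"
    using act_closed[OF W w0(1)] by (auto simp: N_def ann_def[OF W] colon_def act_mult[OF W w0(1)])
  moreover have "submodule N (fiber chi) W"
  proof (rule fiber_submoduleI[OF W])
    show "N \<noteq> {}" using calculation by blast
    show N_add: "v \<oplus>\<^bsub>W\<^esub> v' \<in> N" if "v \<in> N" "v' \<in> N" for v v'
      using that by (auto simp: N_def W.smult_r_distr[OF cls_closed])
    have N: "v \<in> carrier W" "act W env_x v = \<zero>\<^bsub>W\<^esub>" "act W env_y v = \<zero>\<^bsub>W\<^esub>" if "v \<in> N" for v
      using that by (auto simp: N_def)
    \<comment> \<open>An element preserves the common kernel of \<open>x\<close> and \<open>y\<close> if these can be moved to its right.\<close>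
    have NI: "act W u v \<in> N" if "v \<in> N" "env_x * u = u' * env_x + u'' * env_y"
        "env_y * u = w' * env_x + w'' * env_y" for u v u' u'' w' w''
    proof -
      note v = N[OF that(1)]
      have "act W (a * env_x + b * env_y) v = \<zero>\<^bsub>W\<^esub>" for a b
        using v by (simp add: act_add[OF W] act_mult[OF W] act_zero[OF W])
      then have "act W (env_x * u) v = \<zero>\<^bsub>W\<^esub>" "act W (env_y * u) v = \<zero>\<^bsub>W\<^esub>"
        unfolding that(2,3) by blast+
      then show ?thesis using v(1) by (simp add: N_def act_closed[OF W] act_mult[OF W])
    qed
    have gens: "act W a v \<in> N" if v: "v \<in> N" and a: "a \<in> range sc \<union> {env_e, env_f, env_h, env_x, env_y}" for a v
    proof -
      have "act W (sc c) v \<in> N" for c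
        by (rule NI[OF v, of "sc c" "sc c" 0 0 "sc c"]) (simp_all add: sc_central[of c])
      moreover have "act W env_e v \<in> N"
        by (rule NI[OF v, of env_e env_e 0 "- 1" env_e]) (simp_all add: ex ey)
      moreover have "act W env_f v \<in> N"
        by (rule NI[OF v, of env_f env_f "- 1" 0 env_f]) (simp_all add: fx fy)
      moreover have "act W env_h v \<in> N"
        by (rule NI[OF v, of env_h "env_h - 1" 0 0 "env_h + 1"]) (simp_all add: hx hy algebra_simps)
      moreover have "act W env_x v \<in> N"
        by (rule NI[OF v, of env_x env_x 0 env_y 0]) (simp_all add: xy)
      moreover have "act W env_y v \<in> N"
        by (rule NI[OF v, of env_y 0 env_x 0 env_y]) (simp_all add: xy)
      ultimately show ?thesis using a by blast
    qed
    show "act W u v \<in> N" if "v \<in> N" for u v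
      by (rule act_stable_gens[OF W _ N_add gens that]) (use N(1) in auto)
  qed (auto simp: N_def)
  ultimately have "N = carrier W" using irr by (auto simp: irreducible_module_def)
  then show ?thesis using w by (auto simp: N_def)
qed

lemma cls_lin: "A \<in> sl2 \<Longrightarrow> cls (lin (A, 0)) = to_fiber chi (Hincl (A, 0))"
  by (simp add: cls_def rep_env_lin sl2V_def)

lemma underlying_module:
  assumes W: "left_module (fiber chi) W"
  shows "module ring_of_type_algebra (underlying_space (fiber chi) W)"
proof -
  interpret W: left_module "fiber chi" W by (rule W)
  let ?V = "underlying_space (fiber chi) W"
  have V: "carrier ?V = carrier W" "\<And>c w. c \<odot>\<^bsub>?V\<^esub> w = act W (sc c) w" "\<And>v w. v \<oplus>\<^bsub>?V\<^esub> w = v \<oplus>\<^bsub>W\<^esub> w"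
    "\<zero>\<^bsub>?V\<^esub> = \<zero>\<^bsub>W\<^esub>"
    by (simp_all add: underlying_space_def cls_sc)
  show ?thesis
  proof (rule moduleI)
    show "cring (ring_of_type_algebra :: 'k ring)" by (rule cring_from_type_algebra)
    show "abelian_group ?V"
      by (rule abelian_groupI)
        (auto simp: V W.M.a_ac intro: W.M.add.l_inv_ex)
  qed (use act_closed[OF W] act_add[OF W] act_mult[OF W] act_one[OF W] in
      \<open>auto simp: V ring_of_type_algebra_def sc_add sc_mult sc_one W.smult_r_distr cls_closed\<close>)
qed

text \<open>
  A subspace stable under \<open>sl\<^sub>2\<close> is stable under the whole algebra, since \<open>x\<close> and \<open>y\<close> act by zero.
\<close>

lemma irreducible_sl2:
  assumes irr: "irreducible_module (fiber chi) W"
    and x: "chi (rep_env (env_x ^ p)) = 0" and y: "chi (rep_env (env_y ^ p)) = 0"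
  shows "irreducible_lie_module sl2 mat_scale mat_bracket (underlying_space (fiber chi) W)
    (\<lambda>A w. to_fiber chi (Hincl (A, 0)) \<odot>\<^bsub>W\<^esub> w)"
proof -
  have W: "left_module (fiber chi) W" using irr by (simp add: irreducible_module_def)
  interpret W: left_module "fiber chi" W by (rule W)
  let ?V = "underlying_space (fiber chi) W"
  have V: "carrier ?V = carrier W" "\<And>c w. c \<odot>\<^bsub>?V\<^esub> w = act W (sc c) w" "\<And>v w. v \<oplus>\<^bsub>?V\<^esub> w = v \<oplus>\<^bsub>W\<^esub> w"
    "\<zero>\<^bsub>?V\<^esub> = \<zero>\<^bsub>W\<^esub>"
    by (simp_all add: underlying_space_def cls_sc)
  have neg: "\<ominus>\<^bsub>?V\<^esub> v = \<ominus>\<^bsub>W\<^esub> v" for v by (simp add: a_inv_def m_inv_def V)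
  have sl2: "(A, 0) \<in> sl2V" if "A \<in> sl2" for A :: "'k ^ 2 ^ 2" using that by (simp add: sl2V_def)
  have lin_ops: "lin (A + B, 0) = lin (A, 0) + lin (B, 0)" "lin (mat_scale c A, 0) = sc c * lin (A, 0)"
    "lin (mat_bracket A B, 0) = lin (A, 0) * lin (B, 0) - lin (B, 0) * lin (A, 0)"
    if "A \<in> sl2" "B \<in> sl2" for A B :: "'k ^ 2 ^ 2" and c
    using lin_add[OF sl2 sl2, OF that] lin_scale[OF sl2[OF that(1)], of c] lin_bracket[OF sl2 sl2, OF that]
    by (simp_all add: sl2V_scale_def sl2V_bracket_def)
  have closed: "A + B \<in> sl2" "mat_scale c A \<in> sl2" "mat_bracket A B \<in> sl2"
    if "A \<in> sl2" "B \<in> sl2" for A B :: "'k ^ 2 ^ 2" and c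
    using sl2V_add[OF sl2 sl2, OF that] sl2V_scale_closed[OF sl2[OF that(1)], of c] sl2V_bracket_closed[OF sl2 sl2, OF that]
    by (simp_all add: sl2V_scale_def sl2V_bracket_def sl2V_def)
  note cl = cls_lin[symmetric]
  have "lie_module sl2 mat_scale mat_bracket ?V (\<lambda>A w. to_fiber chi (Hincl (A, 0)) \<odot>\<^bsub>W\<^esub> w)"
    unfolding lie_module_def
  proof (intro conjI allI ballI underlying_module[OF W])
    fix A :: "'k ^ 2 ^ 2" and v assume A: "A \<in> sl2" and v: "v \<in> carrier ?V"
    have vW: "v \<in> carrier W" using v by (simp add: V)
    show "to_fiber chi (Hincl (A, 0)) \<odot>\<^bsub>W\<^esub> v \<in> carrier ?V"
      using A vW by (simp add: cl V act_closed[OF W])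
    show "to_fiber chi (Hincl (A, 0)) \<odot>\<^bsub>W\<^esub> (v \<oplus>\<^bsub>?V\<^esub> w)
        = to_fiber chi (Hincl (A, 0)) \<odot>\<^bsub>W\<^esub> v \<oplus>\<^bsub>?V\<^esub> to_fiber chi (Hincl (A, 0)) \<odot>\<^bsub>W\<^esub> w"
      if "w \<in> carrier ?V" for w
      using A vW that by (simp add: cl V W.smult_r_distr cls_closed)
    show "to_fiber chi (Hincl (A, 0)) \<odot>\<^bsub>W\<^esub> (c \<odot>\<^bsub>?V\<^esub> v) = c \<odot>\<^bsub>?V\<^esub> (to_fiber chi (Hincl (A, 0)) \<odot>\<^bsub>W\<^esub> v)" for c
      using A vW sc_central[of c "lin (A, 0)"] by (simp add: cl V flip: act_mult[OF W])
    show "to_fiber chi (Hincl (mat_scale c A, 0)) \<odot>\<^bsub>W\<^esub> v = c \<odot>\<^bsub>?V\<^esub> (to_fiber chi (Hincl (A, 0)) \<odot>\<^bsub>W\<^esub> v)" for c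
      using A vW closed(2)[OF A A] by (simp add: cl V lin_ops flip: act_mult[OF W])
    fix B :: "'k ^ 2 ^ 2" assume B: "B \<in> sl2"
    show "to_fiber chi (Hincl (A + B, 0)) \<odot>\<^bsub>W\<^esub> v
        = to_fiber chi (Hincl (A, 0)) \<odot>\<^bsub>W\<^esub> v \<oplus>\<^bsub>?V\<^esub> to_fiber chi (Hincl (B, 0)) \<odot>\<^bsub>W\<^esub> v"
      using A B vW closed(1)[OF A B] by (simp add: cl V lin_ops act_add[OF W])
    have "act W (u - u') v = act W u v \<ominus>\<^bsub>W\<^esub> act W u' v" for u u'
      using act_add[OF W vW, of u "- u'"] act_minus[OF W vW, of u'] by (simp add: W.M.minus_eq)
    then show "to_fiber chi (Hincl (mat_bracket A B, 0)) \<odot>\<^bsub>W\<^esub> v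
        = to_fiber chi (Hincl (A, 0)) \<odot>\<^bsub>W\<^esub> (to_fiber chi (Hincl (B, 0)) \<odot>\<^bsub>W\<^esub> v)
          \<ominus>\<^bsub>?V\<^esub> to_fiber chi (Hincl (B, 0)) \<odot>\<^bsub>W\<^esub> (to_fiber chi (Hincl (A, 0)) \<odot>\<^bsub>W\<^esub> v)"
      using A B vW closed(3)[OF A B] by (simp add: cl V neg lin_ops a_minus_def act_mult[OF W])
  qed
  moreover have "N = {\<zero>\<^bsub>?V\<^esub>} \<or> N = carrier ?V"
    if N: "submodule N ring_of_type_algebra ?V"
      and st: "\<forall>A\<in>sl2. \<forall>v\<in>N. to_fiber chi (Hincl (A, 0)) \<odot>\<^bsub>W\<^esub> v \<in> N" for N
  proof -
    interpret N: submodule N ring_of_type_algebra ?V by (rule N)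
    have NW: "N \<subseteq> carrier W" using N.subset by (simp add: V)
    have N0: "\<zero>\<^bsub>W\<^esub> \<in> N" using N.one_closed by (simp add: V)
    have add: "v \<oplus>\<^bsub>W\<^esub> w \<in> N" if "v \<in> N" "w \<in> N" for v w using N.m_closed[OF that] by (simp add: V)
    have sm: "act W (sc c) v \<in> N" if "v \<in> N" for c v
      using N.smult_closed[of c v] that by (simp add: V ring_of_type_algebra_def)
    have gens: "act W (lin (A, 0)) v \<in> N" if "A \<in> sl2" "v \<in> N" for A v
      using st that by (simp add: cl)
    have mats: "mat_e \<in> sl2" "mat_f \<in> sl2" "mat_h \<in> sl2"
      using sl2V_gens(1-3) by (simp_all add: sl2V_def)
    have triv: "act W env_x v \<in> N" "act W env_y v \<in> N" if "v \<in> N" for v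
      using irreducible_V_trivial[OF irr x y subsetD[OF NW that]] N0 by simp_all
    have "act W a v \<in> N" if "a \<in> range sc \<union> {env_e, env_f, env_h, env_x, env_y}" "v \<in> N" for a v
      using that(1) sm[OF that(2)] triv[OF that(2)] gens[OF mats(1) that(2)] gens[OF mats(2) that(2)]
        gens[OF mats(3) that(2)] unfolding env_e_def env_f_def env_h_def by blast
    then have "act W u v \<in> N" if "v \<in> N" for u v
      using act_stable_gens[OF W NW add _ that] by blast
    then have "submodule N (fiber chi) W"
      using N0 by (intro fiber_submoduleI[OF W NW _ add]) auto
    then show ?thesis using irr by (auto simp: irreducible_module_def V)
  qed
  moreover have "carrier ?V \<noteq> {\<zero>\<^bsub>?V\<^esub>}" using irr by (simp add: V irreducible_module_def)
  ultimately show ?thesis unfolding irreducible_lie_module_def by blast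
qed

end

section \<open>The irreducible modules at the other points\<close>

context central_character
begin

lemma chi_powers:
  "chi (He [^]\<^bsub>Halg\<^esub> p) = chi (rep_env (env_e ^ p))" "chi (Hf [^]\<^bsub>Halg\<^esub> p) = chi (rep_env (env_f ^ p))"
  "chi (Hx [^]\<^bsub>Halg\<^esub> p) = chi (rep_env (env_x ^ p))" "chi (Hy [^]\<^bsub>Halg\<^esub> p) = chi (rep_env (env_y ^ p))"
  "chi (Hh [^]\<^bsub>Halg\<^esub> p \<ominus>\<^bsub>Halg\<^esub> Hh) = chi (rep_env (env_h ^ p - env_h))"
  by (simp_all add: rep_env_minus_power rep_env_power rep_env_gens)

lemma eigen_pair: "eigen {(u, c), (v, d)} J \<longleftrightarrow> u - sc c \<in> J \<and> v - sc d \<in> J"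
  by (simp add: eigen_def)

lemma e_zero_power: "chi (rep_env (env_e ^ p)) = 0 \<Longrightarrow> (0 :: 'k) ^ p = chi (rep_env (env_e ^ p))"
  using p_gt_2 by simp

text \<open>
  The common kernel of \<open>e\<close> and \<open>x - a\<close> gives a model of the irreducible module at every point with
  \<open>e\<^sup>p\<close> zero and \<open>x\<^sup>p\<close> nonzero, induced from the subalgebra generated by \<open>e\<close> and \<open>x\<close>.
\<close>

lemma x_invertible_irreducible:
  assumes e: "chi (rep_env (env_e ^ p)) = 0" and x: "chi (rep_env (env_x ^ p)) \<noteq> 0"
  shows "\<exists>M :: ('k Helem set, ('k Helem set \<times> 'k \<Rightarrow>\<^sub>0 int) set) module.
    the_irreducible_module TYPE('w) (fiber chi) (p\<^sup>2) M"
proof -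
  obtain a where a: "a ^ p = chi (rep_env (env_x ^ p))" using p_root_exists by blast
  let ?G = "{(env_e, 0), (env_x, a)}"
  have vector: "\<exists>b. b \<notin> J \<and> eigen ?G (colon J b)" if "point_ideal J" for J
    unfolding eigen_pair
    by (rule common_eigenvector[OF that ex central_e_p e_zero_power[OF e] central_x_p a])
  have frames: "frame env_h env_y J" if "point_ideal J" "eigen ?G J" for J
    using frame_x_invertible[OF that(1) _ _ x] that(2) by (auto simp: eigen_pair sc_0)
  obtain \<rho> where "alg_character ((fiber chi)\<lparr>carrier := subalg_gen (fiber chi) (cls ` fst ` ?G)\<rparr>) \<rho>"
      "\<forall>(u, c)\<in>?G. \<rho> (cls u) = c"
    using eigen_character_exists[OF vector] by blast
  from the_irreducible_induced[OF vector this frames] show ?thesis by blast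
qed

lemma N_vector:
  assumes "b ^ p = chi (rep_env (env_f ^ p))" "a ^ p = chi (rep_env (env_y ^ p))" "point_ideal J"
  shows "\<exists>c. c \<notin> J \<and> eigen {(env_f, b), (env_y, a)} (colon J c)"
  unfolding eigen_pair
  by (rule common_eigenvector[OF assms(3) fy central_f_p assms(1) central_y_p assms(2)])

lemma Nsub_eq: "Nsub chi = subalg_gen (fiber chi) (cls ` fst ` {(env_f, b), (env_y, a)})"
  by (simp add: Nsub_def cls_gens)

lemma Nchar_iff:
  "Nchar p chi \<rho> \<longleftrightarrow> alg_character ((fiber chi)\<lparr>carrier := Nsub chi\<rparr>) \<rho> \<and>
     \<rho> (cls env_f) ^ p = chi (rep_env (env_f ^ p)) \<and> \<rho> (cls env_y) ^ p = chi (rep_env (env_y ^ p))"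
  by (simp add: Nchar_def cls_gens chi_powers)

lemma Nchar_exists: "\<exists>\<rho>. Nchar p chi \<rho>"
proof -
  obtain a b where ab: "b ^ p = chi (rep_env (env_f ^ p))" "a ^ p = chi (rep_env (env_y ^ p))"
    using p_root_exists by metis
  obtain \<rho> where "alg_character ((fiber chi)\<lparr>carrier := Nsub chi\<rparr>) \<rho>"
      "\<forall>(u, c)\<in>{(env_f, b), (env_y, a)}. \<rho> (cls u) = c"
    using eigen_character_exists[OF N_vector[OF ab]] unfolding Nsub_eq[of b a] by blast
  then show ?thesis using ab by (auto simp: Nchar_iff)
qed

text \<open>
  If \<open>y\<^sup>p\<close> does not vanish, \<open>y\<close> plays the part that \<open>x\<close> plays above. If it does, \<open>f\<^sup>p\<close>
  does not, so \<open>f\<close> has a nonzero eigenvalue and \<open>x\<close> acts on the generator by a scalar.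
\<close>

lemma Ninduced_irreducible:
  assumes x: "chi (rep_env (env_x ^ p)) \<noteq> 0"
    and fy: "chi (rep_env (env_f ^ p)) \<noteq> 0 \<or> chi (rep_env (env_y ^ p)) \<noteq> 0"
    and \<rho>: "Nchar p chi \<rho>"
  shows "the_irreducible_module TYPE('w) (fiber chi) (p\<^sup>2) (Ninduced chi \<rho>)"
proof -
  define b a where "b = \<rho> (cls env_f)" and "a = \<rho> (cls env_y)"
  have ab: "b ^ p = chi (rep_env (env_f ^ p))" "a ^ p = chi (rep_env (env_y ^ p))"
    using \<rho> by (simp_all add: Nchar_iff a_def b_def)
  have char: "alg_character ((fiber chi)\<lparr>carrier := Nsub chi\<rparr>) \<rho>"
    "\<forall>(u, c)\<in>{(env_f, b), (env_y, a)}. \<rho> (cls u) = c"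
    using \<rho> by (simp_all add: Nchar_iff a_def b_def)
  note induced = the_irreducible_induced[OF N_vector[OF ab] char(1)[unfolded Nsub_eq[of b a]] char(2),
      folded Nsub_eq Ninduced_def]
  show ?thesis
  proof (cases "chi (rep_env (env_y ^ p)) = 0")
    case False
    show ?thesis
    proof (rule induced)
      show "frame env_h env_x J" if "point_ideal J" "eigen {(env_f, b), (env_y, a)} J" for J
        using frame_y_invertible[OF that(1) _ _ False] that(2) by (auto simp: eigen_pair)
    qed
  next
    case True
    then have "a = 0" using ab(2) by simp
    moreover have "b \<noteq> 0"
    proof
      assume "b = 0"
      then have "chi (rep_env (env_f ^ p)) = 0" using ab(1) p_gt_2 by (simp add: zero_power)
      then show False using fy True by simp
    qed
    ultimately show ?thesis
      using frame_f_invertible[OF _ _ _ _ x] by (intro induced[of env_e env_h]) (auto simp: eigen_pair sc_0)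
  qed
qed

lemma B_vector:
  assumes "chi (rep_env (env_e ^ p)) = 0" "chi (rep_env (env_x ^ p)) = 0" "chi (rep_env (env_y ^ p)) \<noteq> 0"
    "c ^ p - c = chi (rep_env (env_h ^ p - env_h))" "point_ideal J"
  shows "\<exists>a. a \<notin> J \<and> eigen {(env_e, 0), (env_x, 0), (env_h, c)} (colon J a)"
  using highest_weight_vector[OF assms(5,1-4)] by (simp add: eigen_def sc_0)

lemma Bsub_eq: "Bsub chi = subalg_gen (fiber chi) (cls ` fst ` {(env_e, 0), (env_x, 0), (env_h, c)})"
  by (simp add: Bsub_def cls_gens)

lemma Bchar_iff:
  "Bchar chi c \<rho> \<longleftrightarrow> alg_character ((fiber chi)\<lparr>carrier := Bsub chi\<rparr>) \<rho> \<and>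
     (\<forall>(u, d)\<in>{(env_e, 0), (env_x, 0), (env_h, c)}. \<rho> (cls u) = d)"
  by (simp add: Bchar_def cls_gens)

lemma Binduced_irreducible:
  assumes chi: "chi (rep_env (env_e ^ p)) = 0" "chi (rep_env (env_x ^ p)) = 0" "chi (rep_env (env_y ^ p)) \<noteq> 0"
    "c ^ p - c = chi (rep_env (env_h ^ p - env_h))"
  shows "\<exists>\<rho>. Bchar chi c \<rho>"
    and "Bchar chi c \<rho> \<Longrightarrow> the_irreducible_module TYPE('w) (fiber chi) (p\<^sup>2) (Binduced chi \<rho>)"
proof -
  show "\<exists>\<rho>. Bchar chi c \<rho>"
    unfolding Bchar_iff Bsub_eq[of c] by (rule eigen_character_exists[OF B_vector[OF chi]])
  assume \<rho>: "Bchar chi c \<rho>"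
  have "frame env_f env_y J" if "point_ideal J" "eigen {(env_e, 0), (env_x, 0), (env_h, c)} J" for J
    using frame_highest_weight[OF that(1) _ _ _ chi(3)] that(2) by (auto simp: eigen_def sc_0)
  then show "the_irreducible_module TYPE('w) (fiber chi) (p\<^sup>2) (Binduced chi \<rho>)"
    using \<rho> unfolding Bchar_iff Binduced_def Bsub_eq[of c]
    by (intro the_irreducible_induced[OF B_vector[OF chi]]) auto
qed

end

theorem proposition2p3:
  fixes chi :: "'k::alg_closed_field Helem \<Rightarrow> 'k" and p :: nat
  assumes "CHAR('k) = p" and "p > 2"
    and "alg_character Zalg chi"
    and "chi (He [^]\<^bsub>Halg\<^esub> p) = 0"
  shows
    "(chi (Hx [^]\<^bsub>Halg\<^esub> p) \<noteq> 0 \<longrightarrow>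
        (\<exists>M :: ('k Helem set, ('k Helem set \<times> 'k \<Rightarrow>\<^sub>0 int) set) module.
           the_irreducible_module TYPE('w) (fiber chi) (p\<^sup>2) M) \<and>
        (\<exists>\<rho>. Nchar p chi \<rho>) \<and>
        (chi (Hf [^]\<^bsub>Halg\<^esub> p) \<noteq> 0 \<or> chi (Hy [^]\<^bsub>Halg\<^esub> p) \<noteq> 0 \<longrightarrow>
          (\<forall>\<rho>. Nchar p chi \<rho> \<longrightarrow>
             the_irreducible_module TYPE('w) (fiber chi) (p\<^sup>2) (Ninduced chi \<rho>))))
     \<and> (chi (Hx [^]\<^bsub>Halg\<^esub> p) = 0 \<and> chi (Hy [^]\<^bsub>Halg\<^esub> p) \<noteq> 0 \<longrightarrow>
        (\<forall>c. c ^ p - c = chi (Hh [^]\<^bsub>Halg\<^esub> p \<ominus>\<^bsub>Halg\<^esub> Hh) \<longrightarrow>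
          (\<exists>\<rho>. Bchar chi c \<rho>) \<and>
          (\<forall>\<rho>. Bchar chi c \<rho> \<longrightarrow>
             the_irreducible_module TYPE('w) (fiber chi) (p\<^sup>2) (Binduced chi \<rho>))))
     \<and> (chi (Hx [^]\<^bsub>Halg\<^esub> p) = 0 \<and> chi (Hy [^]\<^bsub>Halg\<^esub> p) = 0 \<longrightarrow>
        (\<forall>W :: ('k Helem set, 'w) module.
           irreducible_module (fiber chi) W \<longrightarrow>
             irreducible_lie_module sl2 mat_scale mat_bracket (underlying_space (fiber chi) W)
               (\<lambda>A w. to_fiber chi (Hincl (A, 0)) \<odot>\<^bsub>W\<^esub> w) \<and>
             (\<forall>w\<in>carrier W. to_fiber chi Hx \<odot>\<^bsub>W\<^esub> w = \<zero>\<^bsub>W\<^esub> \<and>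
                              to_fiber chi Hy \<odot>\<^bsub>W\<^esub> w = \<zero>\<^bsub>W\<^esub>)))"
proof -
  interpret central_character chi p
    using assms(1-3) by unfold_locales
  have e: "chi (rep_env (env_e ^ p)) = 0" using assms(4) by (simp only: chi_powers)
  show ?thesis
    unfolding chi_powers
  proof (intro conjI impI allI ballI; (elim conjE)?)
    assume x: "chi (rep_env (env_x ^ p)) \<noteq> 0"
    show "\<exists>M :: ('k Helem set, ('k Helem set \<times> 'k \<Rightarrow>\<^sub>0 int) set) module.
        the_irreducible_module TYPE('w) (fiber chi) (p\<^sup>2) M"
      by (rule x_invertible_irreducible[OF e x])
    show "\<exists>\<rho>. Nchar p chi \<rho>" by (rule Nchar_exists)
    show "the_irreducible_module TYPE('w) (fiber chi) (p\<^sup>2) (Ninduced chi \<rho>)"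
      if "chi (rep_env (env_f ^ p)) \<noteq> 0 \<or> chi (rep_env (env_y ^ p)) \<noteq> 0" "Nchar p chi \<rho>" for \<rho>
      by (rule Ninduced_irreducible[OF x that])
  next
    fix c \<rho>
    assume B: "c ^ p - c = chi (rep_env (env_h ^ p - env_h))"
      "chi (rep_env (env_x ^ p)) = 0" "chi (rep_env (env_y ^ p)) \<noteq> 0"
    show "\<exists>\<rho>. Bchar chi c \<rho>" by (rule Binduced_irreducible(1)[OF e B(2,3,1)])
    show "the_irreducible_module TYPE('w) (fiber chi) (p\<^sup>2) (Binduced chi \<rho>)" if "Bchar chi c \<rho>"
      by (rule Binduced_irreducible(2)[OF e B(2,3,1) that])
  next
    fix W :: "('k Helem set, 'w) module"
    assume irr: "irreducible_module (fiber chi) W"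
      and V: "chi (rep_env (env_x ^ p)) = 0" "chi (rep_env (env_y ^ p)) = 0"
    show "irreducible_lie_module sl2 mat_scale mat_bracket (underlying_space (fiber chi) W)
        (\<lambda>A w. to_fiber chi (Hincl (A, 0)) \<odot>\<^bsub>W\<^esub> w)"
      by (rule irreducible_sl2[OF irr V])
    fix w assume "w \<in> carrier W"
    from irreducible_V_trivial[OF irr V this]
    show "to_fiber chi Hx \<odot>\<^bsub>W\<^esub> w = \<zero>\<^bsub>W\<^esub>" "to_fiber chi Hy \<odot>\<^bsub>W\<^esub> w = \<zero>\<^bsub>W\<^esub>"
      by (simp_all add: cls_gens)
  qed
qed

end
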